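(* For all $k\geq 3$, $$\rho_k=\lim_{N\to\infty}\sqrt[N]{|P_{k,N}|}=2k-3$$ (in particular the limit exists). Moreover, for every $k\ge 3$ there are positive constants $c_k$ and $C_k$ such that for all integers $N\ge 1$ $$c_k\cdot N\cdot(2k-3)^N\leq |P_{k,N}|\leq C_k\cdot N\cdot(2k-3)^N .$$
   Context: $F_k$ is the free group on the $k$ generators $X=\{x_1,\dots,x_k\}$; its elements are represented by reduced words in the alphabet $X^{\pm1}=\{x_1^{\pm1},\dots,x_k^{\pm1}\}$, and the length of an element is the length of its reduced word. An element of $F_k$ is called primitive if it belongs to some free generating set (basis) of $F_k$. $P_{k,N}$ denotes the set of primitive elements of $F_k$ of word length exactly $N$, and $\rho_k=\limsup_{N\to\infty}\sqrt[N]{|P_{k,N}|}$. *)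

theory Defs
  imports Complex_Main "HOL-Library.Extended_Real" "HOL-Algebra.Generated_Groups"
begin

section \<open>Reduced words\<close>

text \<open>The letter \<open>(a, True)\<close> stands for \<open>a\<close> and \<open>(a, False)\<close> for its formal inverse.\<close>

type_synonym 'a letter = "'a \<times> bool"
type_synonym 'a word = "'a letter list"

definition inv_letter :: "'a letter \<Rightarrow> 'a letter" where
  "inv_letter x = (fst x, \<not> snd x)"

definition reduced :: "'a word \<Rightarrow> bool" where
  "reduced w \<longleftrightarrow> successively (\<lambda>x y. y \<noteq> inv_letter x) w"

definition reduced_words :: "'a set \<Rightarrow> 'a word set" where
  "reduced_words A = {w. fst ` set w \<subseteq> A \<and> reduced w}"

fun cons_reduced :: "'a letter \<Rightarrow> 'a word \<Rightarrow> 'a word" where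
  "cons_reduced x [] = [x]"
| "cons_reduced x (y # w) = (if y = inv_letter x then w else x # y # w)"

definition reduce :: "'a word \<Rightarrow> 'a word" where
  "reduce w = foldr cons_reduced w []"


section \<open>Free groups, bases and primitive elements\<close>

definition free_group :: "'a set \<Rightarrow> 'a word monoid" where
  "free_group A =
     \<lparr>carrier = reduced_words A, mult = (\<lambda>u v. reduce (u @ v)), one = []\<rparr>"

definition word_value :: "('g, 'm) monoid_scheme \<Rightarrow> 'g word \<Rightarrow> 'g" where
  "word_value G w =
     foldr (\<lambda>(g, e) h. (if e then g else inv\<^bsub>G\<^esub> g) \<otimes>\<^bsub>G\<^esub> h) w \<one>\<^bsub>G\<^esub>"

text \<open>
  A basis of a group is a generating set satisfying no nontrivial relation.  Words are
  reduced with respect to formal inversion of letters only; in particular no basis contains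
  the identity, or both an element and its inverse.
\<close>

definition is_basis :: "('g, 'm) monoid_scheme \<Rightarrow> 'g set \<Rightarrow> bool" where
  "is_basis G S \<longleftrightarrow>
     S \<subseteq> carrier G \<and> generate G S = carrier G \<and>
     (\<forall>w \<in> reduced_words S. w \<noteq> [] \<longrightarrow> word_value G w \<noteq> \<one>\<^bsub>G\<^esub>)"

definition primitive :: "('g, 'm) monoid_scheme \<Rightarrow> 'g \<Rightarrow> bool" where
  "primitive G g \<longleftrightarrow> (\<exists>S. is_basis G S \<and> g \<in> S)"

abbreviation F :: "nat \<Rightarrow> nat word monoid" where
  "F k \<equiv> free_group {1..k}"

definition P :: "nat \<Rightarrow> nat \<Rightarrow> nat word set" where
  "P k N = {w \<in> carrier (F k). primitive (F k) w \<and> length w = N}"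

definition rho :: "nat \<Rightarrow> ereal" where
  "rho k = limsup (\<lambda>N. ereal (root N (real (card (P k N)))))"


section \<open>Basic facts\<close>

lemma inv_letter_inv_letter [simp]: "inv_letter (inv_letter x) = x"
  by (simp add: inv_letter_def)

lemma fst_inv_letter [simp]: "fst (inv_letter x) = fst x"
  by (simp add: inv_letter_def)

lemma inv_letter_neq [simp]: "inv_letter x \<noteq> x" "x \<noteq> inv_letter x"
  by (metis inv_letter_def snd_conv)+

lemma reduced_Nil [simp]: "reduced []"
  by (simp add: reduced_def)

lemma reduced_ConsD: "reduced (x # w) \<Longrightarrow> reduced w"
  by (cases w) (auto simp: reduced_def)

lemma reduced_cons_reduced: "reduced w \<Longrightarrow> reduced (cons_reduced x w)"
  by (cases w) (auto simp: reduced_def dest: reduced_ConsD[unfolded reduced_def])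

lemma cons_reduced_eq_Cons: "reduced (x # w) \<Longrightarrow> cons_reduced x w = x # w"
  by (cases w) (auto simp: reduced_def)

lemma cons_reduced_cancel:
  assumes "reduced w"
  shows "cons_reduced x (cons_reduced (inv_letter x) w) = w"
proof (cases w)
  case (Cons y v)
  then show ?thesis
    using assms cons_reduced_eq_Cons[of y v] by auto
qed simp

lemma reduced_foldr: "reduced v \<Longrightarrow> reduced (foldr cons_reduced u v)"
  by (induction u) (auto intro: reduced_cons_reduced)

lemma reduced_reduce: "reduced (reduce w)"
  by (simp add: reduce_def reduced_foldr)

lemma reduce_eq_self: "reduced w \<Longrightarrow> reduce w = w"
proof (induction w)
  case (Cons x w)
  then show ?case
    using reduced_ConsD[of x w] cons_reduced_eq_Cons[of x w] by (simp add: reduce_def)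
qed (simp add: reduce_def)

lemma foldr_cons_reduced:
  assumes "reduced v"
  shows "foldr cons_reduced (cons_reduced x u) v = cons_reduced x (foldr cons_reduced u v)"
proof (cases u)
  case (Cons y u')
  then show ?thesis
    using cons_reduced_cancel[OF reduced_foldr[OF assms]] by auto
qed simp

lemma foldr_reduce:
  "reduced v \<Longrightarrow> foldr cons_reduced (reduce u) v = foldr cons_reduced u v"
  by (induction u) (auto simp: reduce_def foldr_cons_reduced)

lemma reduce_append_reduce:
  "reduce (reduce u @ v) = reduce (u @ v)" "reduce (u @ reduce v) = reduce (u @ v)"
proof -
  have "foldr cons_reduced v [] = reduce v"
    by (simp add: reduce_def)
  moreover have "foldr cons_reduced (reduce v) [] = reduce v"
    using reduce_eq_self[OF reduced_reduce] by (simp add: reduce_def)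
  ultimately show "reduce (reduce u @ v) = reduce (u @ v)" "reduce (u @ reduce v) = reduce (u @ v)"
    by (simp_all add: reduce_def[of "_ @ _"] foldr_reduce reduced_reduce)
qed

lemma set_reduce: "set (reduce w) \<subseteq> set w"
proof -
  have *: "set (cons_reduced x u) \<subseteq> insert x (set u)" for x :: "'a letter" and u
    by (cases u) auto
  show ?thesis
    unfolding reduce_def
  proof (induction w)
    case (Cons x w)
    then show ?case
      using *[of x "foldr cons_reduced w []"] by auto
  qed simp
qed

lemma reduce_in_reduced_words: "fst ` set w \<subseteq> A \<Longrightarrow> reduce w \<in> reduced_words A"
  using set_reduce[of w] by (auto simp: reduced_words_def reduced_reduce)

definition inv_word :: "'a word \<Rightarrow> 'a word" where
  "inv_word w = rev (map inv_letter w)"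

lemma inv_word_in_reduced_words:
  assumes "w \<in> reduced_words A"
  shows "inv_word w \<in> reduced_words A"
proof -
  have "reduced (inv_word w)"
    using assms unfolding inv_word_def reduced_def reduced_words_def
    by (auto simp: successively_map elim!: successively_mono)
  then show ?thesis
    using assms by (auto simp: reduced_words_def inv_word_def)
qed

lemma reduce_inv_word: "reduce (inv_word w @ w) = []"
proof -
  have "foldr cons_reduced (inv_word w) (foldr cons_reduced w v) = v" if "reduced v" for v
    using that
  proof (induction w arbitrary: v)
    case (Cons x w)
    then show ?case
      using cons_reduced_cancel[OF reduced_foldr[OF Cons.prems], of "inv_letter x" w]
      by (simp add: inv_word_def)
  qed (simp add: inv_word_def)
  then show ?thesis
    by (simp add: reduce_def)
qed

lemma group_free_group: "group (free_group A)"
proof (rule groupI)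
  fix u v w assume "u \<in> carrier (free_group A)" "v \<in> carrier (free_group A)"
    "w \<in> carrier (free_group A)"
  then show "u \<otimes>\<^bsub>free_group A\<^esub> v \<otimes>\<^bsub>free_group A\<^esub> w
      = u \<otimes>\<^bsub>free_group A\<^esub> (v \<otimes>\<^bsub>free_group A\<^esub> w)"
    by (simp add: free_group_def reduce_append_reduce)
next
  fix w assume "w \<in> carrier (free_group A)"
  then show "\<exists>v \<in> carrier (free_group A). v \<otimes>\<^bsub>free_group A\<^esub> w = \<one>\<^bsub>free_group A\<^esub>"
    using inv_word_in_reduced_words reduce_inv_word by (fastforce simp: free_group_def)
next
  fix u v assume "u \<in> carrier (free_group A)" "v \<in> carrier (free_group A)"
  then have "fst ` set (u @ v) \<subseteq> A"
    by (auto simp: free_group_def reduced_words_def)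
  then show "u \<otimes>\<^bsub>free_group A\<^esub> v \<in> carrier (free_group A)"
    by (simp add: free_group_def reduce_in_reduced_words)
qed (auto simp: free_group_def reduced_words_def reduce_eq_self)

lemma letter_in_free_group: "a \<in> A \<Longrightarrow> [(a, e)] \<in> carrier (free_group A)"
  by (simp add: free_group_def reduced_words_def reduced_def)

lemma inv_generator:
  assumes "a \<in> A"
  shows "inv\<^bsub>free_group A\<^esub> [(a, True)] = [(a, False)]"
proof -
  interpret group "free_group A"
    by (rule group_free_group)
  show ?thesis
    using assms
    by (intro inv_equality) (auto simp: letter_in_free_group,
        simp add: free_group_def reduce_def inv_letter_def)
qed

lemma generate_generators:
  "generate (free_group A) ((\<lambda>a. [(a, True)]) ` A) = carrier (free_group A)"
    (is "generate ?G ?S = _")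
proof
  interpret group ?G
    by (rule group_free_group)
  show "generate ?G ?S \<subseteq> carrier ?G"
    by (rule generate_incl) (auto intro: letter_in_free_group)
  have "w \<in> generate ?G ?S" if "w \<in> reduced_words A" for w
    using that
  proof (induction w)
    case Nil
    then show ?case
      using generate.one[of ?G ?S] by (simp add: free_group_def)
  next
    case (Cons x w)
    obtain a e where x: "x = (a, e)" "a \<in> A"
      using Cons.prems by (cases x) (auto simp: reduced_words_def)
    have "[x] \<in> generate ?G ?S"
    proof (cases e)
      case True
      then show ?thesis
        using x by (auto intro: generate.incl)
    next
      case False
      then have "[x] = inv\<^bsub>?G\<^esub> [(a, True)]"
        using x by (simp add: inv_generator)
      then show ?thesis
        using x generate.inv[of "[(a, True)]" ?S ?G] by simp
    qed
    moreover have "w \<in> generate ?G ?S"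
      using Cons reduced_ConsD[of x w] by (auto simp: reduced_words_def)
    moreover have "[x] \<otimes>\<^bsub>?G\<^esub> w = x # w"
      using Cons.prems reduce_eq_self[of "x # w"]
      by (simp add: free_group_def reduced_words_def)
    ultimately show ?case
      using generate.eng[of "[x]" ?G ?S w] by simp
  qed
  then show "carrier ?G \<subseteq> generate ?G ?S"
    by (auto simp: free_group_def)
qed

lemma is_basis_generators: "is_basis (free_group A) ((\<lambda>a. [(a, True)]) ` A)"
    (is "is_basis ?G ?S")
proof -
  have val: "word_value ?G w = reduce (map (\<lambda>(g, e). (fst (hd g), e)) w)"
    if "fst ` set w \<subseteq> ?S" for w
    using that
  proof (induction w)
    case Nil
    then show ?case
      by (simp add: word_value_def free_group_def reduce_def)
  next
    case (Cons x w)
    then obtain a e where x: "x = ([(a, True)], e)" "a \<in> A"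
      by (cases x) auto
    have "word_value ?G (x # w) = [(a, e)] \<otimes>\<^bsub>?G\<^esub> word_value ?G w"
      using x by (simp add: word_value_def inv_generator)
    also have "\<dots> = reduce ([(a, e)] @ reduce (map (\<lambda>(g, e). (fst (hd g), e)) w))"
      using Cons by (simp add: free_group_def)
    finally show ?case
      using x by (simp only: reduce_append_reduce) simp
  qed
  have "word_value ?G w \<noteq> []" if w: "w \<in> reduced_words ?S" "w \<noteq> []" for w
  proof -
    let ?w = "map (\<lambda>(g, e). (fst (hd g), e)) w"
    have "successively (\<lambda>x y. y \<noteq> inv_letter x) ?w"
      unfolding successively_map
    proof (rule successively_mono)
      show "successively (\<lambda>x y. y \<noteq> inv_letter x) w"
        using w by (simp add: reduced_words_def reduced_def)
      fix x y assume xy: "x \<in> set w" "y \<in> set w" "y \<noteq> inv_letter x"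
      have "fst x \<in> ?S" "fst y \<in> ?S"
        using w xy by (auto simp: reduced_words_def)
      then obtain a b where "fst x = [(a, True)]" "fst y = [(b, True)]"
        by blast
      with xy(3) show "(case y of (g, e) \<Rightarrow> (fst (hd g), e))
          \<noteq> inv_letter (case x of (g, e) \<Rightarrow> (fst (hd g), e))"
        by (cases x; cases y) (simp add: inv_letter_def)
    qed
    then have "reduce ?w = ?w"
      by (intro reduce_eq_self) (simp add: reduced_def)
    then show ?thesis
      using val[of w] w by (simp add: reduced_words_def)
  qed
  moreover have "?S \<subseteq> carrier ?G"
    by (auto intro: letter_in_free_group)
  ultimately show ?thesis
    by (simp add: is_basis_def generate_generators) (simp add: free_group_def)
qed

lemma finite_P: "finite (P k N)"
proof (rule finite_subset)
  show "P k N \<subseteq> {w. set w \<subseteq> {1..k} \<times> UNIV \<and> length w = N}"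
    by (force simp: P_def free_group_def reduced_words_def)
  show "finite {w. set w \<subseteq> {1..k} \<times> (UNIV :: bool set) \<and> length w = N}"
    by (rule finite_lists_length_eq) simp
qed

end

theory Submission
  imports Defs "HOL-Library.Multiset"
begin

text \<open>
  Lower bound: the words in which one fixed generator occurs exactly once are primitive.

  Upper bound: let \<open>S\<close> be a basis containing the cyclically reduced word \<open>w\<close>, and let \<open>U\<close> be the
  set of elements whose normal form over \<open>S\<close> starts with some fixed \<open>s \<noteq> w\<close>. Then \<open>U\<close> has
  finite boundary in the Cayley tree and both ends of every line \<open>h w\<^sup>n\<close> lie on the same side of
  it. If \<open>U\<close> is changed by a finite set so that its boundary becomes minimal, then at a vertex
  below which the boundary is deepest no line joins the two sides, which is Whitehead's cut vertex
  lemma. The Whitehead automorphism of the cut shortens \<open>w\<close> by the number \<open>r\<close> of edges of the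
  Whitehead graph that lead from the cut off side \<open>Y\<close> to the cut vertex.
  If \<open>r\<close> is large, then \<open>w\<close> arises in boundedly many ways from a much shorter primitive word, so
  these words contribute a contraction to an induction on the length. If \<open>r\<close> is bounded, then
  only boundedly many transitions in \<open>w\<close> run between \<open>Y\<close> and its complement. The growth of such
  words is less than \<open>2k - 3\<close> unless some generator \<open>i\<close> occurs in boundedly many blocks only. In
  the latter case \<open>w\<close> either misses a transition between the other generators, which again makes
  the growth smaller, or every cut of \<open>w\<close> is at \<open>i\<close>. Then \<open>w\<close> has one block, with an explicit
  count, or the reduction shortens \<open>w\<close> by at least the number of letters \<open>i\<close> or by 4, which gives
  another contraction.
\<close>

section \<open>Free reduction and substitutions\<close>

text \<open>The base \<open>2k - 3 = 2(k - 1) - 1\<close> is the growth of the free group of rank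
  \<open>k - 1\<close>. The factor \<open>N\<close> counts the places of the single letter in the
  lower bound and the rotations that bring a letter \<open>i\<close> to the front in the upper
  bound. Words that are not cyclically reduced cost only a constant factor: a conjugator of length
  \<open>m\<close> has about \<open>(2k - 1)^m\<close> choices but uses up \<open>2m\<close>
  letters, and \<open>2k - 1 < (2k - 3)^2\<close> for \<open>k \<ge> 3\<close>. The obstacle is that
  a shortening by \<open>r\<close> contracts only if few longer words arise from a shorter one
  compared with \<open>(2k - 3)^r\<close>. Admitting every side and every vertex is affordable for
  large \<open>r\<close> only. For small \<open>r\<close> the cuts have to be known exactly: in a
  generic word they have \<open>2k - 2\<close> possible vertices and three possible sides. At
  \<open>k = 3\<close> even this leaves little room. Hence the number of letters \<open>i\<close>,
  which these reductions preserve, is separated into the value 2 and the values from 3 on, and the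
  words are made to start with \<open>i\<close>, because an undetermined rotation would double the
  weights.\<close>

lemma reduce_Nil [simp]: "reduce [] = []"
  by (simp add: reduce_def)

lemma reduce_idem [simp]: "reduce (reduce w) = reduce w"
  by (simp add: reduce_eq_self reduced_reduce)

lemma reduce_append_cong:
  "reduce u = reduce u' \<Longrightarrow> reduce v = reduce v' \<Longrightarrow> reduce (u @ v) = reduce (u' @ v')"
  by (metis reduce_append_reduce)

lemma inv_word_Nil [simp]: "inv_word [] = []"
  by (simp add: inv_word_def)

lemma inv_word_Cons [simp]: "inv_word (x # w) = inv_word w @ [inv_letter x]"
  by (simp add: inv_word_def)

lemma inv_word_append [simp]: "inv_word (u @ v) = inv_word v @ inv_word u"
  by (simp add: inv_word_def)

lemma inv_word_inv_word [simp]: "inv_word (inv_word w) = w"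
  by (induction w) auto

lemma length_inv_word [simp]: "length (inv_word w) = length w"
  by (simp add: inv_word_def)

lemma reduce_inv_word_right: "reduce (w @ inv_word w) = []"
  using reduce_inv_word[of "inv_word w"] by simp

lemma reduce_append_inv_word_cancel [simp]:
  "reduce (u @ inv_word w @ w @ v) = reduce (u @ v)"
  "reduce (u @ w @ inv_word w @ v) = reduce (u @ v)"
  "reduce (inv_word w @ w @ v) = reduce v"
  "reduce (w @ inv_word w @ v) = reduce v"
proof -
  have 1: "reduce ((inv_word w @ w) @ v) = reduce ([] @ v)" for w v :: "'a word"
    by (intro reduce_append_cong) (simp_all add: reduce_inv_word)
  then have 2: "reduce ((w @ inv_word w) @ v) = reduce ([] @ v)" for w v :: "'a word"
    using 1[of "inv_word w"] by simp
  show "reduce (inv_word w @ w @ v) = reduce v" "reduce (w @ inv_word w @ v) = reduce v"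
    using 1 2 by simp_all
  then show "reduce (u @ inv_word w @ w @ v) = reduce (u @ v)"
    "reduce (u @ w @ inv_word w @ v) = reduce (u @ v)"
    by (auto intro: reduce_append_cong)
qed

lemma reduced_append_iff:
  "reduced (u @ v) \<longleftrightarrow>
     reduced u \<and> reduced v \<and> (u \<noteq> [] \<and> v \<noteq> [] \<longrightarrow> hd v \<noteq> inv_letter (last u))"
  by (auto simp: reduced_def successively_append_iff)

lemma reduced_Cons_iff:
  "reduced (x # w) \<longleftrightarrow> reduced w \<and> (w \<noteq> [] \<longrightarrow> hd w \<noteq> inv_letter x)"
  using reduced_append_iff[of "[x]" w] by (auto simp: reduced_def)

lemma reduced_single [simp]: "reduced [x]"
  by (simp add: reduced_def)

lemma inv_letter_eq_iff [simp]: "inv_letter x = inv_letter y \<longleftrightarrow> x = y"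
  by (metis inv_letter_inv_letter)

lemma inv_letter_swap: "inv_letter x = y \<longleftrightarrow> x = inv_letter y"
  by (metis inv_letter_inv_letter)

lemma reduced_inv_word [simp]: "reduced (inv_word w) \<longleftrightarrow> reduced w"
proof -
  have "reduced (inv_word w)" if "reduced w" for w :: "'a word"
    using that inv_word_in_reduced_words[of w UNIV] by (simp add: reduced_words_def)
  then show ?thesis
    by (metis inv_word_inv_word)
qed

lemma inv_word_eq_Nil_iff [simp]: "inv_word w = [] \<longleftrightarrow> w = []"
  by (simp add: inv_word_def)

lemma hd_inv_word: "w \<noteq> [] \<Longrightarrow> hd (inv_word w) = inv_letter (last w)"
  by (simp add: inv_word_def hd_rev last_map)

lemma fst_set_inv_word [simp]: "fst ` set (inv_word w) = fst ` set w"
  by (auto simp: inv_word_def image_image)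

lemma reduce_inv_word_reduce: "inv_word (reduce w) = reduce (inv_word w)"
proof -
  have "reduce (inv_word w) = reduce (inv_word w @ w @ inv_word (reduce w))"
    using reduce_append_cong[of "inv_word w" "inv_word w" "w @ inv_word (reduce w)" "[]"]
      reduce_append_reduce(1)[of w "inv_word (reduce w)"]
    by (simp add: reduce_inv_word_right)
  then show ?thesis
    by (simp add: reduce_eq_self reduced_reduce)
qed

lemma reduced_append_cancel:
  assumes "reduced u" "reduced v"
  obtains u1 c v2 where "u = u1 @ c" "v = inv_word c @ v2" "reduce (u @ v) = u1 @ v2"
    "reduced (u1 @ v2)"
proof -
  have "\<exists>u1 c v2. u = u1 @ c \<and> v = inv_word c @ v2 \<and> reduced (u1 @ v2)"
    using assms
  proof (induction u arbitrary: v rule: rev_induct)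
    case (snoc x u)
    show ?case
    proof (cases "v \<noteq> [] \<and> hd v = inv_letter x")
      case True
      then obtain v' where v: "v = inv_letter x # v'"
        by (cases v) auto
      obtain u1 c v2 where "u = u1 @ c" "v' = inv_word c @ v2" "reduced (u1 @ v2)"
        using snoc v by (metis reduced_append_iff reduced_ConsD)
      then show ?thesis
        using v by (intro exI[of _ u1] exI[of _ "c @ [x]"] exI[of _ v2]) simp
    next
      case False
      then show ?thesis
        using snoc.prems reduced_append_iff[of "u @ [x]" v]
        by (intro exI[of _ "u @ [x]"] exI[of _ "[]"] exI[of _ v]) auto
    qed
  qed simp
  then obtain u1 c v2 where *: "u = u1 @ c" "v = inv_word c @ v2" "reduced (u1 @ v2)"
    by blast
  moreover have "reduce (u @ v) = u1 @ v2"
    using * by (simp add: reduce_eq_self)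
  ultimately show ?thesis
    using that by blast
qed

definition subst :: "('a letter \<Rightarrow> 'b word) \<Rightarrow> 'a word \<Rightarrow> 'b word" where
  "subst f w = concat (map f w)"

lemma subst_simps [simp]:
  "subst f [] = []" "subst f (x # w) = f x @ subst f w"
  "subst f (u @ v) = subst f u @ subst f v"
  by (simp_all add: subst_def)

text \<open>Substitutions prescribe images for both signs of a generator; this condition makes them
  respect the cancellation of a letter against its inverse, so that they induce
  homomorphisms.\<close>

definition inv_compatible :: "('a letter \<Rightarrow> 'b word) \<Rightarrow> bool" where
  "inv_compatible f \<longleftrightarrow> (\<forall>x. f (inv_letter x) = inv_word (f x))"

lemma reduce_subst_reduce:
  assumes inv: "inv_compatible f"
  shows "reduce (subst f (reduce w)) = reduce (subst f w)"
proof (induction w)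
  case (Cons x w)
  have *: "reduce (subst f (cons_reduced x u)) = reduce (f x @ subst f u)" for u
    using inv by (cases u) (auto simp: inv_compatible_def simp del: split_paired_All)
  have "reduce (subst f (reduce (x # w))) = reduce (f x @ subst f (reduce w))"
    using * by (simp add: reduce_def)
  also have "\<dots> = reduce (f x @ subst f w)"
    using Cons by (intro reduce_append_cong) auto
  finally show ?case
    by simp
qed simp

lemma reduce_subst_subst:
  assumes inv: "inv_compatible f"
    and fg: "\<And>x. x \<in> set w \<Longrightarrow> reduce (subst f (g x)) = [x]"
  shows "reduce (subst f (reduce (subst g w))) = reduce w"
proof -
  have "reduce (subst f (subst g w)) = reduce w"
    using fg
  proof (induction w)
    case (Cons x w)
    have "reduce (subst f (g x) @ subst f (subst g w)) = reduce ([x] @ w)"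
      using Cons by (intro reduce_append_cong) (auto simp: reduce_eq_self)
    then show ?case
      by simp
  qed simp
  then show ?thesis
    by (simp add: reduce_subst_reduce[OF inv])
qed

definition subst_hom :: "('a letter \<Rightarrow> 'b word) \<Rightarrow> 'a word \<Rightarrow> 'b word" where
  "subst_hom f w = reduce (subst f w)"

lemma set_subst: "set (subst f w) = (\<Union>x\<in>set w. set (f x))"
  by (simp add: subst_def)

lemma subst_hom_hom:
  assumes inv: "inv_compatible f"
    and closed: "\<And>x. fst x \<in> A \<Longrightarrow> fst ` set (f x) \<subseteq> B"
  shows "subst_hom f \<in> hom (free_group A) (free_group B)"
proof (rule homI)
  fix u assume "u \<in> carrier (free_group A)"
  then have "fst ` set (subst f u) \<subseteq> B"
    using closed by (fastforce simp: free_group_def reduced_words_def set_subst)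
  then show "subst_hom f u \<in> carrier (free_group B)"
    by (simp add: subst_hom_def free_group_def reduce_in_reduced_words)
next
  fix u v
  show "subst_hom f (u \<otimes>\<^bsub>free_group A\<^esub> v) = subst_hom f u \<otimes>\<^bsub>free_group B\<^esub> subst_hom f v"
    by (simp add: subst_hom_def free_group_def reduce_subst_reduce[OF inv] reduce_append_reduce)
qed

lemma subst_hom_iso:
  assumes f: "inv_compatible f"
    and g: "inv_compatible g"
    and fA: "\<And>x. fst x \<in> A \<Longrightarrow> fst ` set (f x) \<subseteq> A"
    and gA: "\<And>x. fst x \<in> A \<Longrightarrow> fst ` set (g x) \<subseteq> A"
    and fg: "\<And>x. fst x \<in> A \<Longrightarrow> reduce (subst f (g x)) = [x]"
    and gf: "\<And>x. fst x \<in> A \<Longrightarrow> reduce (subst g (f x)) = [x]"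
  shows "subst_hom f \<in> iso (free_group A) (free_group A)"
proof -
  have hf: "subst_hom f \<in> hom (free_group A) (free_group A)"
    using f fA by (rule subst_hom_hom)
  have hg: "subst_hom g \<in> hom (free_group A) (free_group A)"
    using g gA by (rule subst_hom_hom)
  have "bij_betw (subst_hom f) (carrier (free_group A)) (carrier (free_group A))"
  proof (rule bij_betw_byWitness[where f' = "subst_hom g"])
    show "\<forall>a\<in>carrier (free_group A). subst_hom g (subst_hom f a) = a"
      unfolding subst_hom_def free_group_def reduced_words_def
      by (auto simp: reduce_eq_self intro!: gf trans[OF reduce_subst_subst[OF g]])
    show "\<forall>a\<in>carrier (free_group A). subst_hom f (subst_hom g a) = a"
      unfolding subst_hom_def free_group_def reduced_words_def
      by (auto simp: reduce_eq_self intro!: fg trans[OF reduce_subst_subst[OF f]])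
  qed (use hf hg in \<open>auto simp: hom_def\<close>)
  then show ?thesis
    using hf by (simp add: iso_def)
qed

section \<open>Bases\<close>

lemma (in group) word_value_Nil [simp]: "word_value G [] = \<one>"
  by (simp add: word_value_def)

lemma (in group) word_value_Cons:
  "word_value G (x # w) = (if snd x then fst x else inv fst x) \<otimes> word_value G w"
  by (cases x) (simp add: word_value_def)

lemma (in group) word_value_closed [simp]:
  "fst ` set w \<subseteq> carrier G \<Longrightarrow> word_value G w \<in> carrier G"
  by (induction w) (auto simp: word_value_Cons)

lemma (in group) word_value_append:
  "fst ` set u \<subseteq> carrier G \<Longrightarrow> fst ` set v \<subseteq> carrier G \<Longrightarrow>
    word_value G (u @ v) = word_value G u \<otimes> word_value G v"
  by (induction u) (auto simp: word_value_Cons m_assoc)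

lemma (in group) word_value_cons_reduced:
  "fst x \<in> carrier G \<Longrightarrow> fst ` set w \<subseteq> carrier G \<Longrightarrow>
    word_value G (cons_reduced x w) = word_value G (x # w)"
  by (cases w) (auto simp: word_value_Cons inv_letter_def m_assoc[symmetric])

lemma (in group) word_value_reduce:
  assumes "fst ` set w \<subseteq> carrier G"
  shows "word_value G (reduce w) = word_value G w"
  using assms
proof (induction w)
  case (Cons x w)
  have "fst ` set (foldr cons_reduced w []) \<subseteq> carrier G"
    using Cons.prems set_reduce[of w] by (auto simp: reduce_def)
  then show ?case
    using Cons by (auto simp: reduce_def word_value_cons_reduced word_value_Cons)
qed simp

lemma (in group) word_value_inv_word:
  assumes "fst ` set w \<subseteq> carrier G"
  shows "word_value G (inv_word w) = inv (word_value G w)"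
proof (rule inv_equality[symmetric])
  show "word_value G (inv_word w) \<otimes> word_value G w = \<one>"
    using assms word_value_reduce[of "inv_word w @ w"] fst_set_inv_word[of w]
    by (simp add: word_value_append[symmetric] reduce_inv_word image_Un del: fst_set_inv_word)
qed (use assms in auto)

lemma (in group_hom) word_value_map:
  "fst ` set w \<subseteq> carrier G \<Longrightarrow> word_value H (map (map_prod h id) w) = h (word_value G w)"
  by (induction w) (auto simp: G.word_value_Cons H.word_value_Cons)

lemma is_basis_iso:
  assumes "group G" "group H" "h \<in> iso G H" "is_basis G S"
  shows "is_basis H (h ` S)"
proof -
  interpret group_hom G H h
    using assms by (simp add: group_hom_def group_hom_axioms_def iso_def)
  have bij: "bij_betw h (carrier G) (carrier H)"
    using assms by (simp add: iso_def)
  then have inj: "inj_on h (carrier G)"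
    by (rule bij_betw_imp_inj_on)
  have S: "S \<subseteq> carrier G" "generate G S = carrier G"
    "\<And>w. w \<in> reduced_words S \<Longrightarrow> w \<noteq> [] \<Longrightarrow> word_value G w \<noteq> \<one>\<^bsub>G\<^esub>"
    using assms by (auto simp: is_basis_def)
  have "generate H (h ` S) = carrier H"
    using generate_img[OF S(1)] S(2) bij_betw_imp_surj_on[OF bij] by simp
  moreover have "word_value H w \<noteq> \<one>\<^bsub>H\<^esub>" if w: "w \<in> reduced_words (h ` S)" "w \<noteq> []" for w
  proof -
    define g where "g = inv_into S h"
    define u where "u = map (map_prod g id) w"
    have injS: "inj_on h S"
      using inj S(1) by (rule inj_on_subset)
    have wS: "fst ` set w \<subseteq> h ` S"
      using w by (auto simp: reduced_words_def)
    have hu: "map (map_prod h id) u = w"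
      unfolding u_def map_map
    proof (rule map_idI)
      fix x assume "x \<in> set w"
      then have "fst x \<in> h ` S"
        using wS by blast
      then show "(map_prod h id \<circ> map_prod g id) x = x"
        by (cases x) (auto simp: g_def f_inv_into_f)
    qed
    have uS: "fst ` set u \<subseteq> S"
      using wS by (force simp: u_def g_def inv_into_into)
    \<comment> \<open>\<open>g\<close> inverts \<open>h\<close> on the letters of \<open>w\<close>,
      hence is injective there and cannot create a cancelling pair.\<close>
    have "reduced u"
      using w unfolding reduced_words_def reduced_def u_def
      by (auto simp: successively_map inv_letter_def map_prod_def split: prod.splits
          elim!: successively_mono)
        (metis g_def fst_conv image_eqI image_subset_iff inv_into_injective wS)+
    then have "word_value G u \<noteq> \<one>\<^bsub>G\<^esub>"
      using S(3)[of u] uS w(2) by (auto simp: reduced_words_def u_def)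
    moreover have "word_value G u \<in> carrier G"
      using uS S(1) by auto
    ultimately have "h (word_value G u) \<noteq> \<one>\<^bsub>H\<^esub>"
      using inj by (metis G.one_closed hom_one inj_on_eq_iff)
    then show ?thesis
      using word_value_map[of u] uS S(1) hu by auto
  qed
  ultimately show ?thesis
    using S(1) by (auto simp: is_basis_def)
qed

lemma primitive_iso:
  assumes "group G" "group H" "h \<in> iso G H" "primitive G g"
  shows "primitive H (h g)"
  using assms is_basis_iso unfolding primitive_def by blast

lemma (in group) conj_iso:
  assumes "g \<in> carrier G"
  shows "(\<lambda>x. g \<otimes> x \<otimes> inv g) \<in> iso G G"
proof -
  have cancel: "g \<otimes> (inv g \<otimes> x) = x" "inv g \<otimes> (g \<otimes> x) = x" if "x \<in> carrier G" for x
    using that assms by (simp_all add: m_assoc[symmetric])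
  have "bij_betw (\<lambda>x. g \<otimes> x \<otimes> inv g) (carrier G) (carrier G)"
    by (rule bij_betw_byWitness[where f' = "\<lambda>x. inv g \<otimes> x \<otimes> g"])
      (use assms in \<open>auto simp: m_assoc cancel\<close>)
  then show ?thesis
    using assms by (auto simp: iso_def hom_def m_assoc cancel)
qed

lemma free_group_inv: "w \<in> carrier (free_group A) \<Longrightarrow> inv\<^bsub>free_group A\<^esub> w = inv_word w"
proof -
  assume w: "w \<in> carrier (free_group A)"
  interpret group "free_group A"
    by (rule group_free_group)
  show ?thesis
    using w inv_word_in_reduced_words[of w A]
    by (intro inv_equality) (auto simp: free_group_def reduce_inv_word)
qed

text \<open>Primitivity only makes sense for reduced words, so it is extended to all words along
  free reduction.\<close>

definition prim :: "nat \<Rightarrow> nat word \<Rightarrow> bool" where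
  "prim k w \<longleftrightarrow> fst ` set w \<subseteq> {1..k} \<and> primitive (F k) (reduce w)"

text \<open>Conjugation is an automorphism, and automorphisms carry bases to bases. The word
  \<open>u\<close> may fail to be reduced, so the conjugating element is
  \<open>reduce (inv_word u)\<close>.\<close>

lemma prim_conj:
  assumes "prim k (u @ w @ inv_word u)" "fst ` set w \<subseteq> {1..k}"
  shows "prim k w"
proof -
  interpret group "F k"
    by (rule group_free_group)
  have u: "fst ` set u \<subseteq> {1..k}"
    using assms by (auto simp: prim_def image_Un)
  then have ur: "reduce (inv_word u) \<in> carrier (F k)"
    using reduce_in_reduced_words[of "inv_word u" "{1..k}"] by (simp add: free_group_def)
  have "primitive (F k) (reduce (inv_word u) \<otimes>\<^bsub>F k\<^esub> reduce (u @ w @ inv_word u)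
      \<otimes>\<^bsub>F k\<^esub> inv\<^bsub>F k\<^esub> reduce (inv_word u))"
    using primitive_iso[OF group_free_group group_free_group conj_iso[OF ur]] assms
    by (simp add: prim_def)
  also have "reduce (inv_word u) \<otimes>\<^bsub>F k\<^esub> reduce (u @ w @ inv_word u)
      \<otimes>\<^bsub>F k\<^esub> inv\<^bsub>F k\<^esub> reduce (inv_word u)
      = reduce ((inv_word u @ u @ w @ inv_word u) @ inv_word (inv_word u))"
    using ur
    by (simp only: free_group_inv reduce_inv_word_reduce)
      (simp only: free_group_def monoid.simps reduce_append_reduce partial_object.simps)
  also have "\<dots> = reduce w"
    using reduce_append_inv_word_cancel(2)[of w "inv_word u" "[]"] by simp
  finally show ?thesis
    using assms(2) by (simp add: prim_def)
qed

lemma prim_rotate: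
  assumes "prim k (u @ v)" shows "prim k (v @ u)"
proof (rule prim_conj)
  have "reduce (u @ (v @ u) @ inv_word u) = reduce (u @ v)"
    using reduce_append_inv_word_cancel(2)[of "u @ v" u "[]"] by simp
  then show "prim k (u @ (v @ u) @ inv_word u)"
    using assms by (auto simp: prim_def image_Un)
  show "fst ` set (v @ u) \<subseteq> {1..k}"
    using assms by (auto simp: prim_def image_Un)
qed

lemma prim_subst:
  assumes "prim k w" and "subst_hom f \<in> iso (F k) (F k)"
    and "inv_compatible f"
  shows "primitive (F k) (reduce (subst f w))"
  using primitive_iso[OF group_free_group group_free_group assms(2), of "reduce w"] assms
  by (simp add: prim_def subst_hom_def reduce_subst_reduce)

section \<open>Normal forms over a basis and half-spaces\<close>

lemma (in group) word_value_bij_betw_basis: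
  assumes "is_basis G S"
  shows "bij_betw (word_value G) (reduced_words S) (carrier G)"
proof -
  have S: "S \<subseteq> carrier G" "generate G S = carrier G"
    "\<And>w. w \<in> reduced_words S \<Longrightarrow> w \<noteq> [] \<Longrightarrow> word_value G w \<noteq> \<one>"
    using assms by (auto simp: is_basis_def)
  have SG: "fst ` set w \<subseteq> carrier G" if "w \<in> reduced_words S" for w
    using that S(1) by (auto simp: reduced_words_def)
  \<comment> \<open>Words of equal value turn the reduced form of \<open>inv_word u @ v\<close> into
    a relation, and a basis admits only the empty one.\<close>
  have "inj_on (word_value G) (reduced_words S)"
  proof (rule inj_onI)
    fix u v assume uv: "u \<in> reduced_words S" "v \<in> reduced_words S"
      "word_value G u = word_value G v"
    have "word_value G (reduce (inv_word u @ v)) = word_value G (inv_word u @ v)"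
      using SG uv by (intro word_value_reduce) (auto simp: image_Un)
    also have "\<dots> = inv (word_value G u) \<otimes> word_value G v"
      using SG[OF uv(1)] SG[OF uv(2)] by (subst word_value_append) (auto simp: word_value_inv_word)
    also have "\<dots> = \<one>"
      using uv SG by simp
    finally have "word_value G (reduce (inv_word u @ v)) = \<one>" .
    moreover have "reduce (inv_word u @ v) \<in> reduced_words S"
      using uv by (intro reduce_in_reduced_words) (auto simp: reduced_words_def image_Un)
    ultimately have *: "reduce (inv_word u @ v) = []"
      using S(3) by blast
    have "reduce v = reduce (u @ inv_word u @ v)"
      by simp
    also have "\<dots> = reduce u"
      using reduce_append_cong[of u u "inv_word u @ v" "[]"] * by simp
    finally show "u = v"
      using uv by (simp add: reduced_words_def reduce_eq_self)
  qed
  moreover have "g \<in> word_value G ` reduced_words S" if "g \<in> generate G S" for g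
    using that
  proof induction
    case one
    show ?case
      by (rule image_eqI[of _ _ "[]"]) (auto simp: reduced_words_def)
  next
    case (incl h)
    then show ?case
      using S(1) by (intro image_eqI[of _ _ "[(h, True)]"])
        (auto simp: reduced_words_def word_value_Cons)
  next
    case (inv h)
    then show ?case
      using S(1) by (intro image_eqI[of _ _ "[(h, False)]"])
        (auto simp: reduced_words_def word_value_Cons)
  next
    case (eng h1 h2)
    then obtain u v where uv: "u \<in> reduced_words S" "v \<in> reduced_words S"
      "h1 = word_value G u" "h2 = word_value G v"
      by blast
    have "word_value G (reduce (u @ v)) = h1 \<otimes> h2"
      using uv SG[OF uv(1)] SG[OF uv(2)]
      by (simp add: word_value_reduce word_value_append image_Un)
    moreover have "reduce (u @ v) \<in> reduced_words S"
      using uv by (intro reduce_in_reduced_words) (auto simp: reduced_words_def image_Un)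
    ultimately show ?case
      by (metis imageI)
  qed
  moreover have "word_value G ` reduced_words S \<subseteq> carrier G"
    using SG word_value_closed by blast
  ultimately show ?thesis
    using S(2) by (auto simp: bij_betw_def)
qed

lemma reduced_replicate [simp]: "reduced (replicate n x)"
  by (induction n) (auto simp: reduced_Cons_iff)

text \<open>Right multiplication by \<open>g\<close> can change the leading letter of a normal form
  only if that form cancels completely against the normal form of \<open>g\<close>. Only inverses of
  prefixes of one word do so, whence the finite boundary of \<open>U\<close>. For
  \<open>g = w\<close> these are the identity and the inverse of \<open>w\<close>, and
  multiplication by \<open>w\<close> keeps both outside \<open>U\<close> because \<open>s\<close>
  differs from \<open>w\<close>.\<close>

lemma (in group) basis_half_space:
  assumes basis: "is_basis G S" and s: "s \<in> S" and w: "w \<in> S" and "s \<noteq> w"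
  obtains U where "U \<subseteq> carrier G" "infinite U" "infinite (carrier G - U)"
    "\<And>x. x \<in> carrier G \<Longrightarrow> x \<otimes> w \<in> U \<longleftrightarrow> x \<in> U"
    "\<And>g. g \<in> carrier G \<Longrightarrow> finite {x \<in> carrier G. (x \<in> U) \<noteq> (x \<otimes> g \<in> U)}"
proof -
  let ?V = "word_value G"
  have bij: "bij_betw ?V (reduced_words S) (carrier G)"
    using basis by (rule word_value_bij_betw_basis)
  have SG: "fst ` set w \<subseteq> carrier G" if "w \<in> reduced_words S" for w
    using that basis by (auto simp: reduced_words_def is_basis_def)
  \<comment> \<open>The sign of the leading letter is left open: \<open>U\<close> contains the
    normal forms that begin with \<open>s\<close> and those that begin with its inverse.\<close>
  define first where "first u \<longleftrightarrow> u \<noteq> [] \<and> fst (hd u) = s" for u :: "'a word"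
  define U where "U = ?V ` {u \<in> reduced_words S. first u}"
  have surj: thesis0 if "x \<in> carrier G" "\<And>u. u \<in> reduced_words S \<Longrightarrow> x = ?V u \<Longrightarrow> thesis0" for x thesis0
    using that(1) unfolding bij_betw_imp_surj_on[OF bij, symmetric] by (elim imageE) (rule that(2))
  have UG: "U \<subseteq> carrier G"
    using bij by (auto simp: U_def bij_betw_def)
  have mem: "?V u \<in> U \<longleftrightarrow> first u" if "u \<in> reduced_words S" for u
    using that bij unfolding U_def bij_betw_def inj_on_def by blast
  have mult: "\<exists>u1 c v2. u = u1 @ c \<and> v = inv_word c @ v2 \<and>
      (?V u \<otimes> ?V v \<in> U \<longleftrightarrow> first (u1 @ v2))"
    if uv: "u \<in> reduced_words S" "v \<in> reduced_words S" for u v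
  proof -
    have uvr: "reduced u" "reduced v"
      using uv by (simp_all add: reduced_words_def)
    obtain u1 c v2 where *: "u = u1 @ c" "v = inv_word c @ v2" "reduce (u @ v) = u1 @ v2"
      "reduced (u1 @ v2)"
      by (rule reduced_append_cancel[OF uvr])
    have "?V u \<otimes> ?V v = ?V (reduce (u @ v))"
      using SG[OF uv(1)] SG[OF uv(2)] by (simp add: word_value_reduce word_value_append image_Un)
    moreover have "reduce (u @ v) \<in> reduced_words S"
      using uv by (intro reduce_in_reduced_words) (auto simp: reduced_words_def image_Un)
    ultimately show ?thesis
      using * mem[of "u1 @ v2"] by (intro exI[of _ u1] exI[of _ c] exI[of _ v2]) simp
  qed
  have rep: "replicate n (t, True) \<in> reduced_words S" if "t \<in> S" for n t
    using that by (auto simp: reduced_words_def)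
  have inj_rep: "inj (\<lambda>n. ?V (replicate n (t, True)))" if "t \<in> S" for t
    using rep[OF that] bij unfolding bij_betw_def inj_on_def
    by (metis length_replicate)
  have 1: "infinite U"
  proof -
    have "range (\<lambda>n. ?V (replicate (Suc n) (s, True))) \<subseteq> U"
    proof
      fix x assume "x \<in> range (\<lambda>n. ?V (replicate (Suc n) (s, True)))"
      then obtain n where x: "x = ?V (replicate (Suc n) (s, True))"
        by blast
      show "x \<in> U"
        unfolding x mem[OF rep[OF s]] by (simp add: first_def)
    qed
    moreover have "inj (\<lambda>n. ?V (replicate (Suc n) (s, True)))"
      using inj_rep[OF s] by (auto simp: inj_def simp del: replicate_Suc)
    ultimately show ?thesis
      using infinite_iff_countable_subset by blast
  qed
  have 2: "infinite (carrier G - U)"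
  proof -
    have "\<not> first (replicate n (w, True))" for n
      using \<open>s \<noteq> w\<close> by (cases n) (auto simp: first_def)
    then have "?V (replicate n (w, True)) \<in> carrier G - U" for n
      using rep[OF w, of n] mem bij by (auto simp: bij_betw_def)
    then show ?thesis
      using inj_rep[OF w] infinite_iff_countable_subset by blast
  qed
  have 3: "x \<otimes> w \<in> U \<longleftrightarrow> x \<in> U" if arg: "x \<in> carrier G" for x
  proof -
    obtain u where u: "u \<in> reduced_words S" "x = ?V u"
      using arg by (rule surj)
    have "w \<in> carrier G"
      using w basis unfolding is_basis_def by blast
    then have w': "[(w, True)] \<in> reduced_words S" "?V [(w, True)] = w"
      using w by (simp_all add: reduced_words_def word_value_Cons)
    obtain u1 c v2 where c: "u = u1 @ c" "[(w, True)] = inv_word c @ v2"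
      "x \<otimes> w \<in> U \<longleftrightarrow> first (u1 @ v2)"
      using mult[OF u(1) w'(1)] unfolding u(2) w'(2) by blast
    have "c = [] \<or> c = [(w, False)]"
      using c(2) by (cases c rule: rev_cases) (auto simp: inv_letter_def prod_eq_iff)
    then show ?thesis
      using c mem[OF u(1)] u \<open>s \<noteq> w\<close> by (cases u1) (auto simp: first_def)
  qed
  have 4: "finite {x \<in> carrier G. (x \<in> U) \<noteq> (x \<otimes> g \<in> U)}" if arg: "g \<in> carrier G" for g
  proof -
    obtain v where v: "v \<in> reduced_words S" "g = ?V v"
      using arg by (rule surj)
    have "{x \<in> carrier G. (x \<in> U) \<noteq> (x \<otimes> g \<in> U)}
        \<subseteq> (\<lambda>n. ?V (inv_word (take n v))) ` {..length v}"
    proof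
      fix x assume x: "x \<in> {x \<in> carrier G. (x \<in> U) \<noteq> (x \<otimes> g \<in> U)}"
      then have "x \<in> carrier G"
        by simp
      then obtain u where u: "u \<in> reduced_words S" "x = ?V u"
        by (rule surj)
      obtain u1 c v2 where c: "u = u1 @ c" "v = inv_word c @ v2"
        "x \<otimes> g \<in> U \<longleftrightarrow> first (u1 @ v2)"
        using mult[OF u(1) v(1)] unfolding u(2) v(2) by blast
      \<comment> \<open>If a part of \<open>u\<close> survived, its leading letter would survive
        too, and \<open>x\<close> and \<open>x \<otimes> g\<close> would lie on the same
        side.\<close>
      have "u1 = []"
        using x c(3) mem[OF u(1)] u(2) c(1) by (cases u1) (auto simp: first_def)
      then have "u = inv_word (take (length c) v)" "length c \<le> length v"
        using c by auto
      then show "x \<in> (\<lambda>n. ?V (inv_word (take n v))) ` {..length v}"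
        using u by blast
    qed
    then show ?thesis
      by (rule finite_subset) simp
  qed
  show ?thesis
    using that[OF UG 1 2 3 4] .
qed

text \<open>Elements of a cyclic group commute, but two distinct generators do not. This guarantees
  that a basis containing \<open>w\<close> has a second element.\<close>

lemma free_group_not_cyclic:
  assumes "a \<in> A" "b \<in> A" "a \<noteq> b"
  shows "generate (free_group A) {g} \<noteq> carrier (free_group A)"
proof
  assume *: "generate (free_group A) {g} = carrier (free_group A)"
  interpret group "free_group A"
    by (rule group_free_group)
  have g: "g \<in> carrier (free_group A)"
    using * generate.incl[of g "{g}"] by blast
  have pow: "\<exists>m::int. [(c, True)] = g [^]\<^bsub>free_group A\<^esub> m" if "c \<in> A" for c
    using letter_in_free_group[OF that, of True] unfolding *[symmetric] generate_pow[OF g] by simp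
  obtain m n :: int where "[(a, True)] = g [^]\<^bsub>free_group A\<^esub> m" "[(b, True)]
      = g [^]\<^bsub>free_group A\<^esub> n"
    using pow[OF assms(1)] pow[OF assms(2)] by (elim exE)
  then have "[(a, True)] \<otimes>\<^bsub>free_group A\<^esub> [(b, True)] = [(b, True)] \<otimes>\<^bsub>free_group A\<^esub> [(a, True)]"
    using g by (simp add: int_pow_mult[symmetric] add.commute)
  then show False
    using assms by (simp add: free_group_def reduce_def inv_letter_def)
qed

lemma primitive_half_space:
  assumes "primitive (free_group A) w" "a \<in> A" "b \<in> A" "a \<noteq> b"
  obtains U where "U \<subseteq> reduced_words A" "infinite U" "infinite (reduced_words A - U)"
    "\<And>x. x \<in> reduced_words A \<Longrightarrow> reduce (x @ w) \<in> U \<longleftrightarrow> x \<in> U"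
    "\<And>g. g \<in> reduced_words A \<Longrightarrow>
      finite {x \<in> reduced_words A. (x \<in> U) \<noteq> (reduce (x @ g) \<in> U)}"
proof -
  interpret group "free_group A"
    by (rule group_free_group)
  obtain S where S: "is_basis (free_group A) S" "w \<in> S"
    using assms by (auto simp: primitive_def)
  have "S \<noteq> {w}"
    using free_group_not_cyclic[OF assms(2-4), of w] S(1) by (auto simp: is_basis_def)
  then obtain s where s: "s \<in> S" "s \<noteq> w"
    using S(2) by blast
  from basis_half_space[OF S(1) s(1) S(2) s(2)] show ?thesis
    using that by (simp add: free_group_def) blast
qed

declare split_paired_All [simp del] split_paired_Ex [simp del]

section \<open>The cut vertex lemma\<close>

definition letters :: "'a set \<Rightarrow> 'a letter set" where
  "letters A = A \<times> UNIV"

lemma inv_letter_in_letters [simp]: "inv_letter x \<in> letters A \<longleftrightarrow> x \<in> letters A"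
  by (cases x) (auto simp: letters_def inv_letter_def)

lemma finite_letters [simp]: "finite A \<Longrightarrow> finite (letters A)"
  by (simp add: letters_def)

lemma card_letters: "card (letters A) = 2 * card A"
  by (simp add: letters_def card_cartesian_product mult.commute)

lemma set_subset_letters: "set w \<subseteq> letters A \<longleftrightarrow> fst ` set w \<subseteq> A"
  by (auto simp: letters_def)

lemma reduced_words_iff: "w \<in> reduced_words A \<longleftrightarrow> set w \<subseteq> letters A \<and> reduced w"
  by (simp add: reduced_words_def set_subset_letters)

text \<open>An edge of the Cayley tree is represented by its endpoint that is farther from the
  identity, so \<open>boundary A U\<close> is the set of edges with exactly one endpoint in \<open>U\<close>.\<close>

definition boundary :: "'a set \<Rightarrow> 'a word set \<Rightarrow> 'a word set" where
  "boundary A U = {g \<in> reduced_words A. g \<noteq> [] \<and> (g \<in> U) \<noteq> (butlast g \<in> U)}"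

definition children :: "'a set \<Rightarrow> 'a word \<Rightarrow> 'a letter set" where
  "children A p = {x \<in> letters A. p \<noteq> [] \<longrightarrow> x \<noteq> inv_letter (last p)}"

lemma children_iff:
  "p \<in> reduced_words A \<Longrightarrow> x \<in> children A p \<longleftrightarrow> p @ [x] \<in> reduced_words A"
  by (auto simp: children_def reduced_words_iff reduced_append_iff)

lemma butlast_reduced_words: "g \<in> reduced_words A \<Longrightarrow> butlast g \<in> reduced_words A"
  by (cases g rule: rev_cases) (auto simp: reduced_words_iff reduced_append_iff)

text \<open>A finite change of \<open>U0\<close> leaves both sides infinite, so a set
  \<open>U\<close> with minimal boundary still has boundary edges. Let \<open>p\<close> be the
  endpoint nearer to the root of a deepest one. Below each child of \<open>p\<close> there are no
  further boundary edges, so \<open>U\<close> is constant there; \<open>L\<close> and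
  \<open>M\<close> are the children with and without a boundary edge to \<open>p\<close>.\<close>

lemma tree_cut:
  assumes "finite A" "card A \<ge> 2"
    and U0: "U0 \<subseteq> reduced_words A" "infinite U0" "infinite (reduced_words A - U0)"
      "finite (boundary A U0)"
  obtains U p L M where
    "finite (sym_diff U U0)" "p \<in> reduced_words A"
    "L \<noteq> {}" "M \<noteq> {}" "L \<inter> M = {}" "L \<union> M = children A p"
    "\<And>x h. x \<in> L \<Longrightarrow> p @ x # h \<in> reduced_words A \<Longrightarrow> p @ x # h \<in> U \<longleftrightarrow> p \<notin> U"
    "\<And>x h. x \<in> M \<Longrightarrow> p @ x # h \<in> reduced_words A \<Longrightarrow> p @ x # h \<in> U \<longleftrightarrow> p \<in> U"
proof -
  define \<U> where "\<U> = {U. U \<subseteq> reduced_words A \<and> finite (sym_diff U U0) \<and> finite (boundary A U)}"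
  have "U0 \<in> \<U>"
    using U0 by (simp add: \<U>_def)
  then obtain U where U: "U \<in> \<U>" and min: "\<And>V. V \<in> \<U> \<Longrightarrow> card (boundary A U) \<le> card (boundary A V)"
    using ex_has_least_nat[of "\<lambda>U. U \<in> \<U>" U0 "\<lambda>U. card (boundary A U)"] by blast
  have UR: "U \<subseteq> reduced_words A" and fin: "finite (sym_diff U U0)" "finite (boundary A U)"
    using U by (auto simp: \<U>_def)
  have "boundary A U \<noteq> {}"
  proof
    assume *: "boundary A U = {}"
    have "g \<in> U \<longleftrightarrow> [] \<in> U" if "g \<in> reduced_words A" for g
      using that
    proof (induction g rule: rev_induct)
      case (snoc x g)
      then have "g \<in> reduced_words A"
        using butlast_reduced_words[of "g @ [x]"] by simp
      then show ?case
        using snoc * unfolding boundary_def by fastforce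
    qed simp
    then consider "U = {}" | "U = reduced_words A"
      using UR by blast
    then show False
      using fin(1) U0 by cases auto
  qed
  then obtain g where g: "g \<in> boundary A U" and deep: "\<And>h. h \<in> boundary A U \<Longrightarrow> length h \<le> length g"
  proof -
    have "Max (length ` boundary A U) \<in> length ` boundary A U"
      using fin(2) \<open>boundary A U \<noteq> {}\<close> by (intro Max_in) auto
    then obtain g where "g \<in> boundary A U" "length g = Max (length ` boundary A U)"
      by auto
    then show ?thesis
      using that[of g] fin(2) by simp
  qed
  define p where "p = butlast g"
  have p: "p \<in> reduced_words A"
    using g butlast_reduced_words by (auto simp: p_def boundary_def)
  define L where "L = {x \<in> children A p. p @ [x] \<in> boundary A U}"
  define M where "M = {x \<in> children A p. p @ [x] \<notin> boundary A U}"
  have len: "length g = Suc (length p)"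
    using g by (cases g rule: rev_cases) (auto simp: p_def boundary_def)
  have beyond: "p @ x # h \<in> U \<longleftrightarrow> p @ [x] \<in> U" if "p @ x # h \<in> reduced_words A" for x h
    using that
  proof (induction h rule: rev_induct)
    case (snoc y h)
    then have "p @ x # h \<in> reduced_words A"
      using butlast_reduced_words[of "p @ x # h @ [y]"] by (simp add: butlast_append)
    moreover have "p @ x # h @ [y] \<notin> boundary A U"
      using deep[of "p @ x # h @ [y]"] len by auto
    ultimately show ?case
      using snoc by (auto simp: boundary_def butlast_append)
  qed simp
  have child: "p @ [x] \<in> boundary A U \<longleftrightarrow> (p @ [x] \<in> U) \<noteq> (p \<in> U)" if "x \<in> children A p" for x
    using that children_iff[OF p, of x] by (auto simp: boundary_def)
  have prefix: "x \<in> children A p" if "p @ x # h \<in> reduced_words A" for x h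
    using that by (auto simp: children_def reduced_words_iff reduced_append_iff)
  have "L \<noteq> {}"
  proof -
    have gp: "p @ [last g] = g"
      using g by (auto simp: p_def boundary_def)
    have "last g \<in> children A p"
      unfolding children_iff[OF p] gp using g by (simp add: boundary_def)
    then have "last g \<in> L"
      unfolding L_def using g gp by simp
    then show ?thesis
      by blast
  qed
  \<comment> \<open>Otherwise moving the single vertex \<open>p\<close> to the other side would
    remove all its child edges from the boundary, at least two, and add at most the edge from
    \<open>p\<close> to its parent, contrary to minimality.\<close>
  moreover have "M \<noteq> {}"
  proof
    assume "M = {}"
    then have all: "p @ [x] \<in> boundary A U" if "x \<in> children A p" for x
      using that by (auto simp: M_def)
    define V where "V = (if p \<in> U then U - {p} else insert p U)"
    define C where "C = (\<lambda>x. p @ [x]) ` children A p"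
    have mem: "h \<in> V \<longleftrightarrow> (if h = p then p \<notin> U else h \<in> U)" for h
      by (auto simp: V_def)
    have sub: "boundary A V \<subseteq> insert p (boundary A U - C)"
    proof
      fix h assume h: "h \<in> boundary A V"
      show "h \<in> insert p (boundary A U - C)"
      proof (cases "h = p")
        case False
        have "h \<in> reduced_words A" "h \<noteq> []" and ne: "(h \<in> V) \<noteq> (butlast h \<in> V)"
          using h by (auto simp: boundary_def)
        show ?thesis
        proof (cases "butlast h = p")
          case True
          then have "h = p @ [last h]"
            using \<open>h \<noteq> []\<close> append_butlast_last_id by metis
          then have "last h \<in> children A p"
            using \<open>h \<in> reduced_words A\<close> children_iff[OF p] by metis
          then have "(h \<in> U) \<noteq> (p \<in> U)"
            using all child \<open>h = p @ [last h]\<close> by metis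
          then show ?thesis
            using ne False True by (simp add: mem)
        next
          case False
          then have "h \<notin> C"
            by (auto simp: C_def)
          then show ?thesis
            using ne False \<open>h \<noteq> p\<close> \<open>h \<in> reduced_words A\<close> \<open>h \<noteq> []\<close>
            by (simp add: mem boundary_def)
        qed
      qed simp
    qed
    have CU: "C \<subseteq> boundary A U"
      using all by (auto simp: C_def)
    have "card C = card (children A p)"
      unfolding C_def by (intro card_image) (auto simp: inj_on_def)
    also have "\<dots> \<ge> 2"
    proof -
      have "letters A - {inv_letter (last p)} \<subseteq> children A p"
        by (auto simp: children_def)
      then have "card (letters A - {inv_letter (last p)}) \<le> card (children A p)"
        using assms(1) by (intro card_mono) (auto simp: children_def)
      moreover have "card (letters A) - 1 \<le> card (letters A - {inv_letter (last p)})"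
        using assms(1) by (metis card_Diff1_le card_Diff_singleton_if diff_le_self le_refl)
      ultimately show ?thesis
        using assms(2) by (simp add: card_letters)
    qed
    finally have "card C \<ge> 2" .
    moreover have "card C \<le> card (boundary A U)"
      using CU fin(2) by (rule card_mono[rotated])
    moreover have "card (boundary A V) \<le> Suc (card (boundary A U - C))"
    proof -
      have "card (boundary A V) \<le> card (insert p (boundary A U - C))"
        using sub fin(2) by (intro card_mono) auto
      also have "\<dots> \<le> Suc (card (boundary A U - C))"
        using fin(2) by (simp add: card_insert_if)
      finally show ?thesis .
    qed
    moreover have "card (boundary A U - C) = card (boundary A U) - card C"
      using CU fin(2) by (intro card_Diff_subset) (auto intro: finite_subset)
    moreover have "V \<in> \<U>"
    proof -
      have "sym_diff V U0 \<subseteq> insert p (sym_diff U U0)"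
        by (auto simp: V_def split: if_splits)
      moreover have "V \<subseteq> reduced_words A"
        using UR p by (auto simp: V_def)
      ultimately show ?thesis
        using fin sub finite_subset unfolding \<U>_def by (auto intro: finite_subset)
    qed
    ultimately show False
      using min[of V] by linarith
  qed
  moreover have "L \<inter> M = {}" "L \<union> M = children A p"
    by (auto simp: L_def M_def)
  moreover have "p @ x # h \<in> U \<longleftrightarrow> p \<notin> U" if "x \<in> L" "p @ x # h \<in> reduced_words A" for x h
    using that beyond child prefix by (auto simp: L_def)
  moreover have "p @ x # h \<in> U \<longleftrightarrow> p \<in> U" if "x \<in> M" "p @ x # h \<in> reduced_words A" for x h
    using that beyond child prefix by (auto simp: M_def)
  ultimately show ?thesis
    using that[OF fin(1) p] by blast
qed

section \<open>Ends of the lines given by the powers of a cyclic word\<close>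

definition pow_word :: "nat \<Rightarrow> 'a word \<Rightarrow> 'a word" where
  "pow_word n u = concat (replicate n u)"

lemma pow_word_simps [simp]: "pow_word 0 u = []" "pow_word (Suc n) u = u @ pow_word n u"
  by (simp_all add: pow_word_def)

lemma set_pow_word: "set (pow_word n u) \<subseteq> set u"
  by (auto simp: pow_word_def)

lemma length_pow_word [simp]: "length (pow_word n u) = n * length u"
  by (induction n) auto

lemma reduced_pow_word:
  assumes "reduced (u @ u)"
  shows "reduced (pow_word n u)"
proof (induction n)
  case (Suc n)
  have "hd (pow_word n u) = hd u" if "pow_word n u \<noteq> []"
    using that by (cases n; cases "u = []") (auto simp: pow_word_def)
  then show ?case
    using Suc assms by (auto simp: reduced_append_iff)
qed simp

lemma reduce_pow_word_commute:
  assumes "reduce (u @ c) = reduce (c @ v)"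
  shows "reduce (pow_word n u @ c) = reduce (c @ pow_word n v)"
proof (induction n)
  case (Suc n)
  have "reduce (u @ pow_word n u @ c) = reduce (u @ c @ pow_word n v)"
    by (rule reduce_append_cong[OF refl Suc])
  also have "\<dots> = reduce ((c @ v) @ pow_word n v)"
    using reduce_append_cong[OF assms, of "pow_word n v" "pow_word n v"] by simp
  finally show ?case
    by simp
qed simp

text \<open>Right translation by \<open>c\<close> turns \<open>p u^n\<close> into
  \<open>p c v^n\<close>, whose side with respect to \<open>U0\<close> does not depend on
  \<open>n\<close>. The translation and the passage from \<open>U0\<close> to \<open>U\<close> each
  disturb only finitely many points of the ray, so some point of it lies on the side of
  \<open>p c\<close>. This side involves neither \<open>u\<close> nor \<open>v\<close>, which allows
  rays in different directions to be compared.\<close>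

lemma line_end_side:
  assumes u: "reduced (u @ u)" "u \<noteq> []" "set u \<subseteq> letters A"
    and c: "c \<in> reduced_words A"
    and p: "p \<in> reduced_words A" "hd u \<in> children A p"
    and uc: "reduce (u @ c) = reduce (c @ v)" "set v \<subseteq> letters A"
    and v: "\<And>x. x \<in> reduced_words A \<Longrightarrow> reduce (x @ v) \<in> U0 \<longleftrightarrow> x \<in> U0"
    and fin: "finite {x \<in> reduced_words A. (x \<in> U0) \<noteq> (reduce (x @ c) \<in> U0)}"
      "finite (sym_diff U U0)"
  obtains h where "p @ hd u # h \<in> reduced_words A"
    "p @ hd u # h \<in> U \<longleftrightarrow> reduce (p @ c) \<in> U0"
proof -
  define f where "f n = p @ pow_word (Suc n) u" for n
  have f: "f n \<in> reduced_words A" for n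
  proof -
    have "reduced (pow_word (Suc n) u)"
      using reduced_pow_word[OF u(1)] .
    moreover have "set (f n) \<subseteq> letters A"
      using p(1) u(3) set_pow_word[of "Suc n" u] by (auto simp: f_def reduced_words_iff)
    ultimately show ?thesis
      using p u(2) by (auto simp: f_def reduced_words_iff reduced_append_iff children_def)
  qed
  have "inj f"
  proof (rule injI)
    fix m n assume "f m = f n"
    then have "length (f m) = length (f n)"
      by simp
    then show "m = n"
      using u(2) by (simp add: f_def)
  qed
  then have "infinite (range f)"
    by (simp add: finite_image_iff)
  then have "\<not> range f \<subseteq> {x \<in> reduced_words A. (x \<in> U0) \<noteq> (reduce (x @ c) \<in> U0)} \<union> sym_diff U U0"
    using fin finite_subset by (metis (no_types, lifting) finite_Un)
  then obtain n where n: "f n \<in> U0 \<longleftrightarrow> reduce (f n @ c) \<in> U0" "f n \<in> U \<longleftrightarrow> f n \<in> U0"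
    using f by auto
  have "reduce (f n @ c) = reduce (p @ c @ pow_word (Suc n) v)"
    unfolding f_def append_assoc
    by (intro reduce_append_cong refl reduce_pow_word_commute uc)
  moreover have "reduce (x @ pow_word m v) \<in> U0 \<longleftrightarrow> reduce x \<in> U0" if "set x \<subseteq> letters A" for x m
    using that
  proof (induction m arbitrary: x)
    case (Suc m)
    have "reduce (reduce x @ v) \<in> U0 \<longleftrightarrow> reduce x \<in> U0"
      using Suc.prems reduce_in_reduced_words[of x A] v by (simp add: set_subset_letters)
    then show ?case
      using Suc.IH[of "x @ v"] Suc.prems uc(2) by (simp add: reduce_append_reduce)
  qed simp
  from this[of "p @ c" "Suc n"] have "reduce (p @ c @ pow_word (Suc n) v) \<in> U0
      \<longleftrightarrow> reduce (p @ c) \<in> U0"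
    using p(1) c by (simp add: reduced_words_iff)
  moreover have "f n = p @ hd u # (tl u @ pow_word n u)"
    using u(2) by (simp add: f_def)
  ultimately show ?thesis
    using that[of "tl u @ pow_word n u"] f[of n] n by simp
qed

section \<open>Cyclic transitions and the Whitehead graph\<close>

definition adj :: "'a list \<Rightarrow> ('a \<times> 'a) list" where
  "adj l = zip l (tl l)"

text \<open>Appending the first letter adds the transition from the last letter back to it. For the
  empty word \<open>hd []\<close> is arbitrary, but a list of one letter has no transition.\<close>

definition cyc_adj :: "'a list \<Rightarrow> ('a \<times> 'a) list" where
  "cyc_adj w = adj (w @ [hd w])"

lemma adj_simps [simp]: "adj [] = []" "adj [x] = []" "adj (x # y # l) = (x, y) # adj (y # l)"
  by (simp_all add: adj_def)

lemma set_adj_iff: "(a, b) \<in> set (adj l) \<longleftrightarrow> (\<exists>u v. l = u @ a # b # v)"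
proof (induction l)
  case (Cons x l)
  show ?case
  proof
    assume "(a, b) \<in> set (adj (x # l))"
    then consider l' where "a = x" "l = b # l'" | "(a, b) \<in> set (adj l)"
      by (cases l) auto
    then show "\<exists>u v. x # l = u @ a # b # v"
    proof cases
      case 1
      then show ?thesis
        by (intro exI[of _ "[]"] exI[of _ l']) simp
    next
      case 2
      then obtain u v where "l = u @ a # b # v"
        using Cons by blast
      then show ?thesis
        by (intro exI[of _ "x # u"] exI[of _ v]) simp
    qed
  next
    assume "\<exists>u v. x # l = u @ a # b # v"
    then obtain u v where uv: "x # l = u @ a # b # v"
      by blast
    show "(a, b) \<in> set (adj (x # l))"
    proof (cases u)
      case (Cons y u')
      then have "(a, b) \<in> set (adj l)"
        using uv Cons.IH by auto
      then show ?thesis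
        by (cases l) auto
    qed (use uv in auto)
  qed
qed simp

lemma cyc_adjE:
  assumes "(a, b) \<in> set (cyc_adj w)"
  obtains c d where "w = c @ d" "d @ c \<noteq> []" "a = last (d @ c)" "b = hd (d @ c)"
proof -
  obtain u v where uv: "w @ [hd w] = u @ a # b # v"
    using assms by (auto simp: cyc_adj_def set_adj_iff)
  show ?thesis
  proof (cases v rule: rev_cases)
    case Nil
    then have "w @ [hd w] = (u @ [a]) @ [b]"
      unfolding uv by simp
    then have *: "w = u @ [a]" "hd w = b"
      by (blast dest: append1_eq_conv[THEN iffD1])+
    then have "w \<noteq> []" "last w = a"
      by simp_all
    then show ?thesis
      using that[of w "[]"] *(2) by simp
  next
    case (snoc v' z)
    then have "w @ [hd w] = (u @ a # b # v') @ [z]"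
      unfolding uv by simp
    then have "w = u @ a # b # v'"
      by (simp only: append1_eq_conv)
    then show ?thesis
      using that[of "u @ [a]" "b # v'"] by simp
  qed
qed

definition cyc_reduced :: "'a word \<Rightarrow> bool" where
  "cyc_reduced w \<longleftrightarrow> reduced (w @ w)"

lemma cyc_reduced_rotate:
  assumes "cyc_reduced (c @ d)" shows "cyc_reduced (d @ c)"
proof (cases "c = [] \<or> d = []")
  case False
  then show ?thesis
    using assms by (auto simp: cyc_reduced_def reduced_append_iff)
next
  case True
  then show ?thesis
    using assms by (elim disjE) simp_all
qed

lemma cyc_adj_set:
  assumes "(a, b) \<in> set (cyc_adj w)"
  shows "a \<in> set w" "b \<in> set w"
proof -
  obtain c d where *: "w = c @ d" "d @ c \<noteq> []" "a = last (d @ c)" "b = hd (d @ c)"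
    using assms by (rule cyc_adjE)
  then have "a \<in> set (d @ c)" "b \<in> set (d @ c)"
    using last_in_set hd_in_set by blast+
  then show "a \<in> set w" "b \<in> set w"
    using * by auto
qed

text \<open>The Whitehead graph of the cyclic word \<open>w\<close> has an edge between the inverse of \<open>a\<close> and \<open>b\<close>
  for every cyclic subword \<open>a b\<close>. The vertex \<open>v\<close> separates \<open>Y\<close> from the other vertices.\<close>

definition whitehead_cut :: "'a set \<Rightarrow> 'a letter set \<Rightarrow> 'a letter \<Rightarrow> 'a word \<Rightarrow> bool" where
  "whitehead_cut A Y v w \<longleftrightarrow>
     Y \<subseteq> letters A \<and> Y \<noteq> {} \<and> v \<in> letters A \<and> v \<notin> Y \<and> inv_letter v \<notin> Y \<and>
     (\<forall>(a, b) \<in> set (cyc_adj w).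
        (inv_letter a \<in> Y \<longrightarrow> b \<in> insert v Y) \<and> (b \<in> Y \<longrightarrow> inv_letter a \<in> insert v Y))"

text \<open>A cut side has to avoid the inverse of \<open>v\<close>; since \<open>L\<close> and
  \<open>M\<close> are disjoint, one of them does.\<close>

lemma whitehead_cut_of_separation:
  assumes w: "set w \<subseteq> letters A"
    and v: "v \<in> letters A"
    and LM: "L \<noteq> {}" "M \<noteq> {}" "L \<inter> M = {}" "L \<union> M = letters A - {v}"
    and sep: "\<And>a b. (a, b) \<in> set (cyc_adj w) \<Longrightarrow>
      \<not> (inv_letter a \<in> L \<and> b \<in> M) \<and> \<not> (inv_letter a \<in> M \<and> b \<in> L)"
  obtains Y where "whitehead_cut A Y v w"
proof -
  have ab: "inv_letter a \<in> letters A" "b \<in> letters A" if "(a, b) \<in> set (cyc_adj w)" for a b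
    using cyc_adj_set[OF that] w by auto
  have main: "whitehead_cut A Y v w" if "Y \<noteq> {}" "Y \<inter> Z = {}" "Y \<union> Z = letters A - {v}"
    "inv_letter v \<notin> Y"
    and YZ: "\<And>a b. (a, b) \<in> set (cyc_adj w) \<Longrightarrow>
      \<not> (inv_letter a \<in> Y \<and> b \<in> Z) \<and> \<not> (inv_letter a \<in> Z \<and> b \<in> Y)" for Y Z
  proof -
    have "(inv_letter a \<in> Y \<longrightarrow> b \<in> insert v Y) \<and> (b \<in> Y \<longrightarrow> inv_letter a \<in> insert v Y)"
      if "(a, b) \<in> set (cyc_adj w)" for a b
    proof -
      have "inv_letter a \<in> Y \<union> Z \<union> {v}" "b \<in> Y \<union> Z \<union> {v}"
        using ab[OF that] \<open>Y \<union> Z = letters A - {v}\<close> by auto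
      then show ?thesis
        using YZ[OF that] by auto
    qed
    moreover have "Y \<subseteq> letters A" "v \<notin> Y"
      using \<open>Y \<union> Z = letters A - {v}\<close> by auto
    ultimately show ?thesis
      using v \<open>Y \<noteq> {}\<close> \<open>inv_letter v \<notin> Y\<close> unfolding whitehead_cut_def by fast
  qed
  show ?thesis
  proof (cases "inv_letter v \<in> L")
    case True
    then show ?thesis
      using LM sep by (intro that[of M] main[of M L]) auto
  next
    case False
    then show ?thesis
      using LM sep by (intro that[of L] main[of L M]) auto
  qed
qed

text \<open>The directions at the vertex \<open>p\<close> of the tree correspond to the vertices of
  the Whitehead graph. For each transition \<open>a b\<close> of \<open>w\<close> whose two
  directions \<open>inv_letter a\<close> and \<open>b\<close> are children of \<open>p\<close>, a
  translate of the axis of \<open>w\<close> passes through \<open>p\<close> in these directions.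
  Both of its ends lie on the side of the same element, so the directions cannot belong to different
  classes \<open>L\<close> and \<open>M\<close>.\<close>

theorem primitive_whitehead_cut:
  assumes A: "finite A" "card A \<ge> 2"
    and w: "primitive (free_group A) w" "w \<noteq> []" "set w \<subseteq> letters A" "cyc_reduced w"
  obtains Y v where "whitehead_cut A Y v w"
proof -
  note cut = that
  obtain a b where ab: "a \<in> A" "b \<in> A" "a \<noteq> b"
    using A by (metis card_le_Suc0_iff_eq not_less_eq_eq numeral_2_eq_2)
  obtain U0 where U0: "U0 \<subseteq> reduced_words A" "infinite U0" "infinite (reduced_words A - U0)"
    and step: "\<And>x. x \<in> reduced_words A \<Longrightarrow> reduce (x @ w) \<in> U0 \<longleftrightarrow> x \<in> U0"
    and fin: "\<And>g. g \<in> reduced_words A \<Longrightarrow>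
      finite {x \<in> reduced_words A. (x \<in> U0) \<noteq> (reduce (x @ g) \<in> U0)}"
    by (rule primitive_half_space[OF w(1) ab]) (rule that)
  \<comment> \<open>The edge from \<open>butlast g\<close> to \<open>g\<close> is crossed by right
    multiplication with the inverse of the last letter of \<open>g\<close>, and there are only
    finitely many letters.\<close>
  have "finite (boundary A U0)"
  proof (rule finite_subset)
    let ?B = "\<lambda>x. {g \<in> reduced_words A. (g \<in> U0) \<noteq> (reduce (g @ [x]) \<in> U0)}"
    show "boundary A U0 \<subseteq> (\<Union>x\<in>letters A. ?B (inv_letter x))"
    proof
      fix g assume g: "g \<in> boundary A U0"
      then obtain p x where gp: "g = p @ [x]" "g \<in> reduced_words A"
        by (cases g rule: rev_cases) (auto simp: boundary_def)
      then have "reduce (g @ [inv_letter x]) = p"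
        using reduce_append_inv_word_cancel(2)[of p "[x]" "[]"] reduce_eq_self[of p]
        by (simp add: reduced_words_iff reduced_append_iff)
      then have "g \<in> ?B (inv_letter x)" "x \<in> letters A"
        using g gp by (auto simp: boundary_def reduced_words_iff)
      then show "g \<in> (\<Union>x\<in>letters A. ?B (inv_letter x))"
        by blast
    qed
    show "finite (\<Union>x\<in>letters A. ?B (inv_letter x))"
      using A(1) by (intro finite_UN_I fin) (auto simp: reduced_words_iff)
  qed
  then obtain U p L M where UV: "finite (sym_diff U U0)" and p: "p \<in> reduced_words A"
    and LM: "L \<noteq> {}" "M \<noteq> {}" "L \<inter> M = {}" "L \<union> M = children A p"
    and L: "\<And>x h. x \<in> L \<Longrightarrow> p @ x # h \<in> reduced_words A \<Longrightarrow> p @ x # h \<in> U \<longleftrightarrow> p \<notin> U"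
    and M: "\<And>x h. x \<in> M \<Longrightarrow> p @ x # h \<in> reduced_words A \<Longrightarrow> p @ x # h \<in> U \<longleftrightarrow> p \<in> U"
    using tree_cut[OF A U0] by metis
  have sep: "\<not> (inv_letter a \<in> L \<and> b \<in> M) \<and> \<not> (inv_letter a \<in> M \<and> b \<in> L)"
    if ab: "(a, b) \<in> set (cyc_adj w)" for a b
  proof (rule ccontr)
    assume "\<not> ?thesis"
    then have opp: "inv_letter a \<in> L \<and> b \<in> M \<or> inv_letter a \<in> M \<and> b \<in> L"
      by blast
    then have ch: "inv_letter a \<in> children A p" "b \<in> children A p"
      using LM by auto
    obtain c d where cd: "w = c @ d" "d @ c \<noteq> []" "a = last (d @ c)" "b = hd (d @ c)"
      using ab by (rule cyc_adjE)
    have cr: "reduced ((d @ c) @ (d @ c))"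
      using cyc_reduced_rotate[of c d] w(4) cd(1) by (simp add: cyc_reduced_def)
    then have c: "inv_word c \<in> reduced_words A"
      using w(3) cd(1) inv_word_in_reduced_words[of c A]
      by (auto simp: reduced_words_iff reduced_append_iff)
    have step': "reduce (x @ inv_word w) \<in> U0 \<longleftrightarrow> x \<in> U0" if "x \<in> reduced_words A" for x
    proof -
      have "reduce (x @ inv_word w) \<in> reduced_words A"
        using that w(3) by (intro reduce_in_reduced_words)
          (auto simp: reduced_words_iff set_subset_letters image_Un)
      moreover have "reduce (reduce (x @ inv_word w) @ w) = x"
        using that reduce_append_inv_word_cancel(1)[of x w "[]"]
        by (simp add: reduce_append_reduce reduced_words_iff reduce_eq_self)
      ultimately show ?thesis
        using step by metis
    qed
    have hd: "hd (inv_word (d @ c)) = inv_letter a"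
      unfolding cd(3) by (rule hd_inv_word[OF cd(2)])
    \<comment> \<open>The rotation \<open>d @ c\<close> and its inverse are conjugates of
      \<open>w\<close> and \<open>inv_word w\<close> by the same word \<open>inv_word c\<close>, so
      both rays are compared with the one element \<open>p @ inv_word c\<close>.\<close>
    have dc: "set (d @ c) \<subseteq> letters A" "hd (d @ c) \<in> children A p"
      "reduce ((d @ c) @ inv_word c) = reduce (inv_word c @ w)"
      using w(3) ch(2) cd(4) reduce_append_inv_word_cancel(2)[of d c "[]"] cd(1) by auto
    have dc': "reduced (inv_word (d @ c) @ inv_word (d @ c))" "inv_word (d @ c) \<noteq> []"
      "set (inv_word (d @ c)) \<subseteq> letters A" "hd (inv_word (d @ c)) \<in> children A p"
      "reduce (inv_word (d @ c) @ inv_word c) = reduce (inv_word c @ inv_word w)"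
      "set (inv_word w) \<subseteq> letters A"
      using cr reduced_inv_word[of "(d @ c) @ (d @ c)"] cd(1,2) w(3) ch(1) hd
      by (auto simp: set_subset_letters image_Un simp del: reduced_inv_word)
    obtain h1 where h1: "p @ hd (d @ c) # h1 \<in> reduced_words A"
      "p @ hd (d @ c) # h1 \<in> U \<longleftrightarrow> reduce (p @ inv_word c) \<in> U0"
      by (rule line_end_side[OF cr cd(2) dc(1) c p dc(2,3) w(3) step fin[OF c] UV])
    obtain h2 where h2: "p @ hd (inv_word (d @ c)) # h2 \<in> reduced_words A"
      "p @ hd (inv_word (d @ c)) # h2 \<in> U \<longleftrightarrow> reduce (p @ inv_word c) \<in> U0"
      by (rule line_end_side[OF dc'(1-3) c p dc'(4-6) step' fin[OF c] UV])
    show False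
      using opp L M h1 h2 unfolding hd cd(4)[symmetric] by metis
  qed
  show ?thesis
  proof (cases "p = []")
    case False
    \<comment> \<open>The only direction at \<open>p\<close> that is not a child leads back to the
      root; it becomes the cut vertex.\<close>
    then have "inv_letter (last p) \<in> letters A" "L \<union> M = letters A - {inv_letter (last p)}"
      using LM(4) p by (auto simp: children_def reduced_words_iff)
    then show ?thesis
      using whitehead_cut_of_separation[OF w(3) _ LM(1-3) _ sep] that by metis
  next
    case True
    then have LM': "L \<union> M = letters A"
      using LM by (simp add: children_def)
    \<comment> \<open>At the root \<open>L\<close> and \<open>M\<close> use up all directions, so
      the Whitehead graph is disconnected, and any vertex of a side with at least two elements can
      serve as cut vertex.\<close>
    have main: thesis if "L' \<union> M' = letters A" and disj: "L' \<inter> M' = {}" and L': "L' \<noteq> {}"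
      and M': "card M' \<ge> 2" and sep': "\<And>a b. (a, b) \<in> set (cyc_adj w) \<Longrightarrow>
        \<not> (inv_letter a \<in> L' \<and> b \<in> M') \<and> \<not> (inv_letter a \<in> M' \<and> b \<in> L')" for L' M'
    proof -
      have "M' \<noteq> {}"
        using M' by auto
      then obtain v where v: "v \<in> M'"
        by blast
      have "M' \<noteq> {v}"
        using M' by auto
      then have "M' - {v} \<noteq> {}"
        using v by blast
      moreover have "L' \<union> (M' - {v}) = letters A - {v}" "v \<in> letters A"
        using that v by auto
      moreover have "L' \<inter> (M' - {v}) = {}"
        using disj by blast
      moreover have "\<not> (inv_letter a \<in> L' \<and> b \<in> M' - {v}) \<and> \<not> (inv_letter a \<in> M' - {v} \<and> b \<in> L')"
        if "(a, b) \<in> set (cyc_adj w)" for a b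
        using sep'[OF that] by blast
      ultimately obtain Y where "whitehead_cut A Y v w"
        using whitehead_cut_of_separation[OF w(3), of v L' "M' - {v}"] L' by metis
      then show thesis
        by (rule cut)
    qed
    have "finite L" "finite M"
      using LM' A(1) finite_letters[of A] by (metis finite_Un)+
    then have "card L + card M = 2 * card A"
      using LM(3) LM' card_Un_disjoint[of L M] card_letters by metis
    then consider "card L \<ge> 2" | "card M \<ge> 2"
      using A(2) by linarith
    then show ?thesis
    proof cases
      case 1
      then show ?thesis
        using LM LM' sep by (intro main[of M L]) auto
    next
      case 2
      then show ?thesis
        using LM LM' sep by (intro main[of L M]) auto
    qed
  qed
qed

section \<open>Whitehead reduction\<close>

text \<open>The Whitehead automorphism with multiplier \<open>v\<close>. If neither \<open>v\<close>
  nor its inverse is in \<open>Y\<close>, its inverse is the one with the same \<open>Y\<close> and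
  multiplier \<open>inv_letter v\<close>.\<close>

definition whitehead_map :: "'a letter set \<Rightarrow> 'a letter \<Rightarrow> 'a letter \<Rightarrow> 'a word" where
  "whitehead_map Y v b =
     (if b \<in> Y then [inv_letter v] else []) @ [b] @ (if inv_letter b \<in> Y then [v] else [])"

lemma inv_compatible_whitehead_map: "inv_compatible (whitehead_map Y v)"
  by (auto simp: inv_compatible_def whitehead_map_def)

lemma whitehead_map_inverse:
  assumes "v \<notin> Y" "inv_letter v \<notin> Y"
  shows "reduce (subst (whitehead_map Y v) (whitehead_map Y (inv_letter v) x)) = [x]"
proof -
  have "reduce ([v] @ [inv_letter v] @ u) = reduce u" "reduce ([inv_letter v] @ [v] @ u) = reduce u"
    for u
    using reduce_append_inv_word_cancel(3,4)[of "[v]" u] by simp_all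
  then have *: "reduce (v # inv_letter v # u) = reduce u" "reduce (inv_letter v # v # u) = reduce u"
    for u
    by simp_all
  have **: "reduce (x # v # inv_letter v # u) = reduce (x # u)"
    "reduce (x # inv_letter v # v # u) = reduce (x # u)" for u
    using reduce_append_cong[of "[x]" "[x]", OF refl *(1)[of u]]
      reduce_append_cong[of "[x]" "[x]", OF refl *(2)[of u]] by simp_all
  show ?thesis
    using assms by (auto simp: whitehead_map_def * ** reduce_eq_self)
qed

lemma whitehead_map_letters:
  assumes "v \<in> letters A" "x \<in> letters A"
  shows "set (whitehead_map Y v x) \<subseteq> letters A"
  using assms [[simproc del: list_to_set_comprehension]] by (simp add: whitehead_map_def)

lemma whitehead_map_iso:
  assumes "v \<in> letters A" "v \<notin> Y" "inv_letter v \<notin> Y"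
  shows "subst_hom (whitehead_map Y v) \<in> iso (free_group A) (free_group A)"
proof (rule subst_hom_iso[where g = "whitehead_map Y (inv_letter v)"])
  fix x :: "'a letter" assume "fst x \<in> A"
  then have x: "x \<in> letters A"
    by (cases x) (simp add: letters_def)
  show "fst ` set (whitehead_map Y v x) \<subseteq> A" "fst ` set (whitehead_map Y (inv_letter v) x) \<subseteq> A"
    using whitehead_map_letters[OF _ x] assms(1) by (simp_all add: set_subset_letters[symmetric])
qed (use assms inv_compatible_whitehead_map whitehead_map_inverse[of v Y]
      whitehead_map_inverse[of "inv_letter v" Y] in simp_all)

text \<open>What is left between the images of \<open>a\<close> and \<open>b\<close> once a trailing
  \<open>v\<close> of the one has met a leading \<open>inv_letter v\<close> of the other.\<close>

definition insertion :: "'a letter set \<Rightarrow> 'a letter \<Rightarrow> 'a letter \<Rightarrow> 'a letter \<Rightarrow> 'a word" where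
  "insertion Y v a b =
     (if inv_letter a \<notin> Y \<and> b \<in> Y then [inv_letter v]
      else if inv_letter a \<in> Y \<and> b \<notin> Y then [v] else [])"

text \<open>The parameter \<open>n\<close> stands for the letter following the end of the list,
  which in a cyclic word is its first letter.\<close>

primrec expand_aux :: "'a letter set \<Rightarrow> 'a letter \<Rightarrow> 'a letter \<Rightarrow> 'a word \<Rightarrow> 'a word" where
  "expand_aux Y v n [] = []"
| "expand_aux Y v n (a # l) = a # insertion Y v a (hd (l @ [n])) @ expand_aux Y v n l"

text \<open>As a cyclic word, \<open>expand Y v w\<close> is the reduced form of the image of \<open>w\<close> under
  \<^term>\<open>whitehead_map Y v\<close>.\<close>

definition expand :: "'a letter set \<Rightarrow> 'a letter \<Rightarrow> 'a word \<Rightarrow> 'a word" where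
  "expand Y v w = expand_aux Y v (hd w) w"

text \<open>For nonempty \<open>l\<close> and \<open>n = hd l\<close> the two outer factors are
  inverse to each other, so the image of \<open>l\<close> is conjugate to
  \<open>expand Y v l\<close>.\<close>

lemma reduce_subst_whitehead_map:
  "reduce (subst (whitehead_map Y v) l) =
     reduce ((if hd (l @ [n]) \<in> Y then [inv_letter v] else []) @ expand_aux Y v n l
       @ (if n \<in> Y then [v] else []))"
proof (induction l)
  case Nil
  then show ?case
    using reduce_append_inv_word_cancel(3)[of "[v]" "[]"] by simp
next
  case (Cons a l)
  let ?pre = "\<lambda>b. if b \<in> Y then [inv_letter v] else []"
  let ?suf = "if inv_letter a \<in> Y then [v] else []"
  let ?b = "hd (l @ [n])"
  let ?E = "expand_aux Y v n l" and ?post = "if n \<in> Y then [v] else []"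
  have ins: "reduce (?suf @ ?pre ?b) = reduce (insertion Y v a ?b)"
    using reduce_append_inv_word_cancel(4)[of "[v]" "[]"] by (simp add: insertion_def)
  have "reduce (subst (whitehead_map Y v) (a # l))
      = reduce ((?pre a @ [a] @ ?suf) @ ?pre ?b @ ?E @ ?post)"
    unfolding subst_simps whitehead_map_def[of Y v a] by (intro reduce_append_cong refl Cons.IH)
  also have "\<dots> = reduce ((?pre a @ [a]) @ (?suf @ ?pre ?b) @ ?E @ ?post)"
    by (simp only: append_assoc)
  also have "\<dots> = reduce ((?pre a @ [a]) @ insertion Y v a ?b @ ?E @ ?post)"
    by (intro reduce_append_cong refl ins)
  finally show ?case
    by simp
qed

text \<open>Up to conjugation \<open>expand Y v w\<close> is the image of \<open>w\<close> under an
  automorphism, and the inverse automorphism carries primitivity back to \<open>w\<close>.\<close>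

lemma prim_expand:
  assumes "prim k (expand Y v w)" "set w \<subseteq> letters {1..k}" "w \<noteq> []"
    and v: "v \<in> letters {1..k}" "v \<notin> Y" "inv_letter v \<notin> Y"
  shows "prim k w"
proof -
  let ?pre = "if hd w \<in> Y then [inv_letter v] else []"
  let ?f = "whitehead_map Y v" and ?g = "whitehead_map Y (inv_letter v)"
  have pre: "reduce (subst ?f w) = reduce (?pre @ expand Y v w @ inv_word ?pre)"
    using reduce_subst_whitehead_map[of Y v w "hd w"] assms(3) by (auto simp: expand_def)
  have letters_f: "set (subst ?f w) \<subseteq> letters {1..k}"
    using assms(2) whitehead_map_letters[OF v(1)] by (fastforce simp: set_subst)
  have "prim k (subst ?f w)"
  proof (rule prim_conj[of k "inv_word ?pre"])
    have "reduce (inv_word ?pre @ subst ?f w @ inv_word (inv_word ?pre))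
        = reduce (inv_word ?pre @ (?pre @ expand Y v w @ inv_word ?pre) @ ?pre)"
      unfolding inv_word_inv_word by (intro reduce_append_cong refl pre)
    also have "\<dots> = reduce (expand Y v w)"
      using reduce_append_inv_word_cancel(1)[of "expand Y v w" ?pre "[]"]
        reduce_append_inv_word_cancel(3)[of ?pre "expand Y v w @ inv_word ?pre @ ?pre"]
      by simp
    finally show "prim k (inv_word ?pre @ subst ?f w @ inv_word (inv_word ?pre))"
      using assms(1) letters_f v(1)
      unfolding prim_def set_subset_letters[symmetric] by auto
    show "fst ` set (subst ?f w) \<subseteq> {1..k}"
      using letters_f by (simp add: set_subset_letters)
  qed
  then have "primitive (F k) (reduce (subst ?g (subst ?f w)))"
    using v by (intro prim_subst whitehead_map_iso inv_compatible_whitehead_map) simp_all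
  also have "reduce (subst ?g (subst ?f w)) = reduce w"
    using reduce_subst_subst[of ?g w ?f] reduce_subst_reduce[of ?g "subst ?f w"]
      whitehead_map_inverse[of "inv_letter v" Y] v inv_compatible_whitehead_map[of Y "inv_letter v"]
    by simp
  finally show ?thesis
    using assms(2) by (simp add: prim_def set_subset_letters)
qed

text \<open>Both counts are linear; the cyclic word \<open>w\<close> enters them as \<open>w @ [hd w]\<close>, and then
  \<open>crossings Y\<close> counts the edges between \<open>Y\<close> and its complement in the Whitehead graph.\<close>

definition crossings :: "'a letter set \<Rightarrow> 'a word \<Rightarrow> nat" where
  "crossings Y l = length (filter (\<lambda>(a, b). (inv_letter a \<in> Y) \<noteq> (b \<in> Y)) (adj l))"

definition changes :: "('b \<Rightarrow> bool) \<Rightarrow> 'b list \<Rightarrow> nat" where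
  "changes Q l = length (filter (\<lambda>(a, b). Q a \<noteq> Q b) (adj l))"

lemma crossings_simps [simp]:
  "crossings Y [] = 0" "crossings Y [a] = 0"
  "crossings Y (a # b # l) = of_bool ((inv_letter a \<in> Y) \<noteq> (b \<in> Y)) + crossings Y (b # l)"
  by (auto simp: crossings_def)

lemma changes_simps [simp]:
  "changes Q [] = 0" "changes Q [a] = 0"
  "changes Q (a # b # l) = of_bool (Q a \<noteq> Q b) + changes Q (b # l)"
  by (auto simp: changes_def)

text \<open>The induction undoes \<open>expand_aux\<close> from the left. A letter \<open>v\<close>
  after a letter \<open>a\<close> with \<open>inv_letter a\<close> in \<open>Y\<close>, or an
  \<open>inv_letter v\<close> before a letter of \<open>Y\<close>, is what \<open>expand_aux\<close>
  reinserts, so it is deleted. By the cut condition each deleted letter accounts for exactly one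
  crossing, and there are no other crossings; therefore the length drops by
  \<open>crossings Y x\<close>. The last two premises keep the first and the last letter from being
  deleted.\<close>

lemma contract_aux:
  assumes v: "v \<notin> Y" "inv_letter v \<notin> Y"
    and "x \<noteq> []" "reduced x" "last x = n"
    and "\<And>a b. (a, b) \<in> set (adj x) \<Longrightarrow>
      (inv_letter a \<in> Y \<longrightarrow> b \<in> insert v Y) \<and> (b \<in> Y \<longrightarrow> inv_letter a \<in> insert v Y)"
    and "hd x = inv_letter v \<Longrightarrow> tl x \<noteq> [] \<Longrightarrow> hd (tl x) \<notin> Y"
    and "\<And>u a b. x = u @ [a, b] \<Longrightarrow> b = v \<Longrightarrow> inv_letter a \<notin> Y"
  shows "\<exists>l. expand_aux Y v n l @ [n] = x \<and> hd (l @ [n]) = hd x \<and> reduced (l @ [n])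
    \<and> length l + 1 + crossings Y x = length x
    \<and> filter (\<lambda>y. fst y \<noteq> fst v) (l @ [n]) = filter (\<lambda>y. fst y \<noteq> fst v) x
    \<and> (\<forall>P. changes P (l @ [n]) \<le> changes P x)" (is "?G x")
  using assms(3-)
proof (induction "length x" arbitrary: x rule: less_induct)
  case less
  note adjx = less.prems(4) and last2 = less.prems(6)
  obtain a x' where x: "x = a # x'"
    using less.prems(1) by (cases x) auto
  show ?case
  proof (cases x')
    case Nil
    then show ?thesis
      using less.prems x by (intro exI[of _ "[]"]) simp
  next
    case (Cons b w)
    note x = x[unfolded Cons]
    have ab: "inv_letter a \<in> Y \<longrightarrow> b \<in> insert v Y" "b \<in> Y \<longrightarrow> inv_letter a \<in> insert v Y"
      using adjx[of a b] x by auto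
    have red: "b \<noteq> inv_letter a" "reduced (b # w)"
      using less.prems(2) x by (auto simp: reduced_Cons_iff)
    have a: "a = inv_letter v \<Longrightarrow> b \<notin> Y"
      using less.prems(5) x by simp
    show ?thesis
    proof (cases "(b = v \<and> inv_letter a \<in> Y) \<or> (b = inv_letter v \<and> w \<noteq> [] \<and> hd w \<in> Y)")
      case False
      have "?G (b # w)"
      proof (rule less.hyps)
        show "length (b # w) < length x" "b # w \<noteq> []" "reduced (b # w)" "last (b # w) = n"
          using x red less.prems(3) by simp_all
        show "(inv_letter a' \<in> Y \<longrightarrow> b' \<in> insert v Y) \<and> (b' \<in> Y \<longrightarrow> inv_letter a' \<in> insert v Y)"
          if "(a', b') \<in> set (adj (b # w))" for a' b'
          using adjx[of a' b'] x that by simp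
        show "hd (tl (b # w)) \<notin> Y" if "hd (b # w) = inv_letter v" "tl (b # w) \<noteq> []"
          using False that by auto
        show "inv_letter a' \<notin> Y" if "b # w = u @ [a', b']" "b' = v" for u a' b'
          using last2[of "a # u" a' b'] x that by simp
      qed
      then obtain l where l: "expand_aux Y v n l @ [n] = b # w" "hd (l @ [n]) = b"
        "reduced (l @ [n])" "length l + 1 + crossings Y (b # w) = length (b # w)"
        "filter (\<lambda>y. fst y \<noteq> fst v) (l @ [n]) = filter (\<lambda>y. fst y \<noteq> fst v) (b # w)"
        "\<And>P. changes P (l @ [n]) \<le> changes P (b # w)"
        by auto
      have nc: "(inv_letter a \<in> Y) = (b \<in> Y)"
        using False ab a by auto
      have ch: "changes P (a # l @ [n]) = of_bool (P a \<noteq> P b) + changes P (l @ [n])" for P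
        using l(2) by (cases l) auto
      have "reduced (a # l @ [n])"
        using l(2,3) red(1) by (simp add: reduced_Cons_iff)
      then show ?thesis
        using l nc x by (intro exI[of _ "a # l"]) (simp add: insertion_def ch)
    next
      case True
      then have "w \<noteq> []"
        using last2[of "[]" a b] x by auto
      then obtain c w' where w: "w = c # w'"
        by (cases w) auto
      have bc: "inv_letter b \<in> Y \<longrightarrow> c \<in> insert v Y" "c \<in> Y \<longrightarrow> inv_letter b \<in> insert v Y"
        using adjx[of b c] x w by auto
      have redc: "c \<noteq> inv_letter b" "reduced (c # w')"
        using red w by (auto simp: reduced_Cons_iff)
      have cY: "b = v \<and> inv_letter a \<in> Y \<and> c \<notin> Y \<or> b = inv_letter v \<and> inv_letter a \<notin> Y \<and> c \<in> Y"
        using True bc ab v w by auto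
      have "?G (c # w')"
      proof (rule less.hyps)
        show "length (c # w') < length x" "c # w' \<noteq> []" "reduced (c # w')" "last (c # w') = n"
          using x w redc less.prems(3) by simp_all
        show "(inv_letter a' \<in> Y \<longrightarrow> b' \<in> insert v Y) \<and> (b' \<in> Y \<longrightarrow> inv_letter a' \<in> insert v Y)"
          if "(a', b') \<in> set (adj (c # w'))" for a' b'
          using adjx[of a' b'] x w that by simp
        show "hd (tl (c # w')) \<notin> Y" if "hd (c # w') = inv_letter v" "tl (c # w') \<noteq> []"
          using that cY redc(1) v by auto
        show "inv_letter a' \<notin> Y" if "c # w' = u @ [a', b']" "b' = v" for u a' b'
          using last2[of "a # b # u" a' b'] x w that by simp
      qed
      then obtain l where l: "expand_aux Y v n l @ [n] = c # w'" "hd (l @ [n]) = c"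
        "reduced (l @ [n])" "length l + 1 + crossings Y (c # w') = length (c # w')"
        "filter (\<lambda>y. fst y \<noteq> fst v) (l @ [n]) = filter (\<lambda>y. fst y \<noteq> fst v) (c # w')"
        "\<And>P. changes P (l @ [n]) \<le> changes P (c # w')"
        by auto
      have ch: "changes P (a # l @ [n]) = of_bool (P a \<noteq> P c) + changes P (l @ [n])" for P
        using l(2) by (cases l) auto
      \<comment> \<open>Deleting \<open>b\<close> from \<open>a b c\<close> adds no change: if
        \<open>P a\<close> and \<open>P c\<close> differ, one of the two original steps was a
        change.\<close>
      have "changes P (a # l @ [n]) \<le> changes P x" for P
        unfolding ch using l(6)[of P] x w by (auto simp: of_bool_def)
      moreover have "c \<noteq> inv_letter a"
        using cY by auto
      then have "reduced (a # l @ [n])"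
        using l(2,3) by (simp add: reduced_Cons_iff)
      moreover have "expand_aux Y v n (a # l) @ [n] = x"
        using cY l(1,2) x w by (auto simp: insertion_def)
      moreover have "length (a # l) + 1 + crossings Y x = length x"
        using cY l(4) x w v by auto
      moreover have "fst b = fst v"
        using cY by auto
      ultimately show ?thesis
        using l(5) x w by (intro exI[of _ "a # l"]) simp
    qed
  qed
qed

text \<open>Excludes that the first letter of \<open>w\<close> is among the letters \<open>v\<close> cancelled by the
  reduction.\<close>

definition head_survives :: "'a letter set \<Rightarrow> 'a letter \<Rightarrow> 'a word \<Rightarrow> bool" where
  "head_survives Y v w \<longleftrightarrow>
     (hd w = inv_letter v \<longrightarrow> hd (tl w @ [hd w]) \<notin> Y) \<and> \<not> (hd w = v \<and> inv_letter (last w) \<in> Y)"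

lemma head_survives_other: "fst (hd w) \<noteq> fst v \<Longrightarrow> head_survives Y v w"
  by (auto simp: head_survives_def)

lemma cyc_reduced_iff: "w \<noteq> [] \<Longrightarrow> cyc_reduced w \<longleftrightarrow> reduced (w @ [hd w])"
  by (auto simp: cyc_reduced_def reduced_append_iff)

lemma whitehead_contract:
  assumes cut: "whitehead_cut A Y v w" and "w \<noteq> []" "cyc_reduced w" "head_survives Y v w"
  obtains l where "l \<noteq> []" "hd l = hd w" "cyc_reduced l" "expand Y v l = w"
    "length l + crossings Y (w @ [hd w]) = length w"
    "filter (\<lambda>y. fst y \<noteq> fst v) l = filter (\<lambda>y. fst y \<noteq> fst v) w"
    "\<And>P. changes P (l @ [hd l]) \<le> changes P (w @ [hd w])"
proof -
  have v: "v \<notin> Y" "inv_letter v \<notin> Y"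
    using cut by (auto simp: whitehead_cut_def)
  have "\<exists>l. expand_aux Y v (hd w) l @ [hd w] = w @ [hd w] \<and> hd (l @ [hd w]) = hd (w @ [hd w])
    \<and> reduced (l @ [hd w]) \<and> length l + 1 + crossings Y (w @ [hd w]) = length (w @ [hd w])
    \<and> filter (\<lambda>y. fst y \<noteq> fst v) (l @ [hd w]) = filter (\<lambda>y. fst y \<noteq> fst v) (w @ [hd w])
    \<and> (\<forall>P. changes P (l @ [hd w]) \<le> changes P (w @ [hd w]))"
  proof (rule contract_aux[OF v])
    show "reduced (w @ [hd w])"
      using assms(2,3) by (simp add: cyc_reduced_iff)
    show "(inv_letter a \<in> Y \<longrightarrow> b \<in> insert v Y) \<and> (b \<in> Y \<longrightarrow> inv_letter a \<in> insert v Y)"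
      if "(a, b) \<in> set (adj (w @ [hd w]))" for a b
      using cut that by (auto simp: whitehead_cut_def cyc_adj_def)
    show "hd (tl (w @ [hd w])) \<notin> Y" if "hd (w @ [hd w]) = inv_letter v"
      using assms(2,4) that by (simp add: head_survives_def)
    show "inv_letter a \<notin> Y" if "w @ [hd w] = u @ [a, b]" "b = v" for u a b
    proof -
      have "w @ [hd w] = (u @ [a]) @ [b]"
        unfolding that(1) by simp
      then have "w = u @ [a]" "hd w = b"
        by (blast dest: append1_eq_conv[THEN iffD1])+
      then have "last w = a" "hd w = v"
        using that(2) by simp_all
      then show ?thesis
        using assms(4) by (auto simp: head_survives_def)
    qed
  qed simp_all
  then obtain l where l: "expand_aux Y v (hd w) l = w" "hd (l @ [hd w]) = hd w"
    "reduced (l @ [hd w])" "length l + crossings Y (w @ [hd w]) = length w"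
    "filter (\<lambda>y. fst y \<noteq> fst v) l = filter (\<lambda>y. fst y \<noteq> fst v) w"
    "\<And>P. changes P (l @ [hd w]) \<le> changes P (w @ [hd w])"
    using assms(2) by auto
  have "l \<noteq> []"
    using l(1) assms(2) by auto
  moreover from this have "hd l = hd w"
    using l(2) by simp
  ultimately show ?thesis
    using l by (intro that[of l]) (simp_all add: cyc_reduced_iff expand_def)
qed

section \<open>Rotation of cyclic words\<close>

lemma adj_append: "adj (u @ y # v) = adj (u @ [y]) @ adj (y # v)"
proof (induction u)
  case (Cons x u)
  then show ?case
    by (cases u) auto
qed simp

lemma mset_cyc_adj_rotate1: "mset (cyc_adj (rotate1 w)) = mset (cyc_adj w)"
proof (cases w)
  case (Cons a w')
  show ?thesis
  proof (cases w')
    case (Cons b u)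
    then show ?thesis
      using \<open>w = a # w'\<close> adj_append[of "b # u" a "[b]"] by (simp add: cyc_adj_def)
  qed (use Cons in simp)
qed simp

lemma set_cyc_adj_rotate1: "set (cyc_adj (rotate1 w)) = set (cyc_adj w)"
  using mset_cyc_adj_rotate1 mset_eq_setD by blast

lemma whitehead_cut_rotate1 [simp]: "whitehead_cut A Y v (rotate1 w) \<longleftrightarrow> whitehead_cut A Y v w"
  by (simp add: whitehead_cut_def set_cyc_adj_rotate1)

lemma cyclic_count_rotate1:
  "length (filter Q (adj (rotate1 w @ [hd (rotate1 w)]))) = length (filter Q (adj (w @ [hd w])))"
  using arg_cong[OF mset_cyc_adj_rotate1[of w], of "\<lambda>M. size (filter_mset Q M)"]
  by (simp add: cyc_adj_def flip: mset_filter)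

text \<open>Two cyclically neighbouring letters are never both deleted. A deleted
  \<open>inv_letter v\<close> is followed by a letter of \<open>Y\<close>, which is neither
  \<open>v\<close> nor its inverse. A deleted \<open>v\<close> is not followed by
  \<open>inv_letter v\<close>, and a second \<open>v\<close> after it stays because
  \<open>inv_letter v\<close> is not in \<open>Y\<close>.\<close>

lemma head_survives_rotate1:
  assumes cut: "whitehead_cut A Y v w" and "w \<noteq> []" "cyc_reduced w"
    and "\<not> head_survives Y v w"
  shows "head_survives Y v (rotate1 w)"
proof -
  have v: "v \<notin> Y" "inv_letter v \<notin> Y"
    using cut by (auto simp: whitehead_cut_def)
  obtain a w' where w: "w = a # w'"
    using assms(2) by (cases w) auto
  show ?thesis
  proof (cases w')
    case Nil
    then show ?thesis
      using assms(4) w v by (auto simp: head_survives_def)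
  next
    case (Cons b u)
    then have "b \<noteq> inv_letter a"
      using assms(3) w by (simp add: cyc_reduced_def reduced_Cons_iff)
    then show ?thesis
      using assms(4) w Cons v by (auto simp: head_survives_def)
  qed
qed

section \<open>Counting words\<close>

lemma lists_length_Suc:
  "{w. length w = Suc n \<and> set w \<subseteq> L \<and> Q w} =
     (\<lambda>(a, w). a # w) ` (SIGMA a:L. {w. length w = n \<and> set w \<subseteq> L \<and> Q (a # w)})" (is "?A = ?B")
proof
  show "?A \<subseteq> ?B"
  proof
    fix w assume "w \<in> ?A"
    then obtain a u where "w = a # u" "length u = n" "a \<in> L" "set u \<subseteq> L" "Q (a # u)"
      by (auto simp: length_Suc_conv)
    then show "w \<in> ?B"
      by (intro image_eqI[of _ _ "(a, u)"]) auto
  qed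
qed auto

lemma finite_words_length: "finite L \<Longrightarrow> finite {w. length w = N \<and> set w \<subseteq> L \<and> Q w}"
  by (rule finite_subset[OF _ finite_lists_length_eq[of L N]]) auto

lemma card_bound_subset:
  assumes "\<exists>C. \<forall>N. real (card (T N)) \<le> C * h N" "\<And>N. S N \<subseteq> T N" "\<And>N. finite (T N)"
  shows "\<exists>C. \<forall>N. real (card (S N)) \<le> C * h N"
  using assms card_mono by (meson of_nat_le_iff order_trans)

lemma card_bound_Un:
  fixes h :: "nat \<Rightarrow> real"
  assumes "\<exists>C. \<forall>N. real (card (S N)) \<le> C * h N" "\<exists>C. \<forall>N. real (card (T N)) \<le> C * h N"
  shows "\<exists>C. \<forall>N. real (card (S N \<union> T N)) \<le> C * h N"
proof -
  obtain C D where *: "\<And>N. real (card (S N)) \<le> C * h N" "\<And>N. real (card (T N)) \<le> D * h N"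
    using assms by blast
  have "real (card (S N \<union> T N)) \<le> (C + D) * h N" for N
  proof -
    have "real (card (S N \<union> T N)) \<le> real (card (S N) + card (T N))"
      using card_Un_le by (simp only: of_nat_le_iff)
    then show ?thesis
      using *[of N] by (simp add: distrib_right)
  qed
  then show ?thesis
    by blast
qed

lemma card_lists_length_Suc:
  assumes "finite L"
  shows "card {w. length w = Suc n \<and> set w \<subseteq> L \<and> Q w}
    = (\<Sum>a\<in>L. card {w. length w = n \<and> set w \<subseteq> L \<and> Q (a # w)})"
proof -
  have fin: "finite {w. length w = n \<and> set w \<subseteq> L \<and> Q (a # w)}" for a
    using assms by (rule finite_words_length)
  have "inj_on (\<lambda>(a, w). a # w) (SIGMA a:L. {w. length w = n \<and> set w \<subseteq> L \<and> Q (a # w)})"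
    by (auto simp: inj_on_def)
  then have "card {w. length w = Suc n \<and> set w \<subseteq> L \<and> Q w}
      = card (SIGMA a:L. {w. length w = n \<and> set w \<subseteq> L \<and> Q (a # w)})"
    unfolding lists_length_Suc by (rule card_image)
  then show ?thesis
    using assms fin by simp
qed

lemma card_reduced_continuations:
  assumes "finite A" "a \<in> letters A"
  shows "card {w. length w = n \<and> set w \<subseteq> letters A \<and> reduced (a # w)} = (2 * card A - 1) ^ n"
  using assms(2)
proof (induction n arbitrary: a)
  case 0
  have "{w. length w = 0 \<and> set w \<subseteq> letters A \<and> reduced (a # w)} = {[]}"
    by auto
  then show ?case
    by simp
next
  case (Suc n)
  have "card {w. length w = Suc n \<and> set w \<subseteq> letters A \<and> reduced (a # w)}
      = (\<Sum>b\<in>letters A. card {w. length w = n \<and> set w \<subseteq> letters A \<and> reduced (a # b # w)})"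
    using assms(1) by (intro card_lists_length_Suc) simp
  also have "\<dots> = (\<Sum>b\<in>letters A - {inv_letter a}. (2 * card A - 1) ^ n)"
  proof (intro sum.mono_neutral_cong_right ballI)
    fix b assume "b \<in> letters A - (letters A - {inv_letter a})"
    then have "{w. length w = n \<and> set w \<subseteq> letters A \<and> reduced (a # b # w)} = {}"
      by (auto simp: reduced_Cons_iff)
    then show "card {w. length w = n \<and> set w \<subseteq> letters A \<and> reduced (a # b # w)} = 0"
      by (simp only: card.empty)
  next
    fix b assume b: "b \<in> letters A - {inv_letter a}"
    then have "{w. length w = n \<and> set w \<subseteq> letters A \<and> reduced (a # b # w)}
        = {w. length w = n \<and> set w \<subseteq> letters A \<and> reduced (b # w)}"
      by (auto simp: reduced_Cons_iff)
    then show "card {w. length w = n \<and> set w \<subseteq> letters A \<and> reduced (a # b # w)}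
        = (2 * card A - 1) ^ n"
      using Suc.IH[of b] b by simp
  qed (use assms(1) in auto)
  also have "\<dots> = (2 * card A - 1) ^ Suc n"
    using assms(1) Suc.prems by (simp add: card_letters)
  finally show ?case .
qed

lemma card_reduced_words:
  assumes "finite A"
  shows "card {w \<in> reduced_words A. length w = Suc n} = 2 * card A * (2 * card A - 1) ^ n"
proof -
  have "{w \<in> reduced_words A. length w = Suc n}
      = {w. length w = Suc n \<and> set w \<subseteq> letters A \<and> reduced w}"
    by (auto simp: reduced_words_iff)
  then show ?thesis
    using card_lists_length_Suc[of "letters A" n reduced] assms
    by (simp add: card_reduced_continuations card_letters)
qed

lemma finite_reduced_words_length:
  "finite A \<Longrightarrow> finite {w \<in> reduced_words A. length w = n}"
  by (rule finite_subset[OF _ finite_lists_length_eq[of "letters A" n]])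
    (auto simp: reduced_words_iff)

lemma card_reduced_words_bounds:
  assumes "finite A" "card A \<ge> 1"
  shows "(2 * card A - 1) ^ n \<le> card {w \<in> reduced_words A. length w = n}"
    and "card {w \<in> reduced_words A. length w = n} \<le> 2 * (2 * card A - 1) ^ n"
proof -
  have "{w \<in> reduced_words A. length w = 0} = {[]}"
    by (auto simp: reduced_words_iff)
  moreover have "(2 * card A - 1) * x \<le> 2 * card A * x" for x
    by (intro mult_right_mono) auto
  moreover have "2 * card A * x \<le> 2 * ((2 * card A - 1) * x)" for x
  proof -
    have "card A \<le> 2 * card A - 1"
      using assms(2) by simp
    then have "card A * x \<le> (2 * card A - 1) * x"
      by (rule mult_right_mono) simp
    then show ?thesis
      by simp
  qed
  ultimately show "(2 * card A - 1) ^ n \<le> card {w \<in> reduced_words A. length w = n}"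
    "card {w \<in> reduced_words A. length w = n} \<le> 2 * (2 * card A - 1) ^ n"
    by (cases n; simp only: card_reduced_words[OF assms(1)] power_Suc; simp)+
qed

section \<open>Words with boundedly many forbidden transitions, and contracting recursions\<close>

definition defects :: "('b \<Rightarrow> 'b \<Rightarrow> bool) \<Rightarrow> 'b list \<Rightarrow> nat" where
  "defects G l = length (filter (\<lambda>(a, b). \<not> G a b) (adj l))"

lemma defects_simps [simp]:
  "defects G [] = 0" "defects G [a] = 0"
  "defects G (a # b # l) = of_bool (\<not> G a b) + defects G (b # l)"
  by (auto simp: defects_def)

text \<open>A strict supersolution \<open>h\<close> of the transfer operator stays a supersolution when each
  defect is weighted by a small factor.\<close>

lemma card_few_defects_supersolution:
  fixes h :: "'b \<Rightarrow> real" and q :: real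
  assumes "finite L" and h: "\<And>a. a \<in> L \<Longrightarrow> h a > 0"
    and sup: "\<And>a. a \<in> L \<Longrightarrow> (\<Sum>b | b \<in> L \<and> G a b. h b) < q * h a" and "q > 0"
  shows "\<exists>C. \<forall>N. real (card {w. length w = N \<and> set w \<subseteq> L \<and> defects G w \<le> K}) \<le> C * q ^ N"
proof (cases "L = {}")
  case True
  then have "{w. length w = N \<and> set w \<subseteq> L \<and> defects G w \<le> K} = (if N = 0 then {[]} else {})" for N
    by auto
  then have "real (card {w. length w = N \<and> set w \<subseteq> L \<and> defects G w \<le> K}) \<le> 1 * q ^ N" for N
    using \<open>q > 0\<close> by simp
  then show ?thesis
    by blast
next
  case False
  define m where "m = Min (h ` L)"
  define e where "e = Min ((\<lambda>a. q * h a - (\<Sum>b | b \<in> L \<and> G a b. h b)) ` L)"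
  define T where "T = (\<Sum>b\<in>L. h b)"
  \<comment> \<open>\<open>e\<close> is the slack of the supersolution. A defect is discounted by
    \<open>1 / M\<close>, and \<open>T / M \<le> e\<close> makes all defective successors together
    fit into this slack.\<close>
  define M where "M = T / e + 1"
  have "m > 0" "e > 0"
    using False assms by (auto simp: m_def e_def)
  have hm: "h a \<ge> m" and he: "(\<Sum>b | b \<in> L \<and> G a b. h b) + e \<le> q * h a" if "a \<in> L" for a
  proof -
    show "h a \<ge> m"
      unfolding m_def using that assms(1) by (intro Min_le) auto
    have "e \<le> q * h a - (\<Sum>b | b \<in> L \<and> G a b. h b)"
      unfolding e_def using that assms(1) by (intro Min_le) auto
    then show "(\<Sum>b | b \<in> L \<and> G a b. h b) + e \<le> q * h a"
      by simp
  qed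
  have "T \<ge> 0"
    unfolding T_def using h by (intro sum_nonneg) (auto simp: less_imp_le)
  then have M: "M \<ge> 1" "T \<le> e * M"
    using \<open>e > 0\<close> by (auto simp: M_def field_simps)
  let ?t = "\<lambda>a n k. card {w. length w = n \<and> set w \<subseteq> L \<and> defects G (a # w) \<le> k}"
  have t: "real (?t a n k) \<le> h a / m * M ^ k * q ^ n" if "a \<in> L" for a n k
    using that
  proof (induction n arbitrary: a k)
    case 0
    have "{w. length w = 0 \<and> set w \<subseteq> L \<and> defects G (a # w) \<le> k} = {[]}"
      by auto
    moreover have "1 \<le> h a / m" "1 \<le> M ^ k"
      using hm[OF 0] \<open>m > 0\<close> M(1) by simp_all
    then have "1 * 1 \<le> h a / m * M ^ k"
      by (intro mult_mono) auto
    ultimately show ?case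
      by simp
  next
    case (Suc n)
    let ?u = "\<lambda>b. card {w. length w = n \<and> set w \<subseteq> L \<and> defects G (a # b # w) \<le> k}"
    define c where "c = M ^ k * q ^ n / m"
    have "c > 0"
      using M(1) \<open>q > 0\<close> \<open>m > 0\<close> by (auto simp: c_def)
    have good: "real (?u b) \<le> c * h b" if "b \<in> L" "G a b" for b
      using Suc.IH[OF that(1), of k] that(2) by (simp add: c_def mult_ac)
    have bad: "real (?u b) \<le> c / M * h b" if "b \<in> L" "\<not> G a b" for b
    proof (cases k)
      case 0
      then show ?thesis
        using that \<open>c > 0\<close> M(1) h[of b] by (simp add: less_imp_le)
    next
      case (Suc k')
      then show ?thesis
        using Suc.IH[OF that(1), of k'] that(2) M(1) by (simp add: c_def mult_ac)
    qed
    have "real (?t a (Suc n) k) = (\<Sum>b\<in>L. real (?u b))"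
      by (simp only: card_lists_length_Suc[OF assms(1)] of_nat_sum)
    also have "\<dots> = (\<Sum>b | b \<in> L \<and> G a b. real (?u b)) + (\<Sum>b | b \<in> L \<and> \<not> G a b. real (?u b))"
      using assms(1) by (subst sum.union_disjoint[symmetric]) (auto intro: sum.cong)
    also have "\<dots> \<le> (\<Sum>b | b \<in> L \<and> G a b. c * h b) + (\<Sum>b | b \<in> L \<and> \<not> G a b. c / M * h b)"
      using good bad by (intro add_mono sum_mono) auto
    also have "(\<Sum>b | b \<in> L \<and> \<not> G a b. c / M * h b) \<le> (\<Sum>b\<in>L. c / M * h b)"
      using assms(1) \<open>c > 0\<close> M(1) h by (intro sum_mono2) (auto simp: less_imp_le)
    also have "\<dots> = c * (T / M)"
      by (simp add: T_def sum_distrib_left sum_divide_distrib)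
    also have "\<dots> \<le> c * e"
      using M \<open>c > 0\<close> by (intro mult_left_mono) (auto simp: field_simps)
    also have "(\<Sum>b | b \<in> L \<and> G a b. c * h b) + c * e = c * ((\<Sum>b | b \<in> L \<and> G a b. h b) + e)"
      by (simp add: sum_distrib_left distrib_left)
    also have "\<dots> \<le> c * (q * h a)"
      using he[OF Suc.prems] \<open>c > 0\<close> by (intro mult_left_mono) auto
    finally show ?case
      by (simp add: c_def mult_ac)
  qed
  have "real (card {w. length w = N \<and> set w \<subseteq> L \<and> defects G w \<le> K})
      \<le> (1 + T / m * M ^ K / q) * q ^ N" for N
  proof (cases N)
    case 0
    have "{w. length w = 0 \<and> set w \<subseteq> L \<and> defects G w \<le> K} = {[]}"
      by auto
    then show ?thesis
      using 0 \<open>T \<ge> 0\<close> \<open>m > 0\<close> M(1) \<open>q > 0\<close> by simp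
  next
    case (Suc n)
    have "real (card {w. length w = Suc n \<and> set w \<subseteq> L \<and> defects G w \<le> K}) = (\<Sum>a\<in>L. real (?t a n K))"
      by (simp only: card_lists_length_Suc[OF assms(1)] of_nat_sum)
    also have "\<dots> \<le> (\<Sum>a\<in>L. h a / m * M ^ K * q ^ n)"
      by (intro sum_mono t)
    also have "\<dots> = (T / m * M ^ K / q) * q ^ Suc n"
      unfolding T_def power_Suc using \<open>q > 0\<close>
      by (simp only: sum_divide_distrib[symmetric] sum_distrib_right[symmetric]) simp
    also have "\<dots> \<le> (1 + T / m * M ^ K / q) * q ^ Suc n"
      using \<open>q > 0\<close> by (intro mult_right_mono) auto
    finally show ?thesis
      using Suc by simp
  qed
  then show ?thesis
    by blast
qed

text \<open>Since all out-degrees are at most \<open>q\<close>, a constant function is a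
  supersolution, but not a strict one. The deficit at the low letters is spread backwards along
  paths of length at most two, which makes the inequality strict everywhere.\<close>

lemma card_few_defects:
  fixes G :: "'b \<Rightarrow> 'b \<Rightarrow> bool" and q :: nat
  assumes "finite L" "q > 0"
    and deg: "\<And>a. a \<in> L \<Longrightarrow> card {b \<in> L. G a b} \<le> q"
    and low: "\<And>a. low a \<longleftrightarrow> card {b \<in> L. G a b} < q"
    and reach: "\<And>a. a \<in> L \<Longrightarrow>
      low a \<or> (\<exists>b\<in>L. G a b \<and> low b) \<or> (\<exists>b\<in>L. G a b \<and> (\<exists>c\<in>L. G b c \<and> low c))"
  shows "\<exists>C. \<forall>N. real (card {w. length w = N \<and> set w \<subseteq> L \<and> defects G w \<le> K}) \<le> C * real q ^ N"
proof -
  \<comment> \<open>\<open>h\<close> is lowered from 1 by \<open>(q + 1) * \<delta>\<close> at low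
    letters and by \<open>\<delta>\<close> at their predecessors. Strictness at a low letter needs
    \<open>q * (q + 1) * \<delta> < 1\<close>, at a predecessor
    \<open>q * \<delta> < (q + 1) * \<delta>\<close>, and one step further back only
    \<open>\<delta> > 0\<close>.\<close>
  define \<delta> where "\<delta> = 1 / (real q ^ 2 + real q + 1)"
  define h where "h a = (if low a then 1 - (real q + 1) * \<delta>
    else if \<exists>b\<in>L. G a b \<and> low b then 1 - \<delta> else 1)" for a
  have pos: "real q ^ 2 + real q + 1 > 0"
    by (simp add: add_nonneg_pos)
  then have "\<delta> > 0"
    by (simp add: \<delta>_def)
  have q2: "real q * ((real q + 1) * \<delta>) < 1"
    using pos by (simp add: \<delta>_def field_simps power2_eq_square)
  have "real q \<ge> 1"
    using assms(2) by simp
  have "(real q + 1) * \<delta> \<le> real q * ((real q + 1) * \<delta>)"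
    using mult_right_mono[OF \<open>real q \<ge> 1\<close>, of "(real q + 1) * \<delta>"] \<open>\<delta> > 0\<close> by simp
  then have q1: "(real q + 1) * \<delta> < 1"
    using q2 by linarith
  have "\<delta> \<le> (real q + 1) * \<delta>"
    using \<open>\<delta> > 0\<close> by simp
  then have "\<delta> < 1"
    using q1 by linarith
  have h1: "h a \<le> 1" "h a > 0" for a
    using \<open>\<delta> > 0\<close> \<open>\<delta> < 1\<close> q1 by (auto simp: h_def)
  have sum_le: "(\<Sum>b | b \<in> L \<and> G a b. h b) \<le> real (card {b \<in> L. G a b})" for a
    using sum_bounded_above[of "{b. b \<in> L \<and> G a b}" h 1] h1 by simp
  have sum_le': "(\<Sum>b | b \<in> L \<and> G a b. h b) \<le> real q - 1 + x"
    if "a \<in> L" "b \<in> L" "G a b" "h b \<le> x" for a b x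
  proof -
    have "(\<Sum>c | c \<in> L \<and> G a c. h c) = h b + (\<Sum>c \<in> {c \<in> L. G a c} - {b}. h c)"
      using assms(1) that by (subst sum.remove[of _ b]) auto
    also have "(\<Sum>c \<in> {c \<in> L. G a c} - {b}. h c) \<le> real (card ({c \<in> L. G a c} - {b}))"
      using sum_bounded_above[of "{c \<in> L. G a c} - {b}" h 1] h1 by simp
    also have "real (card ({c \<in> L. G a c} - {b})) = real (card {c \<in> L. G a c}) - 1"
    proof -
      have "card {c \<in> L. G a c} > 0"
        using assms(1) that by (auto simp: card_gt_0_iff)
      then show ?thesis
        using that by (simp add: of_nat_diff)
    qed
    finally show ?thesis
      using deg[OF that(1)] that(4) by linarith
  qed
  have "(\<Sum>b | b \<in> L \<and> G a b. h b) < real q * h a" if a: "a \<in> L" for a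
  proof -
    consider "low a" | b where "\<not> low a" "b \<in> L" "G a b" "low b"
      | b where "\<not> low a" "\<not> (\<exists>b\<in>L. G a b \<and> low b)" "b \<in> L" "G a b" "\<exists>c\<in>L. G b c \<and> low c"
      using reach[OF a] by blast
    then show ?thesis
    proof cases
      case 1
      then have "real (card {b \<in> L. G a b}) \<le> real q - 1"
        using low[of a] by linarith
      then show ?thesis
        using sum_le[of a] q2 1 by (simp add: h_def right_diff_distrib)
    next
      case 2
      have "(\<Sum>b | b \<in> L \<and> G a b. h b) \<le> real q - 1 + (1 - (real q + 1) * \<delta>)"
        using 2 a by (intro sum_le') (auto simp: h_def)
      also have "\<dots> < real q * (1 - \<delta>)"
        using \<open>\<delta> > 0\<close> by (simp add: algebra_simps)
      also have "1 - \<delta> = h a"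
        using 2 by (auto simp: h_def)
      finally show ?thesis .
    next
      case 3
      have "(\<Sum>b | b \<in> L \<and> G a b. h b) \<le> real q - 1 + (1 - \<delta>)"
        using 3 a by (intro sum_le'[of a b]) (auto simp: h_def)
      also have "\<dots> < real q * 1"
        using \<open>\<delta> > 0\<close> by simp
      also have "1 = h a"
        using 3 by (auto simp: h_def)
      finally show ?thesis .
    qed
  qed
  then show ?thesis
    using assms(1,2) h1 by (intro card_few_defects_supersolution[of L h]) auto
qed

text \<open>A renewal inequality: after division by \<open>q ^ N\<close> the recursion has total
  weight at most \<open>\<beta> < 1\<close>, so the bound reproduces itself with the solution
  \<open>C\<close> of \<open>C = c + C * \<beta>\<close>. Monotonicity of \<open>g\<close> replaces
  \<open>g (N - d)\<close> by \<open>g N\<close>.\<close>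

lemma convolution_bound:
  fixes f g \<alpha> :: "nat \<Rightarrow> real" and q \<beta> c :: real
  assumes "q > 0" "\<beta> < 1" "c \<ge> 0" "mono g" "\<And>n. g n \<ge> 0" "\<And>d. \<alpha> d \<ge> 0"
    and sum: "\<And>N. (\<Sum>d=1..N. \<alpha> d / q ^ d) \<le> \<beta>"
    and rec: "\<And>N. f N \<le> c * g N * q ^ N + (\<Sum>d=1..N. \<alpha> d * f (N - d))"
  shows "f N \<le> c / (1 - \<beta>) * g N * q ^ N"
proof (induction N rule: less_induct)
  case (less N)
  let ?C = "c / (1 - \<beta>)"
  have C: "?C \<ge> 0"
    using assms by simp
  have "(\<Sum>d=1..N. \<alpha> d * f (N - d)) \<le> (\<Sum>d=1..N. ?C * g N * q ^ N * (\<alpha> d / q ^ d))"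
  proof (rule sum_mono)
    fix d assume d: "d \<in> {1..N}"
    have "f (N - d) \<le> ?C * g (N - d) * q ^ (N - d)"
      using d by (intro less) auto
    also have "\<dots> \<le> ?C * g N * q ^ (N - d)"
      using C assms(1,4) by (intro mult_right_mono mult_left_mono) (auto simp: mono_def)
    also have "q ^ (N - d) = q ^ N / q ^ d"
      using d assms(1) by (simp add: power_diff)
    finally have "\<alpha> d * f (N - d) \<le> \<alpha> d * (?C * g N * (q ^ N / q ^ d))"
      using assms(6) by (rule mult_left_mono)
    then show "\<alpha> d * f (N - d) \<le> ?C * g N * q ^ N * (\<alpha> d / q ^ d)"
      by (simp add: mult_ac)
  qed
  also have "\<dots> = ?C * g N * q ^ N * (\<Sum>d=1..N. \<alpha> d / q ^ d)"
    by (simp add: sum_distrib_left)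
  also have "\<dots> \<le> ?C * g N * q ^ N * \<beta>"
    using assms(1,5) by (intro mult_left_mono[OF sum] mult_nonneg_nonneg C) auto
  finally have "f N \<le> c * g N * q ^ N + ?C * g N * q ^ N * \<beta>"
    using rec[of N] by linarith
  also have "\<dots> = (c + ?C * \<beta>) * g N * q ^ N"
    by (simp add: algebra_simps)
  also have "c + ?C * \<beta> = ?C"
    using assms(2) by (simp add: field_simps)
  finally show ?case .
qed

declare One_nat_def [simp del]

section \<open>Cyclically reduced primitive words\<close>

definition cyc_prims :: "nat \<Rightarrow> nat word set" where
  "cyc_prims k = {w. w \<noteq> [] \<and> set w \<subseteq> letters {1..k} \<and> cyc_reduced w \<and> prim k w}"

lemma cyc_primsD:
  assumes "w \<in> cyc_prims k"
  shows "w \<noteq> []" "set w \<subseteq> letters {1..k}" "cyc_reduced w" "prim k w" "reduced w"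
    "reduced (w @ [hd w])"
  using assms cyc_reduced_iff[of w]
  by (auto simp: cyc_prims_def cyc_reduced_def reduced_append_iff)

lemma finite_cyc_prims: "finite {w \<in> cyc_prims k. length w = N}"
  by (rule finite_subset[OF _ finite_lists_length_eq[of "letters {1..k}" N]])
    (auto simp: cyc_prims_def)

lemma cyc_prims_cut:
  assumes "w \<in> cyc_prims k" "k \<ge> 2"
  obtains Y v where "whitehead_cut {1..k} Y v w"
proof (rule primitive_whitehead_cut[of "{1..k}" w])
  show "primitive (F k) w"
    using cyc_primsD[OF assms(1)] by (simp add: prim_def reduce_eq_self)
qed (use cyc_primsD[OF assms(1)] assms(2) in auto)

lemma cyc_prims_rotate1:
  assumes "w \<in> cyc_prims k" shows "rotate1 w \<in> cyc_prims k"
proof (cases w)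
  case (Cons a u)
  then show ?thesis
    using assms cyc_reduced_rotate[of "[a]" u] prim_rotate[of k "[a]" u]
    by (simp add: cyc_prims_def)
qed (use assms in \<open>simp add: cyc_prims_def\<close>)

lemma cyc_prims_rotate:
  "w \<in> cyc_prims k \<Longrightarrow> rotate n w \<in> cyc_prims k"
  by (induction n) (simp_all add: rotate_def cyc_prims_rotate1)

lemma set_expand: "set l \<subseteq> set (expand_aux Y v n l)"
  by (induction l) auto

lemma cyc_prims_contract:
  assumes w: "w \<in> cyc_prims k" and cut: "whitehead_cut {1..k} Y v w" and "head_survives Y v w"
  obtains l where "l \<in> cyc_prims k" "expand Y v l = w" "hd l = hd w"
    "length l + crossings Y (w @ [hd w]) = length w"
    "filter (\<lambda>y. fst y \<noteq> fst v) l = filter (\<lambda>y. fst y \<noteq> fst v) w"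
    "\<And>R. changes R (l @ [hd l]) \<le> changes R (w @ [hd w])"
proof -
  obtain l where l: "l \<noteq> []" "hd l = hd w" "cyc_reduced l" "expand Y v l = w"
    "length l + crossings Y (w @ [hd w]) = length w"
    "filter (\<lambda>y. fst y \<noteq> fst v) l = filter (\<lambda>y. fst y \<noteq> fst v) w"
    "\<And>R. changes R (l @ [hd l]) \<le> changes R (w @ [hd w])"
    by (rule whitehead_contract[OF cut cyc_primsD(1,3)[OF w] assms(3)]) blast
  have "set l \<subseteq> letters {1..k}"
    using cyc_primsD(2)[OF w] set_expand[of l Y v "hd l"] l(4) by (auto simp: expand_def)
  moreover from this have "prim k l"
    using cyc_primsD(4)[OF w] l(1,4) cut by (intro prim_expand[of k Y v l]) (auto simp: whitehead_cut_def)
  ultimately show ?thesis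
    using l that[of l] by (simp add: cyc_prims_def)
qed

section \<open>Changes and crossings in cyclic words\<close>

lemma changes_le: "changes R l \<le> length (filter R (butlast l)) + length (filter R (tl l))"
proof (induction l rule: induct_list012)
  case (3 x y zs)
  then show ?case
    by (cases zs) auto
qed auto

lemma length_filter_tl_cyclic:
  "w \<noteq> [] \<Longrightarrow> length (filter R (tl (w @ [hd w]))) = length (filter R w)"
  by (cases w) auto

lemma changes_cyclic_le:
  assumes "w \<noteq> []"
  shows "changes R (w @ [hd w]) \<le> 2 * length (filter R w)"
  using changes_le[of R "w @ [hd w]"] length_filter_tl_cyclic[OF assms, of R] by simp

lemma even_changes: "l \<noteq> [] \<Longrightarrow> even (changes R l) \<longleftrightarrow> R (hd l) = R (last l)"
  by (induction l rule: induct_list012) auto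

lemma changes_eq_0: "changes R l = 0 \<Longrightarrow> x \<in> set l \<Longrightarrow> R x = R (hd l)"
  by (induction l rule: induct_list012) (auto split: if_splits)

lemma changes_append: "changes R (u @ y # v) = changes R (u @ [y]) + changes R (y # v)"
  unfolding changes_def by (subst adj_append) simp

text \<open>In a reduced word \<open>inv_letter a = x\<close> and \<open>b = x\<close> exclude each
  other for a transition \<open>a b\<close>, so every step out of \<open>inv_letter x\<close> and
  every step into \<open>x\<close> is a separate crossing.\<close>

lemma crossings_singleton:
  "reduced l \<Longrightarrow> crossings {x} l =
     length (filter (\<lambda>y. y = inv_letter x) (butlast l)) + length (filter (\<lambda>y. y = x) (tl l))"
proof (induction l rule: induct_list012)
  case (3 a b zs)
  then have "crossings {x} (b # zs) =
      length (filter (\<lambda>y. y = inv_letter x) (butlast (b # zs))) + length (filter (\<lambda>y. y = x) zs)"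
    "b \<noteq> inv_letter a"
    by (simp_all add: reduced_Cons_iff)
  then show ?case
    by (auto simp: inv_letter_swap)
qed auto

lemma fst_eq_iff_letter: "fst y = fst x \<longleftrightarrow> y = x \<or> y = inv_letter x"
  by (cases x; cases y) (auto simp: inv_letter_def)

lemma crossings_singleton_cyclic:
  assumes "w \<noteq> []" "cyc_reduced w"
  shows "crossings {x} (w @ [hd w]) = length (filter (\<lambda>y. fst y = fst x) w)"
proof -
  have "crossings {x} (w @ [hd w])
      = length (filter (\<lambda>y. y = inv_letter x) w) + length (filter (\<lambda>y. y = x) w)"
  proof -
    have "reduced (w @ [hd w])"
      using assms by (simp add: cyc_reduced_iff)
    then show ?thesis
      by (simp only: crossings_singleton butlast_snoc length_filter_tl_cyclic[OF assms(1)])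
  qed
  also have "\<dots> = length (filter (\<lambda>y. fst y = fst x) w)"
    unfolding fst_eq_iff_letter by (induction w) auto
  finally show ?thesis .
qed

lemma crossings_generator: "crossings {y. fst y = i} l = changes (\<lambda>y. fst y = i) l"
  by (simp add: crossings_def changes_def)

lemma set_adj_cyc_adj: "set (adj w) \<subseteq> set (cyc_adj w)"
proof (cases w rule: rev_cases)
  case (snoc u x)
  then show ?thesis
    using adj_append[of u x "[hd w]"] by (auto simp: cyc_adj_def)
qed simp

lemma cyclic_successor_closed:
  assumes "x \<in> set w" "R x" and succ: "\<And>a b. (a, b) \<in> set (cyc_adj w) \<Longrightarrow> R a \<Longrightarrow> R b"
    and "y \<in> set w"
  shows "R y"
proof -
  have run: "\<forall>z \<in> set v. R z" if "R c" "\<And>a b. (a, b) \<in> set (adj (c # v)) \<Longrightarrow> R a \<Longrightarrow> R b" for c v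
    using that
  proof (induction v arbitrary: c)
    case (Cons d v)
    have "R d"
      using Cons.prems(2)[of c d] Cons.prems(1) by simp
    moreover have "\<forall>z \<in> set v. R z"
    proof (rule Cons.IH[OF \<open>R d\<close>])
      fix a b assume "(a, b) \<in> set (adj (d # v))" "R a"
      then show "R b"
        using Cons.prems(2)[of a b] by simp
    qed
    ultimately show ?case
      by simp
  qed simp
  obtain u v where uv: "w = u @ x # v"
    using assms(1) by (auto simp: in_set_conv_decomp)
  have tail: "\<forall>z \<in> set (v @ [hd w]). R z"
  proof (rule run[OF assms(2)])
    fix a b assume "(a, b) \<in> set (adj (x # v @ [hd w]))" "R a"
    then show "R b"
      using succ[of a b] adj_append[of u x "v @ [hd w]"] uv by (simp add: cyc_adj_def)
  qed
  then have hdw: "R (hd w)"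
    by simp
  have "\<forall>z \<in> set (tl w). R z"
  proof (rule run[OF hdw])
    fix a b assume "(a, b) \<in> set (adj (hd w # tl w))" "R a"
    moreover have "hd w # tl w = w"
      using uv by (intro list.collapse) simp
    ultimately show "R b"
      using succ[of a b] set_adj_cyc_adj[of w] by auto
  qed
  then show ?thesis
    using hdw assms(4) by (cases w) auto
qed

section \<open>Words containing all transitions between the generators other than a fixed
  one\<close>

definition generic :: "nat \<Rightarrow> nat \<Rightarrow> nat word \<Rightarrow> bool" where
  "generic k i w \<longleftrightarrow> (\<forall>a \<in> letters ({1..k} - {i}). \<forall>b \<in> letters ({1..k} - {i}).
     b \<noteq> inv_letter a \<longrightarrow> (a, b) \<in> set (adj w))"

lemma set_adj_subset: "(a, b) \<in> set (adj l) \<Longrightarrow> a \<in> set l \<and> b \<in> set l"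
  by (auto simp: set_adj_iff)

text \<open>Genericity makes the Whitehead graph complete on the letters other than those of
  \<open>i\<close>. If the cut vertex were a letter of \<open>i\<close>, then \<open>Y\<close> would
  be the set of all these other letters, so that \<open>w\<close> could enter the generator
  \<open>i\<close> only through \<open>v\<close> and would then repeat \<open>v\<close> forever.
  Hence the cut vertex belongs to another generator. A letter of \<open>Y\<close> outside
  \<open>i\<close> would now be joined to \<open>inv_letter v\<close>, which is neither in
  \<open>Y\<close> nor the cut vertex.\<close>

lemma generic_cut:
  assumes "k \<ge> 3" and i: "i \<in> {1..k}" and w: "w \<in> cyc_prims k"
    and gen: "generic k i w" and "\<exists>x \<in> set w. fst x = i"
    and cut: "whitehead_cut {1..k} Y v w"
  shows "fst v \<noteq> i" "Y \<subseteq> {y. fst y = i}"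
proof -
  let ?L = "letters ({1..k} - {i})"
  have in_L: "x \<in> ?L \<longleftrightarrow> x \<in> letters {1..k} \<and> fst x \<noteq> i" for x
    by (cases x) (auto simp: letters_def)
  have Y: "Y \<subseteq> letters {1..k}" "Y \<noteq> {}" "v \<in> letters {1..k}" "v \<notin> Y" "inv_letter v \<notin> Y"
    and edge: "\<And>a b. (a, b) \<in> set (cyc_adj w) \<Longrightarrow>
      (inv_letter a \<in> Y \<longrightarrow> b \<in> insert v Y) \<and> (b \<in> Y \<longrightarrow> inv_letter a \<in> insert v Y)"
    using cut by (auto simp: whitehead_cut_def)
  have link: "(inv_letter a, b) \<in> set (cyc_adj w)" if "a \<in> ?L" "b \<in> ?L" "b \<noteq> a" for a b
  proof -
    have "inv_letter a \<in> ?L"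
      using that(1) by simp
    then show ?thesis
      using gen that set_adj_cyc_adj[of w] unfolding generic_def
      by (metis inv_letter_inv_letter subsetD)
  qed
  show v: "fst v \<noteq> i"
  proof
    assume vi: "fst v = i"
    have YL: "Y \<subseteq> ?L"
    proof
      fix y assume y: "y \<in> Y"
      then have "y \<noteq> v" "y \<noteq> inv_letter v"
        using Y by auto
      then show "y \<in> ?L"
        using y Y(1) vi fst_eq_iff_letter[of y v] by (auto simp: in_L)
    qed
    obtain y where y: "y \<in> Y"
      using Y by blast
    have LY: "z \<in> Y" if z: "z \<in> ?L" for z
    proof (cases "z = y")
      case False
      then have "(inv_letter y, z) \<in> set (cyc_adj w)"
        using link y YL z by blast
      then have "z \<in> insert v Y"
        using edge y by fastforce
      then show ?thesis
        using z vi by (auto simp: in_L)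
    qed (use y in simp)
    have step: "b = v" if ab: "(a, b) \<in> set (cyc_adj w)" "a = v" for a b
    proof -
      have "b \<in> letters {1..k}"
        using cyc_adj_set(2)[OF ab(1)] cyc_primsD(2)[OF w] by blast
      moreover have "b \<noteq> inv_letter a"
      proof -
        obtain u u' where "w @ [hd w] = u @ a # b # u'"
          using ab(1) unfolding cyc_adj_def set_adj_iff by blast
        then have "reduced (u @ a # b # u')"
          using cyc_primsD(6)[OF w] by (simp only:)
        then show ?thesis
          by (simp add: reduced_append_iff reduced_Cons_iff)
      qed
      moreover have "b \<notin> Y"
        using edge[OF ab(1)] ab(2) Y(4,5) inv_letter_neq by blast
      ultimately have "fst b = i"
        using LY in_L by blast
      then show ?thesis
        using \<open>b \<noteq> inv_letter a\<close> ab(2) fst_eq_iff_letter[of b v] vi by auto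
    qed
    obtain x where x: "x \<in> set w" "fst x = i"
      using assms(5) by blast
    obtain z where z: "z \<in> ?L" "z \<in> set w"
    proof -
      obtain z where z: "z \<in> ?L"
        using y YL by blast
      then have "(z, z) \<in> set (adj w)"
        using gen by (auto simp: generic_def)
      then show ?thesis
        using that[OF z] set_adj_subset[of z z w] by simp
    qed
    have "\<exists>a b. (a, b) \<in> set (cyc_adj w) \<and> fst a \<noteq> i \<and> fst b = i"
      using cyclic_successor_closed[of z w "\<lambda>a. fst a \<noteq> i" x] x z in_L by blast
    then obtain a b where ab: "(a, b) \<in> set (cyc_adj w)" "fst a \<noteq> i" "fst b = i"
      by blast
    note abw = cyc_adj_set[OF ab(1)]
    have "inv_letter a \<in> ?L"
      using abw ab(2) cyc_primsD(2)[OF w] by (auto simp: in_L)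
    then have "b \<in> insert v Y"
      using LY edge[OF ab(1)] by blast
    then have "b = v"
      using ab(3) YL in_L by blast
    then have "z = v"
      using cyclic_successor_closed[of v w "\<lambda>a. a = v" z] step abw z by blast
    then show False
      using z vi in_L by blast
  qed
  show "Y \<subseteq> {y. fst y = i}"
  proof
    fix y assume y: "y \<in> Y"
    have vL: "inv_letter v \<in> ?L"
      using v Y(3) by (simp add: in_L)
    show "y \<in> {y. fst y = i}"
    proof (rule ccontr)
      assume "\<not> ?thesis"
      then have "y \<in> ?L"
        using y Y(1) by (auto simp: in_L)
      moreover have "inv_letter v \<noteq> y"
        using y Y(5) by blast
      ultimately have "(inv_letter y, inv_letter v) \<in> set (cyc_adj w)"
        using link vL by blast
      then have "inv_letter v \<in> insert v Y"
        using edge[of "inv_letter y" "inv_letter v"] y by simp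
      then show False
        using Y(5) by simp
    qed
  qed
qed

lemma finite_bound_UN:
  fixes h :: "nat \<Rightarrow> real"
  assumes "finite I" and "\<And>x. x \<in> I \<Longrightarrow> \<exists>C. \<forall>N. real (card (S x N)) \<le> C * h N"
  shows "\<exists>C. \<forall>N. real (card (\<Union>x\<in>I. S x N)) \<le> C * h N"
proof -
  obtain C where C: "\<And>x N. x \<in> I \<Longrightarrow> real (card (S x N)) \<le> C x * h N"
    using assms(2) by metis
  have "real (card (\<Union>x\<in>I. S x N)) \<le> (\<Sum>x\<in>I. C x) * h N" for N
  proof -
    have "real (card (\<Union>x\<in>I. S x N)) \<le> real (\<Sum>x\<in>I. card (S x N))"
      using card_UN_le[OF assms(1)] of_nat_mono by blast
    also have "\<dots> \<le> (\<Sum>x\<in>I. C x * h N)"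
      unfolding of_nat_sum by (intro sum_mono C)
    finally show ?thesis
      by (simp add: sum_distrib_right)
  qed
  then show ?thesis
    by blast
qed

text \<open>Changes between \<open>i\<close> and the other generators count as defects. Without them
  a letter of \<open>i\<close> can only repeat, and any other letter has at most
  \<open>2k - 3\<close> successors. The missing transition lowers this number at \<open>a0\<close>,
  which the other letters outside \<open>i\<close> reach in at most two steps.\<close>

lemma card_missing_transition:
  assumes "k \<ge> 3" "i \<in> {1..k}"
    and ab: "a0 \<in> letters ({1..k} - {i})" "b0 \<in> letters ({1..k} - {i})" "b0 \<noteq> inv_letter a0"
  shows "\<exists>C. \<forall>N. real (card {w. length w = N \<and> set w \<subseteq> letters {1..k} \<and> reduced w
    \<and> changes (\<lambda>y. fst y = i) w \<le> K \<and> (a0, b0) \<notin> set (adj w)}) \<le> C * real (2 * k - 3) ^ N"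
proof -
  let ?L = "letters {1..k}" and ?q = "2 * k - 3"
  let ?M = "letters ({1..k} - {i})"
  define G where "G a b \<longleftrightarrow> b \<noteq> inv_letter a \<and> (fst a = i \<longleftrightarrow> fst b = i) \<and> (a, b) \<noteq> (a0, b0)"
    for a b :: "nat letter"
  have in_M: "x \<in> ?M \<longleftrightarrow> x \<in> ?L \<and> fst x \<noteq> i" for x
    by (cases x) (auto simp: letters_def)
  have cardM: "card ?M = ?q + 1"
    using assms(1,2) by (simp add: card_letters)
  define low where "low a \<longleftrightarrow> card {b \<in> ?L. G a b} < ?q" for a
  have on: "card {b \<in> ?L. G a b} \<le> 1" if "fst a = i" for a
  proof -
    have "{b \<in> ?L. G a b} \<subseteq> {a}"
      using that fst_eq_iff_letter[of _ a] by (auto simp: G_def)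
    then have "card {b \<in> ?L. G a b} \<le> card {a}"
      by (intro card_mono) auto
    then show ?thesis
      by simp
  qed
  have off: "{b \<in> ?L. G a b} \<subseteq> ?M - {inv_letter a}" if "fst a \<noteq> i" for a
    using that by (auto simp: G_def in_M)
  have card_inv: "card (?M - {inv_letter a}) = ?q" if "a \<in> ?L" "fst a \<noteq> i" for a
    using that cardM by (simp add: in_M)
  have low_a0: "low a0"
  proof -
    have "{b \<in> ?L. G a0 b} \<subseteq> ?M - {inv_letter a0} - {b0}"
      using ab by (auto simp: G_def in_M)
    then have "card {b \<in> ?L. G a0 b} \<le> card (?M - {inv_letter a0} - {b0})"
      by (intro card_mono) auto
    also have "\<dots> = ?q - 1"
      using card_inv[of a0] ab by (simp add: in_M)
    finally show ?thesis
      using assms(1) by (simp add: low_def)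
  qed
  have "\<exists>C. \<forall>N. real (card {w. length w = N \<and> set w \<subseteq> ?L \<and> defects G w \<le> K}) \<le> C * real ?q ^ N"
  proof (rule card_few_defects)
    show "finite ?L" "?q > 0"
      using assms(1) by auto
    show "card {b \<in> ?L. G a b} \<le> ?q" if a: "a \<in> ?L" for a
    proof (cases "fst a = i")
      case True
      then show ?thesis
        using on[of a] assms(1) by simp
    next
      case False
      have "card {b \<in> ?L. G a b} \<le> card (?M - {inv_letter a})"
        using off[OF False] by (intro card_mono) auto
      then show ?thesis
        using card_inv[OF a False] by simp
    qed
    show "low a \<longleftrightarrow> card {b \<in> ?L. G a b} < ?q" for a
      by (simp add: low_def)
    show "low a \<or> (\<exists>b\<in>?L. G a b \<and> low b) \<or> (\<exists>b\<in>?L. G a b \<and> (\<exists>c\<in>?L. G b c \<and> low c))"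
      if a: "a \<in> ?L" for a
    proof -
      consider "fst a = i" | "a = a0" | "fst a \<noteq> i" "a \<noteq> a0" "a \<noteq> inv_letter a0" | "a
          = inv_letter a0"
        by blast
      then show ?thesis
      proof cases
        case 1
        moreover have "1 < ?q"
          using assms(1) by simp
        ultimately have "low a"
          using on[of a] by (simp add: low_def)
        then show ?thesis ..
      next
        case 2
        then show ?thesis
          using low_a0 by simp
      next
        case 3
        then have "G a a0"
          using ab by (auto simp: G_def in_M inv_letter_swap)
        then show ?thesis
          using low_a0 ab by (auto simp: in_M)
      next
        case 4
        \<comment> \<open>\<open>inv_letter a0\<close> cannot be followed by \<open>a0\<close>; the
          way there leads through a third generator, which exists since
          \<open>k \<ge> 3\<close>.\<close>
        have "\<exists>j \<in> {1..k}. j \<noteq> i \<and> j \<noteq> fst a0"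
        proof (rule ccontr)
          assume "\<not> ?thesis"
          then have "card {1..k} \<le> card {i, fst a0}"
            by (intro card_mono) auto
          also have "\<dots> \<le> 2"
            by (simp add: card_insert_if)
          finally show False
            using assms(1) by simp
        qed
        then obtain j where j: "j \<in> {1..k}" "j \<noteq> i" "j \<noteq> fst a0"
          by blast
        let ?d = "(j, True)"
        have d: "?d \<in> ?L" "?d \<noteq> a0" "inv_letter ?d \<noteq> a0"
          using j by (auto simp: letters_def inv_letter_def)
        have "G a ?d" "G ?d a0"
          using 4 j d ab by (auto simp: G_def in_M)
        then show ?thesis
          using d ab low_a0 by (auto simp: in_M)
      qed
    qed
  qed
  then show ?thesis
  proof (rule card_bound_subset)
    have "defects G w \<le> changes (\<lambda>y. fst y = i) w" if "reduced w" "(a0, b0) \<notin> set (adj w)" for w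
      using that
      by (induction w rule: induct_list012) (auto simp: G_def reduced_Cons_iff)
    then show "{w. length w = N \<and> set w \<subseteq> ?L \<and> reduced w \<and> changes (\<lambda>y. fst y = i) w \<le> K
        \<and> (a0, b0) \<notin> set (adj w)} \<subseteq> {w. length w = N \<and> set w \<subseteq> ?L \<and> defects G w \<le> K}" for N
      using order_trans by blast
  qed (auto intro: finite_words_length)
qed

lemma card_not_generic:
  assumes "k \<ge> 3" "i \<in> {1..k}"
  shows "\<exists>C. \<forall>N. real (card {w. length w = N \<and> set w \<subseteq> letters {1..k} \<and> reduced w
    \<and> changes (\<lambda>y. fst y = i) w \<le> K \<and> \<not> generic k i w}) \<le> C * real (2 * k - 3) ^ N"
  (is "\<exists>C. \<forall>N. real (card (?A N)) \<le> _")
proof -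
  let ?M = "letters ({1..k} - {i})"
  let ?I = "{(a, b). a \<in> ?M \<and> b \<in> ?M \<and> b \<noteq> inv_letter a}"
  let ?S = "\<lambda>(a, b) N. {w. length w = N \<and> set w \<subseteq> letters {1..k} \<and> reduced w
    \<and> changes (\<lambda>y. fst y = i) w \<le> K \<and> (a, b) \<notin> set (adj w)}"
  have "?A N = (\<Union>x\<in>?I. ?S x N)" for N
    by (fastforce simp: generic_def)
  moreover have "finite ?I"
    by (rule finite_subset[of _ "?M \<times> ?M"]) auto
  then have "\<exists>C. \<forall>N. real (card (\<Union>x\<in>?I. ?S x N)) \<le> C * real (2 * k - 3) ^ N"
    using card_missing_transition[OF assms] by (intro finite_bound_UN) auto
  ultimately show ?thesis
    by simp
qed

section \<open>Words with a single cyclic block of one generator\<close>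

lemma reduced_one_generator:
  "reduced w \<Longrightarrow> \<forall>x \<in> set w. fst x = i \<Longrightarrow> w \<noteq> [] \<Longrightarrow> w = replicate (length w) (hd w)"
proof (induction w)
  case (Cons x w)
  show ?case
  proof (cases w)
    case (Cons y v)
    then have "w = replicate (length w) y" "y \<noteq> inv_letter x" "fst y = fst x"
      using Cons.IH Cons.prems by (auto simp: reduced_Cons_iff)
    then show ?thesis
      using fst_eq_iff_letter[of y x] by auto
  qed simp
qed simp

lemma generator_iff: "fst x = i \<longleftrightarrow> x \<in> {(i, True), (i, False)}"
  by (cases x) auto

lemma reduced_one_generatorE:
  assumes "reduced w" "\<forall>x \<in> set w. fst x = i"
  obtains n l where "w = replicate n l" "l \<in> {(i, True), (i, False)}"
proof (cases "w = []")
  case True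
  then show ?thesis
    using that[of 0 "(i, True)"] by simp
next
  case False
  then have "w = replicate (length w) (hd w)" "fst (hd w) = i"
    using reduced_one_generator[OF assms] assms(2) hd_in_set[OF False] by auto
  then show ?thesis
    using that generator_iff by metis
qed

lemma few_changes_decomp:
  assumes w: "w \<noteq> []" "reduced w" "set w \<subseteq> letters A" "fst (hd w) = i"
    and ch: "changes (\<lambda>y. fst y = i) (w @ [hd w]) \<le> 2"
  obtains a b l l' u where "w = replicate a l @ u @ replicate b l'" "u \<in> reduced_words (A - {i})"
    "l \<in> {(i, True), (i, False)}" "l' \<in> {(i, True), (i, False)}"
proof -
  let ?Q = "\<lambda>y. fst y = i"
  define w1 r where "w1 = takeWhile ?Q w" and "r = dropWhile ?Q w"
  define w2 w3 where "w2 = takeWhile (\<lambda>y. \<not> ?Q y) r" and "w3 = dropWhile (\<lambda>y. \<not> ?Q y) r"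
  have eq: "w = w1 @ w2 @ w3"
    by (simp add: w1_def r_def w2_def w3_def)
  have Q1: "\<forall>x \<in> set w1. ?Q x" and Q2: "\<forall>x \<in> set w2. \<not> ?Q x"
    by (auto simp: w1_def w2_def dest: set_takeWhileD)
  have "w1 \<noteq> []" "hd w1 = hd w"
    using w(1,4) by (cases w; simp add: w1_def)+
  \<comment> \<open>Otherwise the closed word leaves \<open>i\<close>, returns to it and leaves it
    again, which makes three changes.\<close>
  have Q3: "\<forall>x \<in> set w3. ?Q x"
  proof (rule ccontr)
    assume "\<not> ?thesis"
    then obtain x where x: "x \<in> set w3" "\<not> ?Q x"
      by blast
    then have "w3 \<noteq> []"
      by auto
    then have h3: "?Q (hd w3)"
      unfolding w3_def using hd_dropWhile[of "\<lambda>y. \<not> ?Q y" r] by blast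
    have "w2 \<noteq> []"
    proof
      assume "w2 = []"
      then have "r = w3" "r \<noteq> []"
        using \<open>w3 \<noteq> []\<close> takeWhile_dropWhile_id[of "\<lambda>y. \<not> ?Q y" r] by (auto simp: w2_def w3_def)
      then have "\<not> ?Q (hd w3)"
        using hd_dropWhile[of ?Q w] by (simp add: r_def)
      then show False
        using h3 by simp
    qed
    obtain b w2' where w2: "w2 = b # w2'"
      using \<open>w2 \<noteq> []\<close> by (cases w2) auto
    obtain c w3' where w3: "w3 = c # w3'"
      using \<open>w3 \<noteq> []\<close> by (cases w3) auto
    have "changes ?Q (w @ [hd w]) = changes ?Q (w1 @ [b])
        + changes ?Q ((b # w2') @ c # w3' @ [hd w])"
      unfolding eq w2 w3 using changes_append[of ?Q w1 b "w2' @ c # w3' @ [hd w]"]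
          by (simp add: eq w2 w3)
    also have "changes ?Q ((b # w2') @ c # w3' @ [hd w])
        = changes ?Q ((b # w2') @ [c]) + changes ?Q (c # w3' @ [hd w])"
      by (rule changes_append)
    finally have sum: "changes ?Q (w1 @ [b]) + (changes ?Q ((b # w2') @ [c])
        + changes ?Q (c # w3' @ [hd w])) \<le> 2"
      using ch by simp
    have "changes ?Q (w1 @ [b]) \<noteq> 0"
      using changes_eq_0[of ?Q "w1 @ [b]" b] Q2 w2 \<open>w1 \<noteq> []\<close> \<open>hd w1 = hd w\<close> w(4) by auto
    moreover have "changes ?Q ((b # w2') @ [c]) \<noteq> 0"
      using changes_eq_0[of ?Q "(b # w2') @ [c]" c] Q2 w2 h3 w3 by auto
    moreover have "changes ?Q (c # w3' @ [hd w]) \<noteq> 0"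
      using changes_eq_0[of ?Q "c # w3' @ [hd w]" x] x h3 w3 by auto
    ultimately show False
      using sum by linarith
  qed
  have red: "reduced w1" "reduced w2" "reduced w3"
    using w(2) unfolding eq by (auto simp: reduced_append_iff)
  obtain a l where l: "w1 = replicate a l" "l \<in> {(i, True), (i, False)}"
    by (rule reduced_one_generatorE[OF red(1) Q1])
  obtain b l' where l': "w3 = replicate b l'" "l' \<in> {(i, True), (i, False)}"
    by (rule reduced_one_generatorE[OF red(3) Q3])
  have "w2 \<in> reduced_words (A - {i})"
    using w(3) Q2 red(2) unfolding eq by (fastforce simp: reduced_words_iff letters_def)
  then show ?thesis
    using that eq l l' by blast
qed

lemma sum_power_le:
  fixes q :: real
  assumes "q > 1"
  shows "(\<Sum>a\<le>N. 1 / q ^ a) \<le> q / (q - 1)"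
proof -
  have "(\<Sum>a\<le>N. (1 / q) ^ a) \<le> 1 / (1 - 1 / q)"
    using sum_le_suminf[of "\<lambda>a. (1 / q) ^ a" "{..N}"] suminf_geometric[of "1 / q"]
      summable_geometric[of "1 / q"] assms by simp
  also have "\<dots> = q / (q - 1)"
    using assms by (simp add: field_simps)
  finally show ?thesis
    by (simp add: power_one_over)
qed

definition single_block_words :: "nat \<Rightarrow> nat \<Rightarrow> nat \<Rightarrow> nat word set" where
  "single_block_words k i N = {w. length w = N \<and> w \<noteq> [] \<and> set w
      \<subseteq> letters {1..k} \<and> reduced w \<and> fst (hd w) = i
    \<and> changes (\<lambda>y. fst y = i) (w @ [hd w]) \<le> 2}"

lemma finite_single_block_words: "finite (single_block_words k i N)"
  unfolding single_block_words_def
  by (rule finite_subset[OF _ finite_lists_length_eq[of "letters {1..k}" N]]) auto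

lemma card_single_block_words:
  assumes "k \<ge> 3" "i \<in> {1..k}"
  shows "\<exists>C. \<forall>N. real (card (single_block_words k i N)) \<le> C * real (2 * k - 3) ^ N"
proof -
  define q where "q = 2 * k - 3"
  let ?I = "{(i, True), (i, False)}" and ?A = "{1..k} - {i}"
  let ?U = "\<lambda>m. {u \<in> reduced_words ?A. length u = m}"
  have cardA: "card ?A = k - 1" "2 * card ?A - 1 = q"
    using assms by (auto simp: q_def)
  have q: "real q > 1"
    using assms by (simp add: q_def)
  have fin: "finite (?U m)" and U: "card (?U m) \<le> 2 * q ^ m" for m
    using finite_reduced_words_length[of ?A m] card_reduced_words_bounds(2)[of ?A m] cardA assms
    by auto
  let ?S = "single_block_words k i"
  \<comment> \<open>The 8 combines the four choices of signs for the two end powers with the factor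
    2 in the count of reduced words; the square comes from the geometric series over the two
    exponents.\<close>
  have "real (card (?S N)) \<le> 8 * (real q / (real q - 1))\<^sup>2 * real q ^ N" for N
  proof -
    let ?f = "\<lambda>((a, b), l, l', u). replicate a l @ u @ replicate b l'"
    let ?V = "\<lambda>(a, b). {u \<in> reduced_words ?A. a + b + length u = N}"
    let ?J = "{..N} \<times> {..N}"
    have V: "finite (?V ab)" "real (card (?V ab)) \<le> 2 * real q ^ N * (1 / real q ^ fst ab * (1 / real q ^ snd ab))"
      for ab
    proof -
      obtain a b where ab: "ab = (a, b)"
        by (cases ab)
      have "a + b + m = N \<longleftrightarrow> a + b \<le> N \<and> m = N - a - b" for m
        by arith
      then have "?V ab = (if a + b \<le> N then ?U (N - a - b) else {})"
        by (simp add: ab)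
      moreover have "real (card (?U (N - a - b))) \<le> 2 * real q ^ N * (1 / real q ^ a * (1 / real q ^ b))"
        if "a + b \<le> N"
      proof -
        have "real (card (?U (N - a - b))) \<le> real (2 * q ^ (N - (a + b)))"
          using U[of "N - (a + b)"] by (simp only: diff_diff_left of_nat_le_iff)
        also have "\<dots> = 2 * real q ^ (N - (a + b))"
          by simp
        also have "real q ^ (N - (a + b)) = real q ^ N / real q ^ (a + b)"
          using q that by (intro power_diff) auto
        finally show ?thesis
          by (simp add: power_add)
      qed
      ultimately show "finite (?V ab)"
        "real (card (?V ab)) \<le> 2 * real q ^ N * (1 / real q ^ fst ab * (1 / real q ^ snd ab))"
        using fin q by (auto simp: ab)
    qed
    have "?S N \<subseteq> ?f ` (SIGMA ab : ?J. ?I \<times> ?I \<times> ?V ab)"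
    proof
      fix w assume "w \<in> ?S N"
      then have w: "length w = N" "w \<noteq> []" "reduced w" "set w \<subseteq> letters {1..k}" "fst (hd w) = i"
        "changes (\<lambda>y. fst y = i) (w @ [hd w]) \<le> 2"
        by (simp_all add: single_block_words_def)
      obtain a b l l' u where *: "w = replicate a l @ u @ replicate b l'" "u \<in> reduced_words ?A"
        "l \<in> ?I" "l' \<in> ?I"
        by (rule few_changes_decomp[OF w(2-6)])
      have len: "a + b + length u = N"
        using w(1) unfolding *(1) by simp
      show "w \<in> ?f ` (SIGMA ab : ?J. ?I \<times> ?I \<times> ?V ab)"
      proof (rule image_eqI)
        show "w = ?f ((a, b), l, l', u)"
          by (simp only: *(1) prod.case)
        show "((a, b), l, l', u) \<in> (SIGMA ab : ?J. ?I \<times> ?I \<times> ?V ab)"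
          using *(2-4) len by simp
      qed
    qed
    then have "card (?S N) \<le> card (SIGMA ab : ?J. ?I \<times> ?I \<times> ?V ab)"
      using V(1) by (intro surj_card_le finite_SigmaI finite_cartesian_product) auto
    also have "\<dots> = (\<Sum>ab\<in>?J. card (?I \<times> ?I \<times> ?V ab))"
      using V(1) by (intro card_SigmaI) auto
    also have "\<dots> = (\<Sum>ab\<in>?J. 4 * card (?V ab))"
      by (intro sum.cong refl) (simp only: card_cartesian_product, simp)
    finally have "real (card (?S N)) \<le> real (\<Sum>ab\<in>?J. 4 * card (?V ab))"
      by (simp only: of_nat_le_iff)
    also have "\<dots> = (\<Sum>ab\<in>?J. 4 * real (card (?V ab)))"
      by simp
    also have "\<dots> \<le> (\<Sum>ab\<in>?J. 4 * (2 * real q ^ N * (1 / real q ^ fst ab * (1 / real q ^ snd ab))))"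
      using V(2) by (intro sum_mono mult_left_mono) auto
    also have "\<dots> = 8 * real q ^ N * ((\<Sum>a\<le>N. 1 / real q ^ a) * (\<Sum>b\<le>N. 1 / real q ^ b))"
    proof -
      have "(\<Sum>a\<le>N. 1 / real q ^ a) * (\<Sum>b\<le>N. 1 / real q ^ b)
          = (\<Sum>ab\<in>?J. 1 / real q ^ fst ab * (1 / real q ^ snd ab))"
        by (simp only: sum_product sum.cartesian_product case_prod_unfold)
      moreover have "(\<Sum>ab\<in>?J. 4 * (2 * real q ^ N * z ab)) = 8 * real q ^ N * (\<Sum>ab\<in>?J. z ab)"
        for z :: "nat \<times> nat \<Rightarrow> real"
        by (simp add: sum_distrib_left mult_ac)
      ultimately show ?thesis
        by (simp only:)
    qed
    also have "\<dots> \<le> 8 * real q ^ N * (real q / (real q - 1) * (real q / (real q - 1)))"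
      using sum_power_le[OF q, of N] q
      by (intro mult_left_mono mult_mono sum_nonneg) auto
    finally show ?thesis
      by (simp add: power2_eq_square mult_ac)
  qed
  then show ?thesis
    unfolding q_def by blast
qed

section \<open>Contraction for words with boundedly many blocks of one generator\<close>

lemma sum_power_ge_le:
  fixes q :: real
  assumes "q > 1"
  shows "(\<Sum>d\<in>{1..N}. if d \<ge> Suc m then 1 / q ^ d else 0) \<le> 1 / (q ^ m * (q - 1))"
proof -
  have "(\<Sum>d\<in>{1..N}. if d \<ge> Suc m then 1 / q ^ d else 0) = (\<Sum>d\<in>{1..N} \<inter> {Suc m..}. 1 / q ^ d)"
    by (simp add: sum.inter_restrict atLeast_def)
  also have "\<dots> \<le> (\<Sum>d\<in>(\<lambda>a. a + Suc m) ` {..N}. 1 / q ^ d)"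
  proof (rule sum_mono2)
    show "{1..N} \<inter> {Suc m..} \<subseteq> (\<lambda>a. a + Suc m) ` {..N}"
    proof
      fix d assume "d \<in> {1..N} \<inter> {Suc m..}"
      then show "d \<in> (\<lambda>a. a + Suc m) ` {..N}"
        by (intro image_eqI[of _ _ "d - Suc m"]) auto
    qed
  qed (use assms in auto)
  also have "\<dots> = (\<Sum>a\<le>N. 1 / q ^ (a + Suc m))"
    by (subst sum.reindex) (auto simp: inj_on_def)
  also have "\<dots> = 1 / q ^ Suc m * (\<Sum>a\<le>N. 1 / q ^ a)"
    by (simp add: sum_distrib_left power_add mult_ac)
  also have "\<dots> \<le> 1 / q ^ Suc m * (q / (q - 1))"
    using assms by (intro mult_left_mono sum_power_le) auto
  also have "\<dots> = 1 / (q ^ m * (q - 1))"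
    using assms by simp
  finally show ?thesis .
qed

text \<open>The right-hand sides are the values at \<open>q = 3\<close>, that is at
  \<open>k = 3\<close>. What matters is that the first and the third stay below 1 when the second is
  added.\<close>

lemma ratio_bounds:
  fixes q :: real
  assumes "q \<ge> 3"
  shows "2 * (q + 1) / q\<^sup>2 \<le> 8 / 9" "(q + 1) / (q ^ 3 * (q - 1)) \<le> 2 / 27"
    "2 * (q + 1) / (q\<^sup>2 * (q - 1)) \<le> 4 / 9"
proof -
  obtain t where t: "q = 3 + t" "t \<ge> 0"
    using assms by (metis add.commute diff_add_cancel diff_ge_0_iff_ge)
  show "2 * (q + 1) / q\<^sup>2 \<le> 8 / 9"
    unfolding t(1) using t(2) by (simp add: divide_simps power2_eq_square algebra_simps)
  show "(q + 1) / (q ^ 3 * (q - 1)) \<le> 2 / 27"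
    unfolding t(1) using t(2) by (simp add: divide_simps power3_eq_cube algebra_simps)
  show "2 * (q + 1) / (q\<^sup>2 * (q - 1)) \<le> 4 / 9"
    unfolding t(1) using t(2) by (simp add: divide_simps power2_eq_square algebra_simps)
qed

definition block_words :: "nat \<Rightarrow> nat \<Rightarrow> nat \<Rightarrow> (nat \<Rightarrow> bool) \<Rightarrow> nat \<Rightarrow> nat word set" where
  "block_words k i K S N = {w \<in> cyc_prims k. length w = N \<and> fst (hd w) = i
     \<and> changes (\<lambda>y. fst y = i) (w @ [hd w]) \<le> K \<and> S (length (filter (\<lambda>y. fst y = i) w))}"

lemma changes_snoc_ge: "changes R w \<le> changes R (w @ [x])"
  by (induction w rule: induct_list012) auto

lemma finite_block_words: "finite (block_words k i K S N)"
  by (rule finite_subset[OF _ finite_cyc_prims[of k N]]) (auto simp: block_words_def)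

text \<open>A generic word with few occurrences of the generator \<open>i\<close> is only cut off at the vertices
  \<open>i\<close>, so the reduction shortens it by the number of letters \<open>i\<close> or by the number of changes;
  the number of letters \<open>i\<close> is invariant.\<close>

lemma block_words_step:
  assumes k: "k \<ge> 3" and i: "i \<in> {1..k}"
    and w: "w \<in> block_words k i K S N"
    and gen: "generic k i w" and many: "changes (\<lambda>y. fst y = i) (w @ [hd w]) > 2"
  obtains v Y d where "v \<in> letters ({1..k} - {i})" "d \<in> {1..N}"
    "w \<in> expand Y v ` block_words k i K S (N - d)"
    "Y \<in> {{(i, True)}, {(i, False)}} \<and> S d \<or> Y = {y. fst y = i} \<and> d \<ge> 4"
proof -
  let ?Q = "\<lambda>y. fst y = i"
  have wp: "w \<in> cyc_prims k" and wN: "length w = N" and wi: "fst (hd w) = i"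
    and wK: "changes ?Q (w @ [hd w]) \<le> K" and wS: "S (length (filter ?Q w))"
    using w by (simp_all add: block_words_def)
  have w0: "w \<noteq> []" "cyc_reduced w"
    using cyc_primsD[OF wp] by simp_all
  have on: "\<exists>x \<in> set w. fst x = i"
    using wi w0(1) hd_in_set by blast
  obtain Y v where cut: "whitehead_cut {1..k} Y v w"
    using cyc_prims_cut[OF wp] k by auto
  have vi: "fst v \<noteq> i" and YT: "Y \<subseteq> {y. fst y = i}"
    using generic_cut[OF k i wp gen on cut] by simp_all
  have v: "v \<in> letters ({1..k} - {i})"
    using cut vi by (cases v) (auto simp: whitehead_cut_def letters_def)
  have "head_survives Y v w"
    using wi vi by (intro head_survives_other) simp
  then obtain l where l: "l \<in> cyc_prims k" "expand Y v l = w" "hd l = hd w"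
    "length l + crossings Y (w @ [hd w]) = length w"
    "filter (\<lambda>y. fst y \<noteq> fst v) l = filter (\<lambda>y. fst y \<noteq> fst v) w"
    "\<And>R. changes R (l @ [hd l]) \<le> changes R (w @ [hd w])"
    by (rule cyc_prims_contract[OF wp cut]) blast
  define d where "d = crossings Y (w @ [hd w])"
  have QQ: "filter ?Q u = filter ?Q (filter (\<lambda>y. fst y \<noteq> fst v) u)" for u :: "nat word"
    using vi by (induction u) auto
  have "filter ?Q l = filter ?Q w"
    using QQ[of l] QQ[of w] l(5) by simp
  then have mem: "l \<in> block_words k i K S (N - d)"
    using l wN wi wS order_trans[OF l(6) wK] by (simp add: block_words_def d_def)
  have Tset: "{y. fst y = i} = {(i, True), (i, False)}"
    by auto
  have "Y \<noteq> {}"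
    using cut by (auto simp: whitehead_cut_def)
  then consider x where "Y = {x}" "x \<in> {(i, True), (i, False)}" | "Y = {y. fst y = i}"
    using YT unfolding Tset by blast
  then have "(Y \<in> {{(i, True)}, {(i, False)}} \<and> S d \<or> Y = {y. fst y = i} \<and> d \<ge> 4) \<and> d \<ge> 1"
  proof cases
    case 1
    then have "d = length (filter ?Q w)"
      using crossings_singleton_cyclic[OF w0, of x] by (auto simp: d_def)
    moreover have "length (filter ?Q w) \<ge> 1"
      using on filter_empty_conv[of ?Q w] by (cases "filter ?Q w") auto
    ultimately show ?thesis
      using 1 wS by auto
  next
    case 2
    have d: "d = changes ?Q (w @ [hd w])"
      unfolding d_def 2 by (rule crossings_generator)
    \<comment> \<open>A closed word enters and leaves \<open>i\<close> equally often, so more than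
      two changes are at least four.\<close>
    moreover have "even (changes ?Q (w @ [hd w]))"
      using even_changes[of "w @ [hd w]" ?Q] w0(1) by simp
    ultimately have "d \<ge> 4"
      using many by presburger
    then show ?thesis
      using 2 by simp
  qed
  moreover have "d \<le> N"
    using l(4) wN by (simp add: d_def)
  ultimately show ?thesis
    using that[of v d Y] v mem l(2) by force
qed

text \<open>For \<open>q = 2k - 3\<close> there are \<open>q + 1\<close> possible cut vertices, the
  letters not belonging to \<open>i\<close>. A shortening by \<open>d\<close> comes either from one
  of two singleton sides, where \<open>d\<close> is the number of letters \<open>i\<close> and hence
  satisfies \<open>S\<close>, or from the side formed by both letters of \<open>i\<close>, where
  \<open>d \<ge> 4\<close>.\<close>

definition contraction_weight :: "real \<Rightarrow> (nat \<Rightarrow> bool) \<Rightarrow> nat \<Rightarrow> real" where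
  "contraction_weight q S d = (if S d then 2 * (q + 1) else 0) + (if d \<ge> 4 then q + 1 else 0)"

lemma block_words_recursion:
  assumes k: "k \<ge> 3" and i: "i \<in> {1..k}"
  obtains C where "C \<ge> 0" and
    "\<And>S N. real (card (block_words k i K S N)) \<le> C * real (2 * k - 3) ^ N
      + (\<Sum>d=1..N. contraction_weight (real (2 * k - 3)) S d * real (card (block_words k i K S (N - d))))"
proof -
  define q where "q = 2 * k - 3"
  let ?Q = "\<lambda>y. fst y = i"
  let ?E = "single_block_words k i"
  let ?G = "\<lambda>N. {w. length w = N \<and> set w \<subseteq> letters {1..k} \<and> reduced w
    \<and> changes ?Q w \<le> K \<and> \<not> generic k i w}"
  let ?B = "block_words k i K"
  let ?L = "letters ({1..k} - {i})"
  let ?T = "{y. fst y = i}"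
  obtain C1 where C1: "\<And>N. real (card (?E N)) \<le> C1 * real q ^ N"
    using card_single_block_words[OF k i] unfolding q_def by blast
  obtain C2 where C2: "\<And>N. real (card (?G N)) \<le> C2 * real q ^ N"
    using card_not_generic[OF k i, of K] unfolding q_def by blast
  have cardL: "card ?L = q + 1" "finite ?L"
    using k i by (auto simp: card_letters q_def)
  have finE: "finite (?E N)" "finite (?G N)" for N
    by (auto intro: finite_single_block_words finite_words_length)
  have "0 \<le> C1 * real q ^ 0" "0 \<le> C2 * real q ^ 0"
    using order_trans[OF of_nat_0_le_iff C1] order_trans[OF of_nat_0_le_iff C2] by blast+
  then have C0: "C1 + C2 \<ge> 0"
    by simp
  have main: "real (card (?B S N)) \<le> (C1 + C2) * real q ^ N
      + (\<Sum>d=1..N. contraction_weight (real q) S d * real (card (?B S (N - d))))" for S N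
  proof -
    let ?X1 = "\<Union>v\<in>?L. \<Union>Y\<in>{{(i, True)}, {(i, False)}}. \<Union>d\<in>{d \<in> {1..N}. S d}. expand Y v ` ?B S (N - d)"
    let ?X2 = "\<Union>v\<in>?L. \<Union>d\<in>{d \<in> {1..N}. d \<ge> 4}. expand ?T v ` ?B S (N - d)"
    let ?s = "\<lambda>R. \<Sum>d\<in>{d \<in> {1..N}. R d}. card (?B S (N - d))"
    have sub: "?B S N \<subseteq> ?E N \<union> ?G N \<union> ?X1 \<union> ?X2"
    proof
      fix w assume w: "w \<in> ?B S N"
      then have wp: "w \<in> cyc_prims k"
        by (simp add: block_words_def)
      have red: "changes ?Q w \<le> changes ?Q (w @ [hd w])"
        by (rule changes_snoc_ge)
      show "w \<in> ?E N \<union> ?G N \<union> ?X1 \<union> ?X2"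
      proof (cases "generic k i w \<and> changes ?Q (w @ [hd w]) > 2")
        case True
        then have gen: "generic k i w" and many: "changes ?Q (w @ [hd w]) > 2"
          by blast+
        obtain v Y d where *: "v \<in> ?L" "d \<in> {1..N}" "w \<in> expand Y v ` ?B S (N - d)"
          "Y \<in> {{(i, True)}, {(i, False)}} \<and> S d \<or> Y = ?T \<and> d \<ge> 4"
          by (rule block_words_step[OF k i w gen many])
        from *(4) show ?thesis
        proof
          assume Y: "Y \<in> {{(i, True)}, {(i, False)}} \<and> S d"
          then have d: "d \<in> {d \<in> {1..N}. S d}"
            using *(2) by simp
          have "w \<in> ?X1"
            by (rule UN_I[OF *(1)], rule UN_I[OF conjunct1[OF Y]], rule UN_I[OF d], rule *(3))
          then show ?thesis
            by blast
        next
          assume Y: "Y = ?T \<and> d \<ge> 4"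
          then have d: "d \<in> {d \<in> {1..N}. d \<ge> 4}"
            using *(2) by simp
          have "w \<in> ?X2"
            using *(3) unfolding conjunct1[OF Y] by (rule UN_I[OF *(1), OF UN_I[OF d]])
          then show ?thesis
            by blast
        qed
      next
        case False
        have w': "length w = N" "fst (hd w) = i" "changes ?Q w \<le> K"
          using w red by (simp_all add: block_words_def)
        from False consider "\<not> generic k i w" | "changes ?Q (w @ [hd w]) \<le> 2"
          by linarith
        then show ?thesis
        proof cases
          case 1
          then have "w \<in> ?G N"
            using w' cyc_primsD(2,5)[OF wp] by simp
          then show ?thesis
            by blast
        next
          case 2
          then have "w \<in> ?E N"
            using w' cyc_primsD(1,2,5)[OF wp] by (simp add: single_block_words_def)
          then show ?thesis
            by blast
        qed
      qed
    qed
    have im: "card (expand Y v ` ?B S m) \<le> card (?B S m)" for Y v m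
      using finite_block_words by (rule card_image_le)
    have inner: "card (\<Union>d\<in>{d \<in> {1..N}. R d}. expand Y v ` ?B S (N - d)) \<le> ?s R" for R Y v
      using im by (intro order_trans[OF card_UN_le] sum_mono) auto
    have X1: "card ?X1 \<le> (q + 1) * (2 * ?s S)"
    proof -
      have "card ?X1 \<le> (\<Sum>v\<in>?L. 2 * ?s S)"
      proof (intro order_trans[OF card_UN_le[OF cardL(2)]] sum_mono)
        fix v assume "v \<in> ?L"
        have "card (\<Union>Y\<in>{{(i, True)}, {(i, False)}}. \<Union>d\<in>{d \<in> {1..N}. S d}. expand Y v ` ?B S (N - d))
            \<le> (\<Sum>Y\<in>{{(i, True)}, {(i, False)}}. ?s S)"
          by (intro order_trans[OF card_UN_le] sum_mono inner) simp
        then show "card (\<Union>Y\<in>{{(i, True)}, {(i, False)}}. \<Union>d\<in>{d \<in> {1..N}. S d}. expand Y v ` ?B S (N - d))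
            \<le> 2 * ?s S"
          by simp
      qed
      then show ?thesis
        by (simp add: cardL)
    qed
    have X2: "card ?X2 \<le> (q + 1) * ?s (\<lambda>d. d \<ge> 4)"
    proof -
      have "card ?X2 \<le> (\<Sum>v\<in>?L. ?s (\<lambda>d. d \<ge> 4))"
        by (intro order_trans[OF card_UN_le[OF cardL(2)]] sum_mono inner)
      then show ?thesis
        by (simp add: cardL)
    qed
    have finX: "finite ?X1" "finite ?X2"
      using cardL(2) finite_block_words by auto
    have s_eq: "real (?s R) = (\<Sum>d=1..N. if R d then real (card (?B S (N - d))) else 0)" for R
      unfolding of_nat_sum by (rule sum.inter_filter) simp
    have "card (?B S N) \<le> card (?E N \<union> ?G N \<union> ?X1 \<union> ?X2)"
      using finE finX by (intro card_mono sub finite_UnI)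
    also have "\<dots> \<le> card (?E N) + card (?G N) + card ?X1 + card ?X2"
      by (meson add_le_mono card_Un_le le_refl order_trans)
    also have "\<dots> \<le> card (?E N) + card (?G N) + (q + 1) * (2 * ?s S) + (q + 1) * ?s (\<lambda>d. d \<ge> 4)"
      using X1 X2 by linarith
    finally have "real (card (?B S N)) \<le> real (card (?E N) + card (?G N) + (q + 1) * (2 * ?s S)
        + (q + 1) * ?s (\<lambda>d. d \<ge> 4))"
      by (simp only: of_nat_le_iff)
    also have "\<dots> = real (card (?E N)) + real (card (?G N)) + 2 * (real q + 1) * real (?s S)
        + (real q + 1) * real (?s (\<lambda>d. d \<ge> 4))"
      by (simp only: of_nat_add of_nat_mult of_nat_1 of_nat_numeral mult_ac)
    also have "\<dots> \<le> (C1 + C2) * real q ^ N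
        + 2 * (real q + 1) * (\<Sum>d=1..N. if S d then real (card (?B S (N - d))) else 0)
        + (real q + 1) * (\<Sum>d=1..N. if d \<ge> 4 then real (card (?B S (N - d))) else 0)"
      using C1[of N] C2[of N] unfolding s_eq distrib_right by linarith
    also have "\<dots> = (C1 + C2) * real q ^ N
      + (\<Sum>d=1..N. contraction_weight (real q) S d * real (card (?B S (N - d))))"
      unfolding sum_distrib_left add.assoc sum.distrib[symmetric]
      by (intro arg_cong2[of _ _ _ _ "(+)"] refl sum.cong)
        (simp add: contraction_weight_def distrib_right)
    finally show ?thesis .
  qed
  show ?thesis
    using that[OF C0] main unfolding q_def by blast
qed

text \<open>If all numbers of letters \<open>i\<close> from 2 on were treated at once, the singleton
  sides would have total weight \<open>2 * (q + 1) / (q * (q - 1))\<close> in the limit, which is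
  \<open>4 / 3\<close> for \<open>q = 3\<close>. Separating the value 2 brings both totals below
  1.\<close>

lemma card_block_words:
  assumes k: "k \<ge> 3" and i: "i \<in> {1..k}" and S: "S = (\<lambda>s. s = 2) \<or> S = (\<lambda>s. s \<ge> 3)"
  shows "\<exists>C. \<forall>N. real (card (block_words k i K S N)) \<le> C * real (2 * k - 3) ^ N"
proof -
  define q where "q = real (2 * k - 3)"
  have q: "q \<ge> 3"
    using k by (simp add: q_def)
  let ?\<alpha> = "contraction_weight q S"
  obtain C where C0: "C \<ge> 0" and rec:
    "\<And>S N. real (card (block_words k i K S N)) \<le> C * real (2 * k - 3) ^ N
      + (\<Sum>d=1..N. contraction_weight (real (2 * k - 3)) S d * real (card (block_words k i K S (N - d))))"
    by (rule block_words_recursion[OF k i, of K]) blast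
  have C: "real (card (block_words k i K S N)) \<le> C * q ^ N
      + (\<Sum>d=1..N. ?\<alpha> d * real (card (block_words k i K S (N - d))))" for N
    unfolding q_def by (rule rec)
  \<comment> \<open>\<open>26 / 27 = 8 / 9 + 2 / 27\<close> is the bound in the case of two letters
    \<open>i\<close>; the other case gives \<open>4 / 9 + 2 / 27\<close>.\<close>
  have "(\<Sum>d=1..N. ?\<alpha> d / q ^ d) \<le> 26 / 27" for N
  proof -
    have "(\<Sum>d=1..N. ?\<alpha> d / q ^ d) = 2 * (q + 1) * (\<Sum>d=1..N. if S d then 1 / q ^ d else 0)
        + (q + 1) * (\<Sum>d=1..N. if d \<ge> Suc 3 then 1 / q ^ d else 0)"
      unfolding sum_distrib_left sum.distrib[symmetric] contraction_weight_def
      by (intro sum.cong refl) (simp add: add_divide_distrib)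
    also have "(q + 1) * (\<Sum>d=1..N. if d \<ge> Suc 3 then 1 / q ^ d else 0)
        \<le> (q + 1) * (1 / (q ^ 3 * (q - 1)))"
      using q by (intro mult_left_mono sum_power_ge_le) auto
    also have "\<dots> = (q + 1) / (q ^ 3 * (q - 1))"
      by simp
    also have "\<dots> \<le> 2 / 27"
      by (rule ratio_bounds(2)[OF q])
    finally have *: "(\<Sum>d=1..N. ?\<alpha> d / q ^ d)
        \<le> 2 * (q + 1) * (\<Sum>d=1..N. if S d then 1 / q ^ d else 0) + 2 / 27"
      by simp
    from S show ?thesis
    proof
      assume S: "S = (\<lambda>s. s = 2)"
      have "(\<Sum>d=1..N. if S d then 1 / q ^ d else 0) \<le> 1 / q\<^sup>2"
        unfolding S using q by (simp add: sum.delta)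
      then have "2 * (q + 1) * (\<Sum>d=1..N. if S d then 1 / q ^ d else 0) \<le> 2 * (q + 1) * (1 / q\<^sup>2)"
        using q by (intro mult_left_mono) auto
      also have "\<dots> \<le> 8 / 9"
        using ratio_bounds(1)[OF q] by simp
      finally show ?thesis
        using * by simp
    next
      assume S: "S = (\<lambda>s. s \<ge> 3)"
      have "(\<Sum>d=1..N. if S d then 1 / q ^ d else 0) \<le> 1 / (q\<^sup>2 * (q - 1))"
      proof -
        have "(3 :: nat) = Suc 2"
          by simp
        then show ?thesis
          unfolding S using sum_power_ge_le[of q 2 N] q by (simp only:)
      qed
      then have "2 * (q + 1) * (\<Sum>d=1..N. if S d then 1 / q ^ d else 0)
          \<le> 2 * (q + 1) * (1 / (q\<^sup>2 * (q - 1)))"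
        using q by (intro mult_left_mono) auto
      also have "\<dots> \<le> 4 / 9"
        using ratio_bounds(3)[OF q] by simp
      finally show ?thesis
        using * by simp
    qed
  qed
  moreover have "mono (\<lambda>_::nat. 1 :: real)"
    by (simp add: mono_def)
  moreover have "?\<alpha> d \<ge> 0" for d
    using q by (simp add: contraction_weight_def)
  moreover have "q > 0" "(26 / 27 :: real) < 1" "(0 :: real) \<le> 1"
    using q by simp_all
  moreover have "real (card (block_words k i K S N)) \<le> C * 1 * q ^ N
      + (\<Sum>d=1..N. ?\<alpha> d * real (card (block_words k i K S (N - d))))" for N
    using C[of N] by simp
  ultimately have "real (card (block_words k i K S N)) \<le> C / (1 - 26 / 27) * 1 * q ^ N" for N
    using C0 by (intro convolution_bound[where f = "\<lambda>N. real (card (block_words k i K S N))"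
        and \<alpha> = ?\<alpha> and g = "\<lambda>_. 1"])
  then show ?thesis
    unfolding q_def by blast
qed

lemma card_cyc_prims_starting_with:
  assumes k: "k \<ge> 3" and i: "i \<in> {1..k}"
  shows "\<exists>C. \<forall>N. real (card {w \<in> cyc_prims k. length w = N \<and> fst (hd w) = i
    \<and> changes (\<lambda>y. fst y = i) (w @ [hd w]) \<le> K}) \<le> C * real (2 * k - 3) ^ N"
proof -
  let ?Q = "\<lambda>y. fst y = i"
  let ?E = "single_block_words k i"
  let ?A = "\<lambda>N. {w \<in> cyc_prims k. length w = N \<and> fst (hd w) = i \<and> changes ?Q (w @ [hd w]) \<le> K}"
  let ?B2 = "block_words k i K (\<lambda>s. s = 2)" and ?B3 = "block_words k i K (\<lambda>s. s \<ge> 3)"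
  have "?A N \<subseteq> ?E N \<union> ?B2 N \<union> ?B3 N" for N
  proof
    fix w assume "w \<in> ?A N"
    then have w: "w \<in> cyc_prims k" "length w = N" "fst (hd w) = i" "changes ?Q (w @ [hd w]) \<le> K"
      by simp_all
    consider "length (filter ?Q w) \<le> 1" | "length (filter ?Q w) = 2" | "length (filter ?Q w) \<ge> 3"
      by linarith
    then show "w \<in> ?E N \<union> ?B2 N \<union> ?B3 N"
    proof cases
      case 1
      then have "changes ?Q (w @ [hd w]) \<le> 2"
        using changes_cyclic_le[OF cyc_primsD(1)[OF w(1)], of ?Q] by linarith
      then show ?thesis
        using w cyc_primsD(1,2,5)[OF w(1)] by (simp add: single_block_words_def)
    qed (use w in \<open>simp_all add: block_words_def\<close>)
  qed
  moreover have "finite (?E N \<union> ?B2 N \<union> ?B3 N)" for N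
    using finite_block_words finite_single_block_words by simp
  moreover have "\<exists>C. \<forall>N. real (card (?B2 N)) \<le> C * real (2 * k - 3) ^ N"
    "\<exists>C. \<forall>N. real (card (?B3 N)) \<le> C * real (2 * k - 3) ^ N"
    by (rule card_block_words[OF k i]; simp)+
  note card_bound_Un[OF card_bound_Un[OF card_single_block_words[OF k i] this(1)] this(2)]
  ultimately show ?thesis
    by (rule card_bound_subset[rotated])
qed

text \<open>A word containing \<open>i\<close> has a rotation that starts with \<open>i\<close>, and
  undoing one of \<open>N\<close> rotations costs the factor \<open>N\<close>. A word without
  \<open>i\<close> lies in a free group of rank \<open>k - 1\<close>.\<close>

lemma card_cyc_prims_few_changes:
  assumes k: "k \<ge> 3" and i: "i \<in> {1..k}"
  shows "\<exists>C. \<forall>N. real (card {w \<in> cyc_prims k. length w = N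
    \<and> changes (\<lambda>y. fst y = i) (w @ [hd w]) \<le> K}) \<le> C * ((real N + 1) * real (2 * k - 3) ^ N)"
proof -
  let ?Q = "\<lambda>y. fst y = i"
  let ?D = "\<lambda>N. {w \<in> cyc_prims k. length w = N \<and> fst (hd w) = i \<and> changes ?Q (w @ [hd w]) \<le> K}"
  let ?A = "\<lambda>N. {w \<in> cyc_prims k. length w = N \<and> changes ?Q (w @ [hd w]) \<le> K}"
  let ?R = "\<lambda>N. {w \<in> reduced_words ({1..k} - {i}). length w = N}"
  obtain C where C: "\<And>N. real (card (?D N)) \<le> C * real (2 * k - 3) ^ N"
    using card_cyc_prims_starting_with[OF k i] by blast
  have "0 \<le> C * real (2 * k - 3) ^ 0"
    using order_trans[OF of_nat_0_le_iff C] by blast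
  then have "C \<ge> 0"
    by simp
  have inv: "changes ?Q (rotate j w @ [hd (rotate j w)])
      = changes ?Q (w @ [hd w])" for j and w :: "nat word"
    by (induction j) (simp_all add: changes_def cyclic_count_rotate1)
  have sub: "?A N \<subseteq> ?R N \<union> (\<Union>j<N. {w. rotate j w \<in> ?D N})" for N
  proof
    fix w assume "w \<in> ?A N"
    then have w: "w \<in> cyc_prims k" "length w = N" "changes ?Q (w @ [hd w]) \<le> K"
      by simp_all
    show "w \<in> ?R N \<union> (\<Union>j<N. {w. rotate j w \<in> ?D N})"
    proof (cases "\<exists>x\<in>set w. fst x = i")
      case True
      then obtain j where j: "j < N" "fst (w ! j) = i"
        using w(2) by (auto simp: in_set_conv_nth)
      then have "hd (rotate j w) = w ! j"
        using w(2) cyc_primsD(1)[OF w(1)] by (simp add: hd_rotate_conv_nth)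
      then have "fst (hd (rotate j w)) = i"
        using j(2) by (simp only:)
      moreover have "changes ?Q (rotate j w @ [hd (rotate j w)]) \<le> K"
        using w(3) by (simp only: inv)
      ultimately have "rotate j w \<in> ?D N"
        using w(1,2) cyc_prims_rotate by simp
      then show ?thesis
        using j(1) by blast
    next
      case False
      then have "w \<in> ?R N"
        using w cyc_primsD(2,5)[OF w(1)] by (fastforce simp: reduced_words_iff letters_def)
      then show ?thesis
        by blast
    qed
  qed
  have inj: "inj (rotate j :: nat word \<Rightarrow> nat word)" for j
    unfolding rotate_def by (intro inj_fn inj_rotate1)
  have finD: "finite (?D N)" for N
    by (rule finite_subset[OF _ finite_cyc_prims[of k N]]) auto
  have rot: "finite {w. rotate j w \<in> ?D N}" "card {w. rotate j w \<in> ?D N} \<le> card (?D N)" for j N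
  proof -
    have "{w. rotate j w \<in> ?D N} = rotate j -` ?D N"
      by blast
    then show "finite {w. rotate j w \<in> ?D N}" "card {w. rotate j w \<in> ?D N} \<le> card (?D N)"
      using finite_vimageI[OF finD[of N] inj] card_vimage_inj_on_le[OF inj finD[of N]] by simp_all
  qed
  have finR: "finite (?R N)" for N
    by (rule finite_reduced_words_length) simp
  have R: "real (card (?R N)) \<le> 2 * real (2 * k - 3) ^ N" for N
  proof -
    have "card ({1..k} - {i}) = k - 1"
      using i by simp
    then have "card (?R N) \<le> 2 * (2 * (k - 1) - 1) ^ N"
      using card_reduced_words_bounds(2)[of "{1..k} - {i}" N] k by simp
    also have "2 * (k - 1) - 1 = 2 * k - 3"
      using k by simp
    finally have "real (card (?R N)) \<le> real (2 * (2 * k - 3) ^ N)"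
      by (simp only: of_nat_le_iff)
    then show ?thesis
      by simp
  qed
  have "real (card (?A N)) \<le> (C + 2) * ((real N + 1) * real (2 * k - 3) ^ N)" for N
  proof -
    have "card (?A N) \<le> card (?R N \<union> (\<Union>j<N. {w. rotate j w \<in> ?D N}))"
      using finR rot(1) by (intro card_mono sub) auto
    also have "\<dots> \<le> card (?R N) + card (\<Union>j<N. {w. rotate j w \<in> ?D N})"
      by (rule card_Un_le)
    also have "card (\<Union>j<N. {w. rotate j w \<in> ?D N}) \<le> (\<Sum>j<N. card (?D N))"
      by (rule order_trans[OF card_UN_le sum_mono[OF rot(2)]]) simp
    finally have "real (card (?A N)) \<le> real (card (?R N) + N * card (?D N))"
      by (simp only: of_nat_le_iff sum_constant card_lessThan) simp
    also have "\<dots> = real (card (?R N)) + real N * real (card (?D N))"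
      by simp
    also have "\<dots> \<le> 2 * real (2 * k - 3) ^ N + real N * (C * real (2 * k - 3) ^ N)"
      using R C by (intro add_mono mult_left_mono) auto
    also have "\<dots> \<le> (C + 2) * ((real N + 1) * real (2 * k - 3) ^ N)"
      using \<open>C \<ge> 0\<close> by (simp add: algebra_simps)
    finally show ?thesis .
  qed
  then show ?thesis
    by blast
qed

section \<open>Cuts with boundedly many crossings\<close>

lemma card_few_crossings:
  assumes k: "k \<ge> 3" and Y: "Y \<subseteq> letters {1..k}" "card Y \<ge> 2" "card (letters {1..k} - Y) \<ge> 2"
    and nogen: "\<And>i. Y \<noteq> {y. fst y = i}" "\<And>i. letters {1..k} - Y \<noteq> {y. fst y = i}"
  shows "\<exists>C. \<forall>N. real (card {w. length w = N \<and> set w \<subseteq> letters {1..k} \<and> reduced w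
    \<and> crossings Y w \<le> K}) \<le> C * real (2 * k - 3) ^ N"
proof -
  let ?L = "letters {1..k}" and ?q = "2 * k - 3"
  define G where "G a b \<longleftrightarrow> b \<noteq> inv_letter a \<and> (inv_letter a \<in> Y \<longleftrightarrow> b \<in> Y)" for a b :: "nat letter"
  \<comment> \<open>The successor of \<open>a\<close> has to lie in \<open>side a\<close> to avoid a
    crossing. \<open>inv_letter a\<close> belongs to this set and is excluded by reducedness, so the
    degree is \<open>card (side a) - 1\<close>.\<close>
  define side where "side a = (if inv_letter a \<in> Y then Y else ?L - Y)" for a
  define low where "low a \<longleftrightarrow> card {b \<in> ?L. G a b} < ?q" for a
  have fin: "finite ?L" "finite Y"
    using finite_subset[OF Y(1)] by simp_all
  have total: "card Y + card (?L - Y) = 2 * k"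
  proof -
    have "card (?L - Y) = card ?L - card Y"
      using Y(1) fin by (intro card_Diff_subset)
    moreover have "card Y \<le> card ?L"
      using Y(1) fin by (intro card_mono)
    ultimately show ?thesis
      by (simp add: card_letters)
  qed
  have deg: "card {b \<in> ?L. G a b} = card (side a) - 1" if "a \<in> ?L" for a
  proof -
    have "{b \<in> ?L. G a b} = side a - {inv_letter a}" "inv_letter a \<in> side a"
      using that Y(1) by (auto simp: G_def side_def)
    then show ?thesis
      using fin by (simp add: side_def)
  qed
  have lowI: "low a" if a: "a \<in> ?L" and "card (side a) \<le> 2" for a
    using deg[OF a] that k by (simp add: low_def)
  \<comment> \<open>A letter \<open>a\<close> of degree \<open>2k - 3\<close> leaves only two
    letters for the opposite side \<open>T\<close>. They are not inverse to each other, so the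
    inverse of one of them can follow \<open>a\<close>, and the successors of that inverse are
    confined to \<open>T\<close>. If \<open>T\<close> were the pair of letters of a generator, no
    low letter could be reached from \<open>a\<close>; \<open>nogen\<close> rules this out.\<close>
  have reach: "\<exists>b\<in>?L. G a b \<and> low b"
    if a: "a \<in> ?L" and T: "T \<subseteq> ?L" "card T = 2" "inv_letter a \<notin> T" "\<And>i. T \<noteq> {y. fst y = i}"
      "T = Y \<or> T = ?L - Y" for a T
  proof -
    obtain x y where xy: "T = {x, y}" "x \<noteq> y"
      using T(2) by (auto simp: card_2_iff)
    have "y \<noteq> inv_letter x"
    proof
      assume "y = inv_letter x"
      then have "T = {z. fst z = fst x}"
        unfolding xy(1) set_eq_iff fst_eq_iff_letter by simp
      then show False
        using T(4) by blast
    qed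
    then have notin: "inv_letter x \<notin> T" "inv_letter y \<notin> T"
      using xy by (auto simp: inv_letter_swap)
    have main: "G a (inv_letter z) \<and> low (inv_letter z) \<and> inv_letter z \<in> ?L"
      if z: "z \<in> T" "inv_letter z \<notin> T" "inv_letter z \<noteq> inv_letter a" for z
    proof -
      have zL: "inv_letter z \<in> ?L" "inv_letter a \<in> ?L"
        using z(1) T(1) a by auto
      have "side (inv_letter z) = T"
        using z T(1,5) by (auto simp: side_def)
      moreover have "G a (inv_letter z)"
        using z T(3,5) zL by (auto simp: G_def)
      ultimately show ?thesis
        using lowI[of "inv_letter z"] zL T(2) by simp
    qed
    show ?thesis
    proof (cases "inv_letter x = inv_letter a")
      case False
      then show ?thesis
        using main[of x] xy notin by blast
    next
      case True
      then have "inv_letter y \<noteq> inv_letter a"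
        using xy(2) by simp
      then show ?thesis
        using main[of y] xy notin by blast
    qed
  qed
  have "\<exists>C. \<forall>N. real (card {w. length w = N \<and> set w \<subseteq> ?L \<and> defects G w \<le> K}) \<le> C * real ?q ^ N"
  proof (rule card_few_defects)
    show "finite ?L" "?q > 0"
      using k by auto
    show "card {b \<in> ?L. G a b} \<le> ?q" if a: "a \<in> ?L" for a
      using deg[OF a] total Y k by (auto simp: side_def)
    show "low a \<longleftrightarrow> card {b \<in> ?L. G a b} < ?q" for a
      by (simp add: low_def)
    show "low a \<or> (\<exists>b\<in>?L. G a b \<and> low b) \<or> (\<exists>b\<in>?L. G a b \<and> (\<exists>c\<in>?L. G b c \<and> low c))"
      if a: "a \<in> ?L" for a
    proof (cases "low a")
      case False
      then have big: "card (side a) \<ge> 2 * k - 2"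
        using deg[OF a] k by (simp add: low_def)
      have "\<exists>b\<in>?L. G a b \<and> low b"
      proof (cases "inv_letter a \<in> Y")
        case True
        then have "card (?L - Y) = 2"
          using big total Y k by (simp add: side_def)
        then show ?thesis
          using reach[of a "?L - Y"] a True nogen by blast
      next
        case False
        then have "card Y = 2"
          using big total Y k by (simp add: side_def)
        then show ?thesis
          using reach[of a Y] a False nogen Y(1) by blast
      qed
      then show ?thesis
        by blast
    qed simp
  qed
  then show ?thesis
  proof (rule card_bound_subset)
    have "defects G w = crossings Y w" if "reduced w" for w
      using that by (induction w rule: induct_list012) (auto simp: G_def reduced_Cons_iff)
    then show "{w. length w = N \<and> set w \<subseteq> ?L \<and> reduced w \<and> crossings Y w \<le> K}
        \<subseteq> {w. length w = N \<and> set w \<subseteq> ?L \<and> defects G w \<le> K}" for N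
      by auto
  qed (auto intro: finite_words_length)
qed

lemma bound_linear_factor:
  assumes "\<exists>C. \<forall>N. real (f N) \<le> C * q ^ N" "q \<ge> 0"
  shows "\<exists>C. \<forall>N. real (f N) \<le> C * ((real N + 1) * q ^ N)"
proof -
  obtain C where C: "\<And>N. real (f N) \<le> C * q ^ N"
    using assms(1) by blast
  have "0 \<le> C * q ^ 0"
    using order_trans[OF of_nat_0_le_iff C] by blast
  then have "C \<ge> 0"
    by simp
  have "C * q ^ N \<le> C * ((real N + 1) * q ^ N)" for N
    using \<open>C \<ge> 0\<close> assms(2) by (intro mult_left_mono) (auto simp: distrib_right)
  then show ?thesis
    using C order_trans by blast
qed

lemma crossings_snoc_ge: "crossings Y w \<le> crossings Y (w @ [x])"
  by (induction w rule: induct_list012) auto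

text \<open>If \<open>Y\<close> is a single letter, or if \<open>Y\<close> or its complement is the
  pair of letters of a generator, then few crossings alone would allow a higher power of
  \<open>N\<close>. Such words have few changes at one generator, and
  \<open>card_cyc_prims_few_changes\<close> uses their primitivity once more. All other sides are
  covered by \<open>card_few_crossings\<close>.\<close>

lemma card_cyc_prims_small_cut:
  assumes k: "k \<ge> 3"
  shows "\<exists>C. \<forall>N. real (card {w \<in> cyc_prims k. length w = N
    \<and> (\<exists>Y v. whitehead_cut {1..k} Y v w \<and> crossings Y (w @ [hd w]) \<le> K)})
        \<le> C * ((real N + 1) * real (2 * k - 3) ^ N)"
proof -
  let ?L = "letters {1..k}"
  let ?A = "\<lambda>N. {w \<in> cyc_prims k. length w = N
    \<and> (\<exists>Y v. whitehead_cut {1..k} Y v w \<and> crossings Y (w @ [hd w]) \<le> K)}"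
  let ?F = "\<lambda>i N. {w \<in> cyc_prims k. length w = N \<and> changes (\<lambda>y. fst y = i) (w @ [hd w]) \<le> 2 * K}"
  let ?I = "{Y. Y \<subseteq> ?L \<and> card Y \<ge> 2 \<and> card (?L - Y) \<ge> 2
    \<and> (\<forall>i. Y \<noteq> {y. fst y = i}) \<and> (\<forall>i. ?L - Y \<noteq> {y. fst y = i})}"
  let ?X = "\<lambda>Y N. {w. length w = N \<and> set w \<subseteq> ?L \<and> reduced w \<and> crossings Y w \<le> K}"
  have finI: "finite ?I"
    by (rule finite_subset[of _ "Pow ?L"]) auto
  have "\<exists>C. \<forall>N. real (card (\<Union>i\<in>{1..k}. ?F i N)) \<le> C * ((real N + 1) * real (2 * k - 3) ^ N)"
    using card_cyc_prims_few_changes[OF k] by (intro finite_bound_UN) auto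
  moreover
  have "\<exists>C. \<forall>N. real (card (?X Y N)) \<le> C * real (2 * k - 3) ^ N" if "Y \<in> ?I" for Y
    using that by (intro card_few_crossings[OF k]) auto
  then have "\<exists>C. \<forall>N. real (card (\<Union>Y\<in>?I. ?X Y N)) \<le> C * real (2 * k - 3) ^ N"
    using finI by (intro finite_bound_UN)
  then have "\<exists>C. \<forall>N. real (card (\<Union>Y\<in>?I. ?X Y N)) \<le> C * ((real N + 1) * real (2 * k - 3) ^ N)"
    by (rule bound_linear_factor) simp
  ultimately have bound: "\<exists>C. \<forall>N. real (card ((\<Union>i\<in>{1..k}. ?F i N) \<union> (\<Union>Y\<in>?I. ?X Y N)))
      \<le> C * ((real N + 1) * real (2 * k - 3) ^ N)"
    by (rule card_bound_Un)
  have sub: "?A N \<subseteq> (\<Union>i\<in>{1..k}. ?F i N) \<union> (\<Union>Y\<in>?I. ?X Y N)" for N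
  proof
    fix w assume "w \<in> ?A N"
    then obtain Y v where w: "w \<in> cyc_prims k" "length w = N" "crossings Y (w @ [hd w]) \<le> K"
      and cut: "whitehead_cut {1..k} Y v w"
      by blast
    note wp = cyc_primsD[OF w(1)]
    have Y: "Y \<subseteq> ?L" "Y \<noteq> {}" "v \<in> ?L" "v \<notin> Y" "inv_letter v \<notin> Y"
      using cut by (auto simp: whitehead_cut_def)
    have adjL: "inv_letter a \<in> ?L \<and> b \<in> ?L" if "(a, b) \<in> set (adj (w @ [hd w]))" for a b
      using set_adj_subset[OF that] wp(1,2) hd_in_set[OF wp(1)] by auto
    have gen: "w \<in> ?F i N" if "i \<in> {1..k}" "changes (\<lambda>y. fst y = i) (w @ [hd w]) \<le> 2 * K" for i
      using that w by simp
    have inL: "fst x \<in> {1..k}" if "x \<in> ?L" for x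
      using that by (cases x) (simp add: letters_def)
    consider x where "Y = {x}" | i where "Y = {y. fst y = i}" | i where "?L - Y = {y. fst y = i}"
      | "Y \<in> ?I"
    proof -
      have finY: "finite Y" "finite (?L - Y)"
        using finite_subset[OF Y(1)] by simp_all
      have "card {v, inv_letter v} \<le> card (?L - Y)"
        using Y finY by (intro card_mono) auto
      then have "card (?L - Y) \<ge> 2"
        by simp
      moreover have "card Y \<noteq> 0"
        using Y(2) finY by simp
      moreover have "card Y = 1 \<Longrightarrow> \<exists>x. Y = {x}"
        by (metis card_1_singletonE)
      ultimately show ?thesis
        using that Y(1) by (cases "card Y = 1") (blast, force)
    qed
    then show "w \<in> (\<Union>i\<in>{1..k}. ?F i N) \<union> (\<Union>Y\<in>?I. ?X Y N)"
    proof cases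
      case 1
      \<comment> \<open>This case is the reason for \<open>2 * K\<close>: here the crossings count
        the letters of the generator, and each of these takes part in at most two changes.\<close>
      have "changes (\<lambda>y. fst y = fst x) (w @ [hd w]) \<le> 2 * length (filter (\<lambda>y. fst y = fst x) w)"
        by (rule changes_cyclic_le[OF wp(1)])
      also have "\<dots> \<le> 2 * K"
        using w(3) crossings_singleton_cyclic[OF wp(1,3), of x] 1 by simp
      finally show ?thesis
        using gen inL[of x] Y(1) 1 by blast
    next
      case 2
      then have "i \<in> {1..k}"
        using Y(1,2) inL by blast
      moreover have "changes (\<lambda>y. fst y = i) (w @ [hd w]) \<le> 2 * K"
        using w(3) crossings_generator[of i] 2 by simp
      ultimately show ?thesis
        using gen by blast
    next
      case 3
      have "v \<in> ?L - Y"
        using Y by simp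
      then have "fst v = i"
        unfolding 3 by simp
      then have "i \<in> {1..k}"
        using Y(3) inL by blast
      moreover have "crossings Y (w @ [hd w]) = changes (\<lambda>y. fst y = i) (w @ [hd w])"
      proof -
        have "y \<in> Y \<longleftrightarrow> fst y \<noteq> i" if "y \<in> ?L" for y
          using that 3 Y(1) by blast
        then have eq: "((inv_letter a \<in> Y) \<noteq> (b \<in> Y)) = ((fst a = i) \<noteq> (fst b = i))"
          if "(a, b) \<in> set (adj (w @ [hd w]))" for a b
          using adjL[OF that] by auto
        then show ?thesis
          unfolding crossings_def changes_def
        proof (intro arg_cong[where f = length] filter_cong refl)
          fix p assume p: "p \<in> set (adj (w @ [hd w]))"
          obtain a b where ab: "p = (a, b)"
            by (cases p)
          show "(case p of (a, b) \<Rightarrow> (inv_letter a \<in> Y) \<noteq> (b \<in> Y))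
              = (case p of (a, b) \<Rightarrow> (fst a = i) \<noteq> (fst b = i))"
            unfolding ab prod.case by (rule eq) (use p ab in simp)
        qed
      qed
      ultimately have "w \<in> ?F i N"
        using w(3) by (intro gen) simp_all
      then show ?thesis
        using \<open>i \<in> {1..k}\<close> by blast
    next
      case 4
      have "crossings Y w \<le> crossings Y (w @ [hd w])"
        by (rule crossings_snoc_ge)
      then have "w \<in> ?X Y N"
        using w wp by simp
      then show ?thesis
        using 4 by blast
    qed
  qed
  have "finite (\<Union>i\<in>{1..k}. ?F i N)" for N
    by (intro finite_UN_I finite_subset[OF _ finite_cyc_prims[of k N]]) auto
  moreover have "finite (\<Union>Y\<in>?I. ?X Y N)" for N
    using finI by (intro finite_UN_I finite_words_length) auto
  ultimately show ?thesis
    by (intro card_bound_subset[OF bound sub] finite_UnI)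
qed

section \<open>Large cuts and the recursion on the length\<close>

lemma cyc_prims_large_cut:
  assumes w: "w \<in> cyc_prims k" and cut: "whitehead_cut {1..k} Y v w"
  obtains l where "l \<in> cyc_prims k" "length l + crossings Y (w @ [hd w]) = length w"
    "w = expand Y v l \<or> rotate1 w = expand Y v l"
proof (cases "head_survives Y v w")
  case True
  obtain l where "l \<in> cyc_prims k" "expand Y v l = w" "hd l = hd w"
    "length l + crossings Y (w @ [hd w]) = length w"
    by (rule cyc_prims_contract[OF w cut True]) blast
  then show ?thesis
    using that[of l] by simp
next
  case False
  \<comment> \<open>One rotation protects a first letter that the reduction would delete. It leaves
    at most two candidates for \<open>w\<close> once \<open>l\<close>, \<open>Y\<close> and
    \<open>v\<close> are known.\<close>
  have rot: "rotate1 w \<in> cyc_prims k" "whitehead_cut {1..k} Y v (rotate1 w)"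
    using cyc_prims_rotate1[OF w] cut by simp_all
  have "head_survives Y v (rotate1 w)"
    by (rule head_survives_rotate1[OF cut cyc_primsD(1,3)[OF w] False])
  then obtain l where l: "l \<in> cyc_prims k" "expand Y v l = rotate1 w" "hd l = hd (rotate1 w)"
    "length l + crossings Y (rotate1 w @ [hd (rotate1 w)]) = length (rotate1 w)"
    by (rule cyc_prims_contract[OF rot]) blast
  have "crossings Y (rotate1 w @ [hd (rotate1 w)]) = crossings Y (w @ [hd w])"
    unfolding crossings_def by (rule cyclic_count_rotate1)
  then show ?thesis
    using that[OF l(1)] l(2,4) by simp
qed

lemma card_cyc_prims:
  assumes k: "k \<ge> 3"
  shows "\<exists>C. \<forall>N. real (card {w \<in> cyc_prims k. length w = N})
      \<le> C * ((real N + 1) * real (2 * k - 3) ^ N)"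
proof -
  define q where "q = real (2 * k - 3)"
  have q: "q \<ge> 3"
    using k by (simp add: q_def)
  let ?L = "letters {1..k}"
  let ?A = "\<lambda>N. {w \<in> cyc_prims k. length w = N}"
  define W where "W = card (Pow ?L) * card ?L"
  \<comment> \<open>\<open>W\<close> counts the pairs of a side and a vertex, and the rotation
    contributes the factor 2. With this \<open>m\<close> the shortenings by more than
    \<open>m\<close> have total weight at most \<open>1 / (q - 1) \<le> 1 / 2\<close>.\<close>
  obtain m where m: "2 * real W \<le> q ^ m"
    using real_arch_pow[of q "2 * real W"] q by (auto intro: less_imp_le)
  let ?S = "\<lambda>N. {w \<in> cyc_prims k. length w = N
    \<and> (\<exists>Y v. whitehead_cut {1..k} Y v w \<and> crossings Y (w @ [hd w]) \<le> m)}"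
  obtain C where C: "\<And>N. real (card (?S N)) \<le> C * ((real N + 1) * q ^ N)"
    using card_cyc_prims_small_cut[OF k, of m] unfolding q_def by blast
  have "0 \<le> C * ((real 0 + 1) * q ^ 0)"
    using order_trans[OF of_nat_0_le_iff C] by blast
  then have "C \<ge> 0"
    by simp
  define \<alpha> where "\<alpha> d = (if d \<ge> Suc m then 2 * real W else 0)" for d
  have rec: "real (card (?A N)) \<le> C * (real N + 1) * q ^ N
      + (\<Sum>d=1..N. \<alpha> d * real (card (?A (N - d))))" for N
  proof -
    let ?D = "{d \<in> {1..N}. d \<ge> Suc m}"
    let ?J = "Pow ?L \<times> ?L"
    let ?X = "\<lambda>(Y, v). \<Union>d\<in>?D. expand Y v ` ?A (N - d) \<union> {w. rotate1 w \<in> expand Y v ` ?A (N - d)}"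
    have sub: "?A N \<subseteq> ?S N \<union> (\<Union>p\<in>?J. ?X p)"
    proof
      fix w assume "w \<in> ?A N"
      then have w: "w \<in> cyc_prims k" "length w = N"
        by simp_all
      obtain Y v where cut: "whitehead_cut {1..k} Y v w"
        by (rule cyc_prims_cut[OF w(1)]) (use k in auto)
      obtain l where l: "l \<in> cyc_prims k" "length l + crossings Y (w @ [hd w]) = length w"
        "w = expand Y v l \<or> rotate1 w = expand Y v l"
        by (rule cyc_prims_large_cut[OF w(1) cut])
      show "w \<in> ?S N \<union> (\<Union>p\<in>?J. ?X p)"
      proof (cases "crossings Y (w @ [hd w]) \<le> m")
        case True
        then have "w \<in> ?S N"
          using w cut by blast
        then show ?thesis
          by blast
      next
        case False
        define d where "d = crossings Y (w @ [hd w])"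
        have d: "d \<in> ?D" and "l \<in> ?A (N - d)"
          using False l w(2) by (auto simp: d_def)
        then have "w \<in> expand Y v ` ?A (N - d) \<union> {w. rotate1 w \<in> expand Y v ` ?A (N - d)}"
          using l(3) by blast
        then have "w \<in> ?X (Y, v)"
          unfolding prod.case by (rule UN_I[OF d])
        moreover have "(Y, v) \<in> ?J"
          using cut by (auto simp: whitehead_cut_def)
        ultimately have "w \<in> (\<Union>p\<in>?J. ?X p)"
          by (rule UN_I[rotated])
        then show ?thesis
          by blast
      qed
    qed
    have finA: "finite (?A n)" for n
      by (rule finite_cyc_prims)
    have fin: "finite (expand Y v ` ?A n)" "finite {w. rotate1 w \<in> expand Y v ` ?A n}"
      and card: "card (expand Y v ` ?A n \<union> {w. rotate1 w \<in> expand Y v ` ?A n})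
          \<le> 2 * card (?A n)" for Y v n
    proof -
      have eq: "{w. rotate1 w \<in> expand Y v ` ?A n} = rotate1 -` (expand Y v ` ?A n)"
        by blast
      show f: "finite (expand Y v ` ?A n)"
        using finA by simp
      then show "finite {w. rotate1 w \<in> expand Y v ` ?A n}"
        unfolding eq by (rule finite_vimageI) (rule inj_rotate1)
      have "card (expand Y v ` ?A n \<union> {w. rotate1 w \<in> expand Y v ` ?A n})
          \<le> card (expand Y v ` ?A n) + card (rotate1 -` (expand Y v ` ?A n))"
        unfolding eq by (rule card_Un_le)
      also have "card (rotate1 -` (expand Y v ` ?A n)) \<le> card (expand Y v ` ?A n)"
        using card_vimage_inj_on_le[OF inj_rotate1 f] by simp
      also have "card (expand Y v ` ?A n) \<le> card (?A n)"
        using finA by (rule card_image_le)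
      finally show "card (expand Y v ` ?A n \<union> {w. rotate1 w \<in> expand Y v ` ?A n}) \<le> 2 * card (?A n)"
        by linarith
    qed
    have finX: "finite (?X p)" for p
      using fin by (cases p) auto
    have cardX: "card (?X p) \<le> (\<Sum>d\<in>?D. 2 * card (?A (N - d)))" for p
    proof -
      obtain Y v where p: "p = (Y, v)"
        by (cases p)
      show ?thesis
        unfolding p prod.case by (rule order_trans[OF card_UN_le sum_mono[OF card]]) simp
    qed
    have finS: "finite (?S N)"
      by (rule finite_subset[OF _ finA[of N]]) auto
    have finJ: "finite ?J"
      by simp
    have "card (?A N) \<le> card (?S N \<union> (\<Union>p\<in>?J. ?X p))"
      using finS finJ finX by (intro card_mono sub finite_UnI finite_UN_I)
    also have "\<dots> \<le> card (?S N) + card (\<Union>p\<in>?J. ?X p)"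
      by (rule card_Un_le)
    also have "card (\<Union>p\<in>?J. ?X p) \<le> (\<Sum>p\<in>?J. \<Sum>d\<in>?D. 2 * card (?A (N - d)))"
      by (rule order_trans[OF card_UN_le[OF finJ] sum_mono[OF cardX]])
    also have "\<dots> = W * (\<Sum>d\<in>?D. 2 * card (?A (N - d)))"
      by (simp only: sum_constant card_cartesian_product W_def of_nat_id)
    finally have "real (card (?A N)) \<le> real (card (?S N) + W * (\<Sum>d\<in>?D. 2 * card (?A (N - d))))"
      by (simp only: of_nat_le_iff)
    also have "\<dots> = real (card (?S N)) + (\<Sum>d\<in>?D. 2 * real W * real (card (?A (N - d))))"
      by (simp add: sum_distrib_left mult_ac)
    also have "(\<Sum>d\<in>?D. 2 * real W * real (card (?A (N - d))))
        = (\<Sum>d=1..N. \<alpha> d * real (card (?A (N - d))))"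
      unfolding \<alpha>_def by (subst sum.inter_filter) (auto intro: sum.cong)
    finally show ?thesis
      using C[of N] by (simp add: mult.assoc)
  qed
  have sum: "(\<Sum>d=1..N. \<alpha> d / q ^ d) \<le> 1 / 2" for N
  proof -
    have "(\<Sum>d=1..N. \<alpha> d / q ^ d) = 2 * real W * (\<Sum>d=1..N. if d \<ge> Suc m then 1 / q ^ d else 0)"
      unfolding sum_distrib_left \<alpha>_def by (intro sum.cong refl) simp
    also have "\<dots> \<le> 2 * real W * (1 / (q ^ m * (q - 1)))"
      using q by (intro mult_left_mono sum_power_ge_le) auto
    also have "\<dots> \<le> q ^ m * (1 / (q ^ m * (q - 1)))"
      using m q by (intro mult_right_mono) auto
    also have "\<dots> = 1 / (q - 1)"
      using q by simp
    also have "\<dots> \<le> 1 / 2"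
      using q by (simp add: field_simps)
    finally show ?thesis .
  qed
  have "real (card (?A N)) \<le> C / (1 - 1 / 2) * (real N + 1) * q ^ N" for N
    using q \<open>C \<ge> 0\<close> rec sum
    by (intro convolution_bound[where f = "\<lambda>N. real (card (?A N))" and \<alpha> = \<alpha> and g
        = "\<lambda>N. real N + 1"])
      (auto simp: mono_def \<alpha>_def)
  then show ?thesis
    unfolding q_def mult.assoc by blast
qed

section \<open>Counting primitive elements\<close>

lemma cyclic_core:
  assumes "reduced w" "w \<noteq> []"
  obtains u c where "w = u @ c @ inv_word u" "c \<noteq> []" "cyc_reduced c"
  using assms
proof (induction "length w" arbitrary: w thesis rule: less_induct)
  case less
  show ?case
  proof (cases "cyc_reduced w")
    case True
    then show ?thesis
      using less.prems(1)[of "[]" w] less.prems(3) by simp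
  next
    case False
    then have h: "hd w = inv_letter (last w)"
      using less.prems(2,3) by (simp add: cyc_reduced_def reduced_append_iff)
    obtain x v where xv: "w = x # v"
      using less.prems(3) by (cases w) auto
    then have "v \<noteq> []"
      using h by auto
    then obtain c where c: "w = x # c @ [inv_letter x]"
      using h xv by (cases v rule: rev_cases) auto
    then have "c \<noteq> []" "reduced c"
      using less.prems(2) by (auto simp: reduced_Cons_iff reduced_append_iff)
    moreover have "length c < length w"
      using c by simp
    ultimately obtain u d where "c = u @ d @ inv_word u" "d \<noteq> []" "cyc_reduced d"
      using less.hyps by blast
    then show ?thesis
      using less.prems(1)[of "x # u" d] c by simp
  qed
qed

lemma Nil_not_primitive: "\<not> primitive (free_group A) []"
proof
  assume "primitive (free_group A) []"
  then obtain S where S: "is_basis (free_group A) S" "[] \<in> S"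
    by (auto simp: primitive_def)
  interpret group "free_group A"
    by (rule group_free_group)
  have "[([], True)] \<in> reduced_words S"
    using S(2) by (simp add: reduced_words_def)
  moreover have "word_value (free_group A) [([], True)] = \<one>\<^bsub>free_group A\<^esub>"
    by (simp add: word_value_Cons) (simp add: free_group_def)
  ultimately show False
    using S(1) by (auto simp: is_basis_def)
qed

lemma P_subset:
  "P k N \<subseteq> (\<Union>m\<in>{m. 2 * m \<le> N}. (\<lambda>(u, c). u @ c @ inv_word u) `
     ({u \<in> reduced_words {1..k}. length u = m} \<times> {c \<in> cyc_prims k. length c = N - 2 * m}))"
  (is "_ \<subseteq> ?X")
proof
  fix w assume "w \<in> P k N"
  then have w: "set w \<subseteq> letters {1..k}" "reduced w" "primitive (F k) w" "length w = N"
    by (simp_all add: P_def free_group_def reduced_words_iff)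
  then have "w \<noteq> []"
    using Nil_not_primitive by auto
  then obtain u c where uc: "w = u @ c @ inv_word u" "c \<noteq> []" "cyc_reduced c"
    using cyclic_core[OF w(2)] by metis
  have "prim k w"
    using w by (simp add: prim_def set_subset_letters reduce_eq_self)
  moreover have c: "set c \<subseteq> letters {1..k}" "set u \<subseteq> letters {1..k}" "reduced u"
    using w(1,2) uc(1) by (simp_all add: reduced_append_iff)
  ultimately have "prim k c"
    using prim_conj[of k u c] uc(1) by (simp add: set_subset_letters)
  then have "c \<in> cyc_prims k"
    using uc c by (simp add: cyc_prims_def)
  moreover have "2 * length u \<le> N" "length c = N - 2 * length u"
    using w(4) uc(1) by simp_all
  ultimately show "w \<in> ?X"
    using uc(1) c by (intro UN_I[of "length u"] image_eqI[of _ _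
        "(u, c)"]) (simp_all add: reduced_words_iff)
qed

lemma P_upper:
  assumes k: "k \<ge> 3"
  shows "\<exists>C. \<forall>N. real (card (P k N)) \<le> C * ((real N + 1) * real (2 * k - 3) ^ N)"
proof -
  define q where "q = real (2 * k - 3)"
  have q: "q \<ge> 3" and q2: "real (2 * k - 1) = q + 2"
    using k by (simp_all add: q_def)
  \<comment> \<open>A conjugator of length \<open>m\<close> has at most
    \<open>2 * (q + 2) ^ m\<close> choices and takes \<open>2 * m\<close> letters away from the
    cyclically reduced core, so its contribution decays like \<open>1 / x ^ m\<close>; this is
    summable because \<open>q + 2 < q^2\<close>.\<close>
  define x where "x = q\<^sup>2 / (q + 2)"
  have "q + 2 < q\<^sup>2"
  proof -
    have "q * 3 \<le> q * q"
      using q by (intro mult_left_mono) auto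
    then show ?thesis
      using q unfolding power2_eq_square by linarith
  qed
  then have x: "x > 1"
    using q by (simp add: x_def)
  let ?A = "\<lambda>n. {c \<in> cyc_prims k. length c = n}"
  let ?U = "\<lambda>m. {u \<in> reduced_words {1..k}. length u = m}"
  let ?M = "\<lambda>N. {m. 2 * m \<le> N}"
  obtain C where C: "\<And>N. real (card (?A N)) \<le> C * ((real N + 1) * q ^ N)"
    using card_cyc_prims[OF k] unfolding q_def by blast
  have "0 \<le> C * ((real 0 + 1) * q ^ 0)"
    using order_trans[OF of_nat_0_le_iff C] by blast
  then have "C \<ge> 0"
    by simp
  have "real (card (P k N)) \<le> (2 * C * (x / (x - 1))) * ((real N + 1) * q ^ N)" for N
  proof -
    have finM: "finite (?M N)"
      by (rule finite_subset[of _ "{..N}"]) auto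
    have fin: "finite (?U m \<times> ?A n)" for m n
      using finite_reduced_words_length[of "{1..k}"] finite_cyc_prims
          by (intro finite_cartesian_product) auto
    have "card (P k N) \<le> card (\<Union>m\<in>?M N. (\<lambda>(u, c). u @ c @ inv_word u) ` (?U m \<times> ?A (N - 2 * m)))"
      using finM fin by (intro card_mono P_subset finite_UN_I finite_imageI)
    also have "\<dots> \<le> (\<Sum>m\<in>?M N. card (?U m) * card (?A (N - 2 * m)))"
    proof (intro order_trans[OF card_UN_le[OF finM]] sum_mono)
      fix m
      show "card ((\<lambda>(u, c). u @ c @ inv_word u) ` (?U m \<times> ?A (N - 2 * m)))
          \<le> card (?U m) * card (?A (N - 2 * m))"
        using card_image_le[OF fin] by (simp only: card_cartesian_product)
    qed
    finally have "real (card (P k N)) \<le> real (\<Sum>m\<in>?M N. card (?U m) * card (?A (N - 2 * m)))"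
      by (simp only: of_nat_le_iff)
    also have "\<dots> = (\<Sum>m\<in>?M N. real (card (?U m)) * real (card (?A (N - 2 * m))))"
      by simp
    also have "\<dots> \<le> (\<Sum>m\<in>?M N. 2 * C * ((real N + 1) * q ^ N) * (1 / x ^ m))"
    proof (rule sum_mono)
      fix m assume "m \<in> ?M N"
      then have m: "2 * m \<le> N"
        by simp
      have "card (?U m) \<le> 2 * (2 * k - 1) ^ m"
        using card_reduced_words_bounds(2)[of "{1..k}" m] k by simp
      then have "real (card (?U m)) \<le> real (2 * (2 * k - 1) ^ m)"
        by (simp only: of_nat_le_iff)
      then have U: "real (card (?U m)) \<le> 2 * (q + 2) ^ m"
        by (simp add: q2)
      have "real (card (?A (N - 2 * m))) \<le> C * ((real (N - 2 * m) + 1) * q ^ (N - 2 * m))"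
        by (rule C)
      also have "\<dots> \<le> C * ((real N + 1) * q ^ (N - 2 * m))"
        using \<open>C \<ge> 0\<close> q by (intro mult_left_mono mult_right_mono) auto
      also have "q ^ (N - 2 * m) = q ^ N / (q\<^sup>2) ^ m"
        using q m by (simp add: power_diff power_mult)
      finally have A: "real (card (?A (N - 2 * m))) \<le> C * ((real N + 1) * (q ^ N / (q\<^sup>2) ^ m))" .
      have "real (card (?U m)) * real (card (?A (N - 2 * m)))
          \<le> (2 * (q + 2) ^ m) * (C * ((real N + 1) * (q ^ N / (q\<^sup>2) ^ m)))"
        using q by (intro mult_mono U A) auto
      also have "\<dots> = 2 * C * ((real N + 1) * q ^ N) * ((q + 2) ^ m / (q\<^sup>2) ^ m)"
        by simp
      also have "(q + 2) ^ m / (q\<^sup>2) ^ m = 1 / x ^ m"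
        by (simp add: x_def power_divide)
      finally show "real (card (?U m)) * real (card (?A (N - 2 * m)))
          \<le> 2 * C * ((real N + 1) * q ^ N) * (1 / x ^ m)" .
    qed
    also have "\<dots> = 2 * C * ((real N + 1) * q ^ N) * (\<Sum>m\<in>?M N. 1 / x ^ m)"
      by (simp only: sum_distrib_left)
    also have "\<dots> \<le> 2 * C * ((real N + 1) * q ^ N) * (x / (x - 1))"
    proof (rule mult_left_mono)
      have "(\<Sum>m\<in>?M N. 1 / x ^ m) \<le> (\<Sum>m\<le>N. 1 / x ^ m)"
        using x by (intro sum_mono2) auto
      also have "\<dots> \<le> x / (x - 1)"
        by (rule sum_power_le[OF x])
      finally show "(\<Sum>m\<in>?M N. 1 / x ^ m) \<le> x / (x - 1)" .
    qed (use \<open>C \<ge> 0\<close> q in auto)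
    finally show ?thesis
      by (simp only: mult_ac)
  qed
  then show ?thesis
    unfolding q_def by blast
qed

section \<open>Lower bound\<close>

lemma primitive_single_occurrence:
  assumes i: "i \<in> {1..k}" and u: "u \<in> reduced_words ({1..k} - {i})" and v:
      "v \<in> reduced_words ({1..k} - {i})"
  shows "u @ (i, True) # v \<in> P k (Suc (length u + length v))"
proof -
  \<comment> \<open>\<open>f\<close> multiplies the generator \<open>i\<close> by \<open>u\<close>
    on the left and by \<open>v\<close> on the right and fixes the other generators. As
    \<open>u\<close> and \<open>v\<close> avoid \<open>i\<close>, both maps fix them, and
    \<open>g\<close> is the inverse of \<open>f\<close>.\<close>
  define f where "f x = (if x = (i, True) then u @ [(i, True)] @ v
    else if x = (i, False) then inv_word v @ [(i, False)] @ inv_word u else [x])" for x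
  define g where "g x = (if x = (i, True) then inv_word u @ [(i, True)] @ inv_word v
    else if x = (i, False) then v @ [(i, False)] @ u else [x])" for x
  have ni: "(i, b) \<notin> set u" "(i, b) \<notin> set v" for b
    using u v by (auto simp: reduced_words_def)
  have ni': "(i, b) \<notin> set (inv_word u)" "(i, b) \<notin> set (inv_word v)" for b
  proof -
    have "fst ` set (inv_word u) \<subseteq> {1..k} - {i}" "fst ` set (inv_word v) \<subseteq> {1..k} - {i}"
      using u v by (simp_all add: reduced_words_def)
    then show "(i, b) \<notin> set (inv_word u)" "(i, b) \<notin> set (inv_word v)"
      by (fastforce, fastforce)
  qed
  have triv: "subst f w = w" "subst g w = w" if "\<And>b. (i, b) \<notin> set w" for w
    using that by (induction w) (auto simp: f_def g_def)
  have inv: "inv_letter (i, True) = (i, False)" "inv_letter (i, False) = (i, True)"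
    by (simp_all add: inv_letter_def)
  have inv_iff: "inv_letter x = (i, b) \<longleftrightarrow> x = (i, \<not> b)" for x b
    by (cases x) (auto simp: inv_letter_def)
  have compat: "inv_compatible f" "inv_compatible g"
    unfolding inv_compatible_def f_def g_def by (auto simp: inv_iff inv)
  have letters: "fst ` set (f x) \<subseteq> {1..k}" "fst ` set (g x) \<subseteq> {1..k}" if "fst x \<in> {1..k}" for x
    using that u v i by (auto simp: f_def g_def reduced_words_def image_Un)
  have cancel: "reduce (x # b @ inv_word b) = [x]" "reduce (x # inv_word b @ b) = [x]"
    for b and x :: "nat letter"
    using reduce_append_inv_word_cancel(2)[of "[x]" b "[]"] reduce_append_inv_word_cancel(1)[of
        "[x]" b "[]"]
    by (simp_all add: reduce_eq_self)
  have fg: "reduce (subst f (g x)) = [x]" for x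
  proof -
    consider "x = (i, True)" | "x = (i, False)" | "x \<noteq> (i, True)" "x \<noteq> (i, False)"
      by blast
    then show ?thesis
      by cases (simp_all add: g_def triv ni ni', simp_all add: f_def cancel reduce_eq_self)
  qed
  have gf: "reduce (subst g (f x)) = [x]" for x
  proof -
    consider "x = (i, True)" | "x = (i, False)" | "x \<noteq> (i, True)" "x \<noteq> (i, False)"
      by blast
    then show ?thesis
      by cases (simp_all add: f_def triv ni ni', simp_all add: g_def cancel reduce_eq_self)
  qed
  have iso: "subst_hom f \<in> iso (F k) (F k)"
    by (rule subst_hom_iso[where g = g]) (use compat letters fg gf in blast)+
  have "primitive (F k) [(i, True)]"
    using is_basis_generators[of "{1..k}"] i unfolding primitive_def by blast
  then have "primitive (F k) (subst_hom f [(i, True)])"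
    by (rule primitive_iso[OF group_free_group group_free_group iso])
  moreover have red: "reduced (u @ (i, True) # v)"
  proof -
    have "hd v \<noteq> inv_letter (i, True)" if "v \<noteq> []"
      using hd_in_set[OF that] ni(2) by (metis inv(1))
    moreover have "(i, True) \<noteq> inv_letter (last u)" if "u \<noteq> []"
      using last_in_set[OF that] ni(1) by (metis inv_iff)
    ultimately show ?thesis
      using u v by (auto simp: reduced_words_iff reduced_append_iff reduced_Cons_iff)
  qed
  moreover have "subst_hom f [(i, True)] = u @ (i, True) # v"
    using red by (simp add: subst_hom_def f_def reduce_eq_self)
  ultimately show ?thesis
    using u v i by (auto simp: P_def free_group_def reduced_words_def)
qed

lemma P_lower:
  assumes k: "k \<ge> 3"
  shows "N * (2 * k - 3) ^ (N - 1) \<le> card (P k N)"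
proof (cases N)
  case (Suc n)
  let ?A = "{1..k} - {1}"
  let ?R = "\<lambda>m. {w \<in> reduced_words ?A. length w = m}"
  let ?f = "\<lambda>(j :: nat, u, v). u @ (1, True) # v :: nat word"
  \<comment> \<open>\<open>j\<close> is the position of the letter \<open>(1, True)\<close>. There
    are \<open>Suc n = N\<close> positions, each with at least \<open>(2k - 3)^n\<close> ways to
    fill the rest.\<close>
  let ?I = "SIGMA j : {..n}. ?R j \<times> ?R (n - j)"
  have fin: "finite (?R m)" for m
    by (rule finite_reduced_words_length) simp
  have cardA: "card ?A = k - 1"
    using k by simp
  have R: "(2 * k - 3) ^ m \<le> card (?R m)" for m
  proof -
    have "(2 * card ?A - 1) ^ m \<le> card (?R m)"
      by (rule card_reduced_words_bounds(1)) (use k cardA in auto)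
    moreover have "2 * card ?A - 1 = 2 * k - 3"
      using k cardA by simp
    ultimately show ?thesis
      by simp
  qed
  have notin: "(1, True) \<notin> set u" if "u \<in> reduced_words ?A" for u
    using that by (auto simp: reduced_words_def)
  have "inj_on ?f ?I"
  proof (rule inj_onI)
    fix x y assume xy: "x \<in> ?I" "y \<in> ?I" "?f x = ?f y"
    obtain j u v where x: "x = (j, u, v)"
      by (cases x)
    obtain j' u' v' where y: "y = (j', u', v')"
      by (cases y)
    have "u \<in> reduced_words ?A" "v \<in> reduced_words ?A" "length u = j" "length u' = j'"
      using xy(1,2) by (simp_all add: x y)
    moreover have "u @ (1, True) # v = u' @ (1, True) # v'"
      using xy(3) by (simp add: x y)
    ultimately show "x = y"
      using append_Cons_eq_iff[of "(1, True)" u v u' v'] notin by (auto simp: x y)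
  qed
  moreover have "?f ` ?I \<subseteq> P k N"
  proof
    fix w assume "w \<in> ?f ` ?I"
    then obtain j u v where w: "w = u @ (1, True) # v" "u \<in> reduced_words ?A" "v \<in> reduced_words ?A"
      "length u + length v = n"
      by auto
    then show "w \<in> P k N"
      using primitive_single_occurrence[of 1 k u v] k Suc by simp
  qed
  ultimately have "card ?I \<le> card (P k N)"
    using finite_P by (rule card_inj_on_le)
  moreover have "card ?I = (\<Sum>j\<le>n. card (?R j) * card (?R (n - j)))"
    using fin by (simp add: card_cartesian_product)
  moreover have "(\<Sum>j\<le>n. (2 * k - 3) ^ n) \<le> (\<Sum>j\<le>n. card (?R j) * card (?R (n - j)))"
  proof (rule sum_mono)
    fix j assume "j \<in> {..n}"
    then have "(2 * k - 3) ^ n = (2 * k - 3) ^ j * (2 * k - 3) ^ (n - j)"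
      by (simp flip: power_add)
    also have "\<dots> \<le> card (?R j) * card (?R (n - j))"
      by (intro mult_mono R) auto
    finally show "(2 * k - 3) ^ n \<le> card (?R j) * card (?R (n - j))" .
  qed
  ultimately show ?thesis
    using Suc by simp
qed simp

section \<open>From the two-sided bounds to the limit of the roots\<close>

lemma root_linear_times_power:
  fixes f :: "nat \<Rightarrow> real"
  assumes "c > 0" "C > 0" "q > 0"
    and lower: "\<And>N. N \<ge> 1 \<Longrightarrow> c * real N * q ^ N \<le> f N"
    and upper: "\<And>N. N \<ge> 1 \<Longrightarrow> f N \<le> C * real N * q ^ N"
  shows "(\<lambda>N. root N (f N)) \<longlonglongrightarrow> q"
proof -
  have lim: "(\<lambda>N. root N (d * real N * q ^ N)) \<longlonglongrightarrow> q" if "d > 0" for d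
  proof -
    have "(\<lambda>N. root N d * root N (real N) * q) \<longlonglongrightarrow> 1 * 1 * q"
      by (intro tendsto_mult LIMSEQ_root LIMSEQ_root_const tendsto_const that)
    moreover have "\<forall>\<^sub>F N in sequentially. root N d * root N (real N) * q
        = root N (d * real N * q ^ N)"
      using eventually_gt_at_top[of 0]
    proof eventually_elim
      case (elim N)
      then show ?case
        using assms(3) by (simp add: real_root_mult real_root_power_cancel)
    qed
    ultimately show ?thesis
      by (simp add: tendsto_cong)
  qed
  show ?thesis
  proof (rule tendsto_sandwich[OF _ _ lim[OF assms(1)] lim[OF assms(2)]])
    show "\<forall>\<^sub>F N in sequentially. root N (c * real N * q ^ N) \<le> root N (f N)"
      using eventually_ge_at_top[of 1] by eventually_elim (simp add: lower)
    show "\<forall>\<^sub>F N in sequentially. root N (f N) \<le> root N (C * real N * q ^ N)"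
      using eventually_ge_at_top[of 1] by eventually_elim (simp add: upper)
  qed
qed

theorem theorem1p1:
  fixes k :: nat
  assumes "k \<ge> 3"
  shows "rho k = ereal (2 * real k - 3)
    \<and> (\<lambda>N. root N (real (card (P k N)))) \<longlonglongrightarrow> 2 * real k - 3
    \<and> (\<exists>c C :: real. c > 0 \<and> C > 0 \<and>
          (\<forall>N \<ge> 1. c * real N * (2 * real k - 3) ^ N \<le> real (card (P k N)) \<and>
                   real (card (P k N)) \<le> C * real N * (2 * real k - 3) ^ N))"
proof -
  define q where "q = 2 * real k - 3"
  have q: "q \<ge> 3" "real (2 * k - 3) = q"
    using assms by (simp_all add: q_def)
  obtain C where C: "\<And>N. real (card (P k N)) \<le> C * ((real N + 1) * q ^ N)"
    using P_upper[OF assms] unfolding q(2) by blast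
  \<comment> \<open>The factor 2 absorbs \<open>N + 1 \<le> 2 * N\<close> for
    \<open>N \<ge> 1\<close>, and the maximum makes the constant positive.\<close>
  define C' where "C' = max 1 (2 * C)"
  have lower: "1 / q * real N * q ^ N \<le> real (card (P k N))" if "N \<ge> 1" for N
  proof -
    have "real (N * (2 * k - 3) ^ (N - 1)) \<le> real (card (P k N))"
      using P_lower[OF assms, of N] by (simp only: of_nat_le_iff)
    moreover have "q ^ N = q * q ^ (N - 1)"
      using that by (cases N) simp_all
    ultimately show ?thesis
      using q by (simp add: q(2))
  qed
  have upper: "real (card (P k N)) \<le> C' * real N * q ^ N" if "N \<ge> 1" for N
  proof -
    have "0 \<le> C * ((real 0 + 1) * q ^ 0)"
      using order_trans[OF of_nat_0_le_iff C] by blast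
    then have "C * (real N + 1) \<le> C * (2 * real N)"
      using that by (intro mult_left_mono) auto
    also have "\<dots> \<le> C' * real N"
    proof -
      have "2 * C * real N \<le> C' * real N"
        by (rule mult_right_mono) (simp_all add: C'_def)
      then show ?thesis
        by simp
    qed
    finally have "C * (real N + 1) * q ^ N \<le> C' * real N * q ^ N"
      using q by (intro mult_right_mono) auto
    then show ?thesis
      using C[of N] by (simp add: mult.assoc)
  qed
  have pos: "1 / q > 0" "C' > 0"
    using q by (simp_all add: C'_def)
  have lim: "(\<lambda>N. root N (real (card (P k N)))) \<longlonglongrightarrow> q"
    using pos q(1) lower upper by (intro root_linear_times_power[of "1 / q" C' q]) auto
  then have "rho k = ereal q"
    unfolding rho_def by (intro lim_imp_Limsup) auto
  moreover have "\<exists>c C :: real. c > 0 \<and> C > 0 \<and>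
      (\<forall>N \<ge> 1. c * real N * q ^ N \<le> real (card (P k N)) \<and> real (card (P k N)) \<le> C * real N * q ^ N)"
    using pos lower upper by blast
  ultimately show ?thesis
    using lim unfolding q_def by blast
qed

end
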